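(* A non-holomorphic symplectic critical surface in a Kähler surface has at most finitely many complex points.
   Context: A Kähler surface $M$ (complex dimension 2) has Kähler form $\omega$, compatible complex structure $J$, and metric $\langle U,V\rangle=\omega(U,JV)$. For a closed oriented real surface $\Sigma$ smoothly immersed in $M$, the Kähler angle $\alpha$ is defined by $\omega|_\Sigma=\cos\alpha\, d\mu_\Sigma$, where $d\mu_\Sigma$ is the area element of the induced metric. $\Sigma$ is symplectic if $\cos\alpha>0$ everywhere, and is a holomorphic curve (holomorphic) if $\cos\alpha\equiv1$. A symplectic critical surface is a closed symplectic immersed surface which is a critical point, among symplectic surfaces, of $L=\int_\Sigma\frac1{\cos\alpha}d\mu_\Sigma$; equivalently $\cos^3\alpha\, H=(J(J\nabla\cos\alpha)^\top)^\bot$, where $H$ is the mean curvature vector (trace of the second fundamental form), $\nabla$ is the gradient of the induced metric, and $(\cdot)^\top,(\cdot)^\bot$ are the components tangent and normal to $\Sigma$. A complex (tangent) point is a point $p\in\Sigma$ with $\alpha(p)=0$, i.e. at which the tangent plane of $\Sigma$ is a complex line. *)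

theory Defs
  imports "HOL-Analysis.Analysis"
begin

section \<open>Smooth maps between open subsets of Euclidean spaces\<close>

primrec times_differentiable_on ::
  "nat \<Rightarrow> ('a::euclidean_space \<Rightarrow> 'b::euclidean_space) \<Rightarrow> 'a set \<Rightarrow> bool" where
  "times_differentiable_on 0 f S \<longleftrightarrow> continuous_on S f"
| "times_differentiable_on (Suc n) f S \<longleftrightarrow>
     (\<forall>x\<in>S. f differentiable (at x)) \<and>
     (\<forall>v. times_differentiable_on n (\<lambda>x. frechet_derivative f (at x) v) S)"

text \<open>Only used for open \<open>S\<close>.\<close>

definition smooth_on :: "('a::euclidean_space \<Rightarrow> 'b::euclidean_space) \<Rightarrow> 'a set \<Rightarrow> bool" where
  "smooth_on f S \<longleftrightarrow> (\<forall>n. times_differentiable_on n f S)"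


section \<open>Manifolds\<close>

text \<open>
  A manifold is a type of class \<^class>\<open>t2_space\<close> and \<^class>\<open>second_countable_topology\<close>
  together with an atlas. A chart is a pair \<open>(U, \<phi>)\<close> of an open set and a homeomorphism
  of \<open>U\<close> onto an open subset of the model space; the values of \<open>\<phi>\<close> outside \<open>U\<close> are
  irrelevant. Atlases need not be maximal.
\<close>

type_synonym ('a, 'e) chart = "'a set \<times> ('a \<Rightarrow> 'e)"

definition is_chart :: "('a::topological_space, 'e::euclidean_space) chart \<Rightarrow> bool" where
  "is_chart c \<longleftrightarrow> open (fst c) \<and> open (snd c ` fst c) \<and>
     (\<exists>\<psi>. homeomorphism (fst c) (snd c ` fst c) (snd c) \<psi>)"

definition local_rep ::
  "('a, 'e) chart \<Rightarrow> ('b, 'f) chart \<Rightarrow> ('a \<Rightarrow> 'b) \<Rightarrow> 'e \<Rightarrow> 'f" where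
  "local_rep a c F = snd c \<circ> F \<circ> inv_into (fst a) (snd a)"

definition local_dom ::
  "('a, 'e) chart \<Rightarrow> ('b, 'f) chart \<Rightarrow> ('a \<Rightarrow> 'b) \<Rightarrow> 'e set" where
  "local_dom a c F = snd a ` (fst a \<inter> F -` fst c)"

abbreviation local_deriv ::
  "('a, 'e::euclidean_space) chart \<Rightarrow> ('b, 'f::euclidean_space) chart \<Rightarrow> ('a \<Rightarrow> 'b) \<Rightarrow> 'e \<Rightarrow> 'e \<Rightarrow> 'f" where
  "local_deriv a c F x \<equiv> frechet_derivative (local_rep a c F) (at x)"

text \<open>The transition map from \<open>a\<close> to \<open>c\<close> is \<open>local_rep a c id\<close>, with domain \<open>local_dom a c id\<close>.\<close>

definition smooth_atlas :: "('a::topological_space, 'e::euclidean_space) chart set \<Rightarrow> bool" where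
  "smooth_atlas A \<longleftrightarrow>
     (\<forall>a\<in>A. is_chart a) \<and> \<Union>(fst ` A) = UNIV \<and>
     (\<forall>a\<in>A. \<forall>c\<in>A. smooth_on (local_rep a c id) (local_dom a c id))"

definition smooth_map ::
  "('a::topological_space, 'e::euclidean_space) chart set \<Rightarrow>
   ('b::topological_space, 'f::euclidean_space) chart set \<Rightarrow> ('a \<Rightarrow> 'b) \<Rightarrow> bool" where
  "smooth_map A B F \<longleftrightarrow> continuous_on UNIV F \<and>
     (\<forall>a\<in>A. \<forall>c\<in>B. smooth_on (local_rep a c F) (local_dom a c F))"

definition immersion ::
  "('a::topological_space, 'e::euclidean_space) chart set \<Rightarrow>
   ('b::topological_space, 'f::euclidean_space) chart set \<Rightarrow> ('a \<Rightarrow> 'b) \<Rightarrow> bool" where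
  "immersion A B F \<longleftrightarrow> smooth_map A B F \<and>
     (\<forall>a\<in>A. \<forall>c\<in>B. \<forall>x\<in>local_dom a c F. inj (local_deriv a c F x))"

text \<open>
  \<open>G :: real \<Rightarrow> 'a \<Rightarrow> 'b\<close> is smooth as a map from \<open>(-\<epsilon>, \<epsilon>) \<times> 'a\<close> to \<open>'b\<close>, jointly in both arguments.
\<close>

definition smooth_family ::
  "('a::topological_space, 'e::euclidean_space) chart set \<Rightarrow>
   ('b::topological_space, 'f::euclidean_space) chart set \<Rightarrow> real \<Rightarrow> (real \<Rightarrow> 'a \<Rightarrow> 'b) \<Rightarrow> bool" where
  "smooth_family A B \<epsilon> G \<longleftrightarrow>
     continuous_on ({-\<epsilon><..<\<epsilon>} \<times> UNIV) (\<lambda>(t, p). G t p) \<and>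
     (\<forall>a\<in>A. \<forall>c\<in>B. smooth_on (\<lambda>(t, x). local_rep a c (G t) x)
        {(t, x). t \<in> {-\<epsilon><..<\<epsilon>} \<and> x \<in> local_dom a c (G t)})"

text \<open>
  Surfaces are required to be connected, as usual; on a disconnected surface one component
  could be a holomorphic curve while another is not.
\<close>

definition closed_oriented_surface ::
  "('s::{t2_space,second_countable_topology}, real^2) chart set \<Rightarrow> bool" where
  "closed_oriented_surface A \<longleftrightarrow>
     compact (UNIV :: 's set) \<and> connected (UNIV :: 's set) \<and> smooth_atlas A \<and>
     (\<forall>a\<in>A. \<forall>c\<in>A. \<forall>x\<in>local_dom a c id. det (matrix (local_deriv a c id x)) > 0)"


section \<open>Kaehler surfaces\<close>

text \<open>In a holomorphic chart the complex structure \<open>J\<close> is multiplication by \<open>\<i>\<close>.\<close>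

definition J :: "complex^2 \<Rightarrow> complex^2" where
  "J v = \<i> *s v"

definition complex_surface ::
  "('m::{t2_space,second_countable_topology}, complex^2) chart set \<Rightarrow> bool" where
  "complex_surface B \<longleftrightarrow> smooth_atlas B \<and>
     (\<forall>a\<in>B. \<forall>c\<in>B. \<forall>x\<in>local_dom a c id. \<forall>v. local_deriv a c id x (J v) = J (local_deriv a c id x v))"

text \<open>
  A differential 2-form is given by its components in the charts: \<open>\<omega> c x u v\<close> is the value, at the
  point with coordinates \<open>x\<close> in the chart \<open>c\<close>, on the tangent vectors with coordinates \<open>u\<close> and \<open>v\<close>.
\<close>

type_synonym 'm form2 =
  "('m, complex^2) chart \<Rightarrow> complex^2 \<Rightarrow> complex^2 \<Rightarrow> complex^2 \<Rightarrow> real"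

definition differential_form2 ::
  "('m::{t2_space,second_countable_topology}, complex^2) chart set \<Rightarrow> 'm form2 \<Rightarrow> bool" where
  "differential_form2 B \<omega> \<longleftrightarrow>
     (\<forall>c\<in>B. (\<forall>x \<in> snd c ` fst c. bilinear (\<omega> c x) \<and> (\<forall>u. \<omega> c x u u = 0)) \<and>
            (\<forall>u v. smooth_on (\<lambda>x. \<omega> c x u v) (snd c ` fst c))) \<and>
     (\<forall>a\<in>B. \<forall>c\<in>B. \<forall>x\<in>local_dom a c id. \<forall>u v.
        \<omega> c (local_rep a c id x) (local_deriv a c id x u) (local_deriv a c id x v) = \<omega> a x u v)"

text \<open>
  The formula is \<open>d\<omega>(u, v, w)\<close> for vector fields \<open>u, v, w\<close> with constant coordinates.
\<close>

definition closed_form2 ::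
  "('m::{t2_space,second_countable_topology}, complex^2) chart set \<Rightarrow> 'm form2 \<Rightarrow> bool" where
  "closed_form2 B \<omega> \<longleftrightarrow> (\<forall>c\<in>B. \<forall>x \<in> snd c ` fst c. \<forall>u v w.
     frechet_derivative (\<lambda>y. \<omega> c y v w) (at x) u +
     frechet_derivative (\<lambda>y. \<omega> c y w u) (at x) v +
     frechet_derivative (\<lambda>y. \<omega> c y u v) (at x) w = 0)"

text \<open>The last condition says that \<open>\<langle>u, v\<rangle> = \<omega>(u, J v)\<close> is a \<open>J\<close>-invariant Riemannian metric.\<close>

definition kaehler_surface ::
  "('m::{t2_space,second_countable_topology}, complex^2) chart set \<Rightarrow> 'm form2 \<Rightarrow> bool" where
  "kaehler_surface B \<omega> \<longleftrightarrow>
     complex_surface B \<and> differential_form2 B \<omega> \<and> closed_form2 B \<omega> \<and>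
     (\<forall>c\<in>B. \<forall>x \<in> snd c ` fst c.
        (\<forall>u v. \<omega> c x (J u) (J v) = \<omega> c x u v) \<and> (\<forall>u. u \<noteq> 0 \<longrightarrow> \<omega> c x u (J u) > 0))"


section \<open>Geometry of an immersed surface\<close>

text \<open>
  In what follows \<open>A\<close> is the atlas of the surface \<open>\<Sigma>\<close>, \<open>B\<close> that of \<open>M\<close>, and \<open>F :: 's \<Rightarrow> 'm\<close> the
  immersion. The next three functions are the components of \<open>\<omega>\<close> restricted to \<open>\<Sigma>\<close>, of the induced
  metric, and of its area element, at the point with coordinates \<open>x\<close> in the chart \<open>a\<close>; they
  do not depend on the chart \<open>c\<close> around the image point.
\<close>

definition pullback_form ::
  "'m form2 \<Rightarrow> ('s, real^2) chart \<Rightarrow> ('m, complex^2) chart \<Rightarrow> ('s \<Rightarrow> 'm) \<Rightarrow>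
   real^2 \<Rightarrow> real^2 \<Rightarrow> real^2 \<Rightarrow> real" where
  "pullback_form \<omega> a c F x u v =
     \<omega> c (local_rep a c F x) (local_deriv a c F x u) (local_deriv a c F x v)"

definition induced_metric ::
  "'m form2 \<Rightarrow> ('s, real^2) chart \<Rightarrow> ('m, complex^2) chart \<Rightarrow> ('s \<Rightarrow> 'm) \<Rightarrow>
   real^2 \<Rightarrow> real^2 \<Rightarrow> real^2 \<Rightarrow> real" where
  "induced_metric \<omega> a c F x u v =
     \<omega> c (local_rep a c F x) (local_deriv a c F x u) (J (local_deriv a c F x v))"

definition area_density ::
  "'m form2 \<Rightarrow> ('s, real^2) chart \<Rightarrow> ('m, complex^2) chart \<Rightarrow> ('s \<Rightarrow> 'm) \<Rightarrow> real^2 \<Rightarrow> real" where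
  "area_density \<omega> a c F x =
     (let g = (\<lambda>i j. induced_metric \<omega> a c F x (axis i 1) (axis j 1))
      in sqrt (g 1 1 * g 2 2 - g 1 2 * g 2 1))"

text \<open>
  The Kaehler angle at \<open>p\<close>: \<open>\<omega> = cos \<alpha> d\<mu>\<close> on the tangent plane, evaluated on the positive
  coordinate basis of any chart around \<open>p\<close>.
\<close>

definition kaehler_angle ::
  "('s, real^2) chart set \<Rightarrow> ('m, complex^2) chart set \<Rightarrow> 'm form2 \<Rightarrow> ('s \<Rightarrow> 'm) \<Rightarrow> 's \<Rightarrow> real" where
  "kaehler_angle A B \<omega> F p = (THE \<alpha>. 0 \<le> \<alpha> \<and> \<alpha> \<le> pi \<and>
     (\<forall>a\<in>A. \<forall>c\<in>B. p \<in> fst a \<longrightarrow> F p \<in> fst c \<longrightarrow>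
        pullback_form \<omega> a c F (snd a p) (axis 1 1) (axis 2 1) =
        cos \<alpha> * area_density \<omega> a c F (snd a p)))"

text \<open>The Borel measure \<open>d\<mu>\<close> on \<open>\<Sigma>\<close> given by the area element of the induced metric.\<close>

definition area_measure ::
  "('s::topological_space, real^2) chart set \<Rightarrow> ('m, complex^2) chart set \<Rightarrow> 'm form2 \<Rightarrow>
   ('s \<Rightarrow> 'm) \<Rightarrow> 's measure" where
  "area_measure A B \<omega> F = (THE \<mu>. sets \<mu> = sets borel \<and>
     (\<forall>a\<in>A. \<forall>c\<in>B. \<forall>X\<in>sets borel. X \<subseteq> fst a \<inter> F -` fst c \<longrightarrow>
        emeasure \<mu> X = (\<integral>\<^sup>+ x \<in> snd a ` X. ennreal (area_density \<omega> a c F x) \<partial>lborel)))"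

definition symplectic_surface ::
  "('s::topological_space, real^2) chart set \<Rightarrow> ('m::topological_space, complex^2) chart set \<Rightarrow>
   'm form2 \<Rightarrow> ('s \<Rightarrow> 'm) \<Rightarrow> bool" where
  "symplectic_surface A B \<omega> F \<longleftrightarrow>
     immersion A B F \<and> (\<forall>p. cos (kaehler_angle A B \<omega> F p) > 0)"

definition holomorphic_curve ::
  "('s::topological_space, real^2) chart set \<Rightarrow> ('m::topological_space, complex^2) chart set \<Rightarrow>
   'm form2 \<Rightarrow> ('s \<Rightarrow> 'm) \<Rightarrow> bool" where
  "holomorphic_curve A B \<omega> F \<longleftrightarrow>
     immersion A B F \<and> (\<forall>p. cos (kaehler_angle A B \<omega> F p) = 1)"

definition L_functional ::
  "('s::topological_space, real^2) chart set \<Rightarrow> ('m, complex^2) chart set \<Rightarrow> 'm form2 \<Rightarrow>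
   ('s \<Rightarrow> 'm) \<Rightarrow> real" where
  "L_functional A B \<omega> F = (LINT p|area_measure A B \<omega> F. 1 / cos (kaehler_angle A B \<omega> F p))"

definition symplectic_critical_surface ::
  "('s::topological_space, real^2) chart set \<Rightarrow> ('m::topological_space, complex^2) chart set \<Rightarrow>
   'm form2 \<Rightarrow> ('s \<Rightarrow> 'm) \<Rightarrow> bool" where
  "symplectic_critical_surface A B \<omega> F \<longleftrightarrow>
     symplectic_surface A B \<omega> F \<and>
     (\<forall>\<epsilon>>0. \<forall>G. smooth_family A B \<epsilon> G \<longrightarrow> G 0 = F \<longrightarrow>
        (\<forall>t\<in>{-\<epsilon><..<\<epsilon>}. symplectic_surface A B \<omega> (G t)) \<longrightarrow>
        ((\<lambda>t. L_functional A B \<omega> (G t)) has_real_derivative 0) (at 0))"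

definition complex_points ::
  "('s, real^2) chart set \<Rightarrow> ('m, complex^2) chart set \<Rightarrow> 'm form2 \<Rightarrow> ('s \<Rightarrow> 'm) \<Rightarrow> 's set" where
  "complex_points A B \<omega> F = {p. kaehler_angle A B \<omega> F p = 0}"

end

theory Submission
  imports Defs
begin

text \<open>
  In a chart of the surface and a holomorphic chart of \<open>M\<close> let \<open>f\<close> represent the immersion, let
  \<open>W = \<omega>(f\<^sub>1, f\<^sub>2)\<close>, and let \<open>\<delta>\<close> be the complex determinant of \<open>f\<^sub>1, f\<^sub>2\<close>. The Gram determinant of
  the induced metric is \<open>W\<^sup>2 + \<rho> |\<delta>|\<^sup>2\<close> with \<open>\<rho> > 0\<close>, so complex points are the zeros of \<open>\<delta>\<close> and
  \<open>L = \<integral> W + \<integral> \<rho> |\<delta>|\<^sup>2 / W\<close>. As \<open>\<omega>\<close> is closed, the first term does not change under variations.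
  In the Euler--Lagrange equation of the second term the second derivatives of \<open>f\<close> cancel up to terms
  bounded by \<open>|\<delta>|\<close>, and what remains is \<open>|f\<^sup>k\<^sub>2 w\<^sub>1 - f\<^sup>k\<^sub>1 w\<^sub>2| \<le> C |w|\<close> for \<open>w = cnj \<delta>\<close> and each component
  \<open>f\<^sup>k\<close>. Near a complex point one of the components is a local coordinate \<open>\<zeta>\<close>, and the inequality says
  that the derivative of \<open>w\<close> with respect to the conjugate of \<open>\<zeta>\<close> is bounded by \<open>C |w|\<close>. The leading
  Taylor term of such a function is a multiple of a power of \<open>\<zeta>\<close>, and if all Taylor terms vanish, an
  \<open>L\<^sup>2\<close> estimate for \<open>w / \<zeta>\<^sup>n\<close> with \<open>n \<rightarrow> \<infinity>\<close> shows that \<open>w\<close> vanishes near the point. Hence the set of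
  complex points is locally either a single point or everything, and connectedness and compactness
  of the surface give the claim.
\<close>

section \<open>Calculus of smooth functions\<close>

text \<open>Criticality concerns global families and an abstract measure, so it is first brought
  into one chart: a deformation in a fixed direction e, with support in a small cube, extends to an
  admissible family, and \<open>L\<close> changes only by an integral over the cube. The conjugate
  of \<delta> enters because |\<delta>|^2 varies by 2 Re (cnj \<delta> d\<delta>), and the
  directions e and J e together give a complex equation. The second derivatives of f that are not
  part of dw come from the divergence of (cdet(e, f_2), cdet(f_1, e)), which is 0 by symmetry of
  mixed derivatives. The component \<zeta> never serves as an actual coordinate. The operator w ->
  \<zeta>_2 w_1 - \<zeta>_1 w_2 annihilates \<zeta>, hence commutes with division by \<zeta>^n, and
  the constants of the estimate do not depend on n. The cutoff costs an error only where |\<zeta>|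
  has a positive lower bound; on a smaller cube |\<zeta>| is below half that bound, so the
  comparison gains a factor 1/4 with each n.\<close>

lemma times_differentiable_on_cong:
  assumes "open S" "\<And>x. x \<in> S \<Longrightarrow> f x = g x"
  shows "times_differentiable_on n f S \<longleftrightarrow> times_differentiable_on n g S"
  using assms(2)
proof (induction n arbitrary: f g)
  case 0
  then show ?case by (auto intro!: continuous_on_cong)
next
  case (Suc n)
  have d: "(f has_derivative D) (at x) \<longleftrightarrow> (g has_derivative D) (at x)" if "x \<in> S" for x D
    by (rule iffI; erule has_derivative_transform_within_open[OF _ assms(1) that]) (simp_all add: Suc.prems)
  have "frechet_derivative f (at x) = frechet_derivative g (at x)" if "x \<in> S" for x
    using d[OF that] by (simp add: frechet_derivative_def)
  then have "times_differentiable_on n (\<lambda>x. frechet_derivative f (at x) v) S \<longleftrightarrow>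
        times_differentiable_on n (\<lambda>x. frechet_derivative g (at x) v) S" for v
    by (intro Suc.IH) auto
  moreover have "f differentiable (at x) \<longleftrightarrow> g differentiable (at x)" if "x \<in> S" for x
    using d[OF that] by (simp add: differentiable_def)
  ultimately show ?case by auto
qed

lemma times_differentiable_on_subset:
  "times_differentiable_on n f S \<Longrightarrow> T \<subseteq> S \<Longrightarrow> times_differentiable_on n f T"
  by (induction n arbitrary: f) (auto intro: continuous_on_subset)

lemma times_differentiable_on_SucD:
  "times_differentiable_on (Suc n) f S \<Longrightarrow> times_differentiable_on n f S"
proof (induction n arbitrary: f)
  case 0
  then show ?case
    by (simp add: differentiable_at_imp_differentiable_on differentiable_imp_continuous_on)
next
  case (Suc n)
  then show ?case by (metis times_differentiable_on.simps(2))
qed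

lemma times_differentiable_on_UN:
  assumes "\<And>i. i \<in> I \<Longrightarrow> open (U i)" "\<And>i. i \<in> I \<Longrightarrow> times_differentiable_on n f (U i)"
  shows "times_differentiable_on n f (\<Union>i\<in>I. U i)"
  using assms(2)
proof (induction n arbitrary: f)
  case 0
  then show ?case using assms(1) by (auto intro: continuous_on_open_UN)
qed auto

text \<open>Lets any pointwise formula for the derivative stand in for
  \<open>frechet_derivative\<close>; the inductions on the order of differentiability below all step
  through this form.\<close>

lemma times_differentiable_on_SucI:
  assumes "open S" "\<And>x. x \<in> S \<Longrightarrow> (f has_derivative D x) (at x)"
    and "\<And>v. times_differentiable_on n (\<lambda>x. D x v) S"
  shows "times_differentiable_on (Suc n) f S"
proof -
  have "times_differentiable_on n (\<lambda>x. frechet_derivative f (at x) v) S" for v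
    using times_differentiable_on_cong[OF assms(1), of "\<lambda>x. D x v" "\<lambda>x. frechet_derivative f (at x) v" n]
      frechet_derivative_at[OF assms(2)] assms(3) by auto
  then show ?thesis using assms(2) by (auto simp: differentiable_def)
qed

lemma times_differentiable_on_compose_linear:
  assumes "open S" "bounded_linear h" "times_differentiable_on n f S"
  shows "times_differentiable_on n (\<lambda>x. h (f x)) S"
  using assms(3)
proof (induction n arbitrary: f)
  case 0
  then show ?case by (simp add: bounded_linear.continuous_on[OF assms(2)])
next
  case (Suc n)
  have d: "((\<lambda>x. h (f x)) has_derivative (\<lambda>v. h (frechet_derivative f (at x) v))) (at x)" if "x \<in> S" for x
    using Suc.prems that by (intro bounded_linear.has_derivative[OF assms(2)]) (simp add: frechet_derivative_works[symmetric])
  show ?case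
    using Suc.IH[of "\<lambda>x. frechet_derivative f (at x) _"] Suc.prems
    by (intro times_differentiable_on_SucI[OF assms(1) d]) simp_all
qed

lemma times_differentiable_on_const: "times_differentiable_on n (\<lambda>x. c) S"
  by (induction n arbitrary: c) (auto simp: frechet_derivative_const)

lemma times_differentiable_on_linear:
  assumes "bounded_linear h"
  shows "times_differentiable_on n h S"
proof (cases n)
  case 0
  then show ?thesis using assms by (auto intro: linear_continuous_on)
next
  case (Suc m)
  have "frechet_derivative h (at x) = h" for x
    using frechet_derivative_at[OF bounded_linear_imp_has_derivative[OF assms]] by simp
  then have "times_differentiable_on (Suc m) h S"
    by (simp add: times_differentiable_on_const bounded_linear_imp_differentiable[OF assms])
  then show ?thesis using Suc by simp
qed

lemma times_differentiable_on_add: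
  assumes "open S" "times_differentiable_on n f S" "times_differentiable_on n g S"
  shows "times_differentiable_on n (\<lambda>x. f x + g x) S"
  using assms(2,3)
proof (induction n arbitrary: f g)
  case 0
  then show ?case by (auto intro: continuous_intros)
next
  case (Suc n)
  have d: "((\<lambda>x. f x + g x) has_derivative
      (\<lambda>v. frechet_derivative f (at x) v + frechet_derivative g (at x) v)) (at x)" if "x \<in> S" for x
    using Suc.prems that by (auto intro!: has_derivative_add simp: frechet_derivative_works[symmetric])
  show ?case
    using Suc.IH[of "\<lambda>x. frechet_derivative f (at x) _" "\<lambda>x. frechet_derivative g (at x) _"] Suc.prems
    by (intro times_differentiable_on_SucI[OF assms(1) d]) simp_all
qed

lemma times_differentiable_on_bilinear:
  assumes "open S" "bounded_bilinear h" "times_differentiable_on n f S" "times_differentiable_on n g S"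
  shows "times_differentiable_on n (\<lambda>x. h (f x) (g x)) S"
  using assms(3,4)
proof (induction n arbitrary: f g)
  case 0
  then show ?case by (simp add: bounded_bilinear.continuous_on[OF assms(2)])
next
  case (Suc n)
  have d: "((\<lambda>x. h (f x) (g x)) has_derivative
      (\<lambda>v. h (f x) (frechet_derivative g (at x) v) + h (frechet_derivative f (at x) v) (g x))) (at x)" if "x \<in> S" for x
    using Suc.prems that by (intro bounded_bilinear.FDERIV[OF assms(2)]) (simp_all add: frechet_derivative_works[symmetric])
  have *: "times_differentiable_on n (\<lambda>x. h (f x) (frechet_derivative g (at x) v) + h (frechet_derivative f (at x) v) (g x)) S" for v
    using Suc.prems by (intro times_differentiable_on_add assms Suc.IH)
      (auto intro: times_differentiable_on_SucD)
  show ?case by (rule times_differentiable_on_SucI[OF assms(1) d *])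
qed

lemma times_differentiable_on_sum:
  assumes "open S" "\<And>i. i \<in> I \<Longrightarrow> times_differentiable_on n (f i) S"
  shows "times_differentiable_on n (\<lambda>x. \<Sum>i\<in>I. f i x) S"
  using assms(2)
  by (induction I rule: infinite_finite_induct)
     (auto simp: times_differentiable_on_const intro!: times_differentiable_on_add assms(1))

lemma linear_Basis_expansion:
  fixes x :: "'a::euclidean_space"
  assumes "bounded_linear f"
  shows "f x = (\<Sum>b\<in>Basis. (x \<bullet> b) *\<^sub>R f b)"
proof -
  interpret bounded_linear f by fact
  show ?thesis
    using sum[of "\<lambda>b. (x \<bullet> b) *\<^sub>R b" Basis] by (simp add: scaleR euclidean_representation)
qed

lemma times_differentiable_on_compose:
  assumes "open S" "open T" "\<And>x. x \<in> S \<Longrightarrow> g x \<in> T"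
    and "times_differentiable_on n f T" "times_differentiable_on n g S"
  shows "times_differentiable_on n (\<lambda>x. f (g x)) S"
  using assms(4,5)
proof (induction n arbitrary: f)
  case 0
  then show ?case using assms(3) by (auto intro: continuous_on_compose2)
next
  case (Suc n)
  \<comment> \<open>The direction in which \<open>f\<close> is differentiated moves with the point,
    whereas the definition speaks of fixed directions. Expanding in \<open>Basis\<close> leaves
    fixed directions with differentiable coefficients.\<close>
  let ?D = "\<lambda>x v. \<Sum>b\<in>Basis. (frechet_derivative g (at x) v \<bullet> b) *\<^sub>R frechet_derivative f (at (g x)) b"
  have d: "((\<lambda>x. f (g x)) has_derivative ?D x) (at x)" if "x \<in> S" for x
  proof -
    have f: "(f has_derivative frechet_derivative f (at (g x))) (at (g x))"
      and g: "(g has_derivative frechet_derivative g (at x)) (at x)"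
      using Suc.prems assms(3) that by (auto simp: frechet_derivative_works[symmetric])
    have "((\<lambda>x. f (g x)) has_derivative (\<lambda>v. frechet_derivative f (at (g x)) (frechet_derivative g (at x) v))) (at x)"
      using diff_chain_at[OF g f] by (simp add: o_def)
    then show ?thesis
      by (subst (asm) linear_Basis_expansion[OF has_derivative_bounded_linear[OF f]])
  qed
  have "times_differentiable_on n (\<lambda>x. ?D x v) S" for v
  proof (intro times_differentiable_on_sum assms(1) times_differentiable_on_bilinear[OF _ bounded_bilinear_scaleR])
    fix b :: 'b
    show "times_differentiable_on n (\<lambda>x. frechet_derivative g (at x) v \<bullet> b) S"
      using Suc.prems(2)
      by (intro times_differentiable_on_bilinear[OF _ bounded_bilinear_inner] assms(1) times_differentiable_on_const) auto
    show "times_differentiable_on n (\<lambda>x. frechet_derivative f (at (g x)) b) S"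
      using Suc.prems by (intro Suc.IH) (auto intro: times_differentiable_on_SucD)
  qed
  then show ?case by (intro times_differentiable_on_SucI[OF assms(1) d])
qed

lemma times_differentiable_on_inverse:
  fixes f :: "'a::euclidean_space \<Rightarrow> 'b::{euclidean_space,real_normed_field}"
  assumes "open S" "times_differentiable_on n f S" "\<And>x. x \<in> S \<Longrightarrow> f x \<noteq> 0"
  shows "times_differentiable_on n (\<lambda>x. inverse (f x)) S"
  using assms(2)
proof (induction n)
  case 0
  then show ?case using assms(3) by (auto intro: continuous_intros)
next
  case (Suc n)
  let ?D = "\<lambda>x v. - (inverse (f x) * frechet_derivative f (at x) v * inverse (f x))"
  have d: "((\<lambda>x. inverse (f x)) has_derivative ?D x) (at x)" if "x \<in> S" for x
    using Suc.prems that assms(3) by (auto intro!: has_derivative_inverse simp: frechet_derivative_works[symmetric])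
  \<comment> \<open>The derivative of the inverse contains the inverse again, but only to order
    \<open>n\<close>, which the induction hypothesis provides.\<close>
  have i: "times_differentiable_on n (\<lambda>x. inverse (f x)) S"
    using Suc times_differentiable_on_SucD by blast
  have "times_differentiable_on n (\<lambda>x. ?D x v) S" for v
    using Suc.prems
    by (intro times_differentiable_on_compose_linear[OF assms(1) bounded_linear_minus[OF bounded_linear_ident]]
        times_differentiable_on_bilinear[OF assms(1) bounded_bilinear_mult] i) auto
  then show ?case by (intro times_differentiable_on_SucI[OF assms(1) d])
qed

section \<open>Closure properties of smooth functions\<close>

lemma smooth_on_cong: "open S \<Longrightarrow> (\<And>x. x \<in> S \<Longrightarrow> f x = g x) \<Longrightarrow> smooth_on f S \<longleftrightarrow> smooth_on g S"
  by (metis smooth_on_def times_differentiable_on_cong)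

lemma smooth_on_subset: "smooth_on f S \<Longrightarrow> T \<subseteq> S \<Longrightarrow> smooth_on f T"
  by (metis smooth_on_def times_differentiable_on_subset)

lemma smooth_on_continuous: "smooth_on f S \<Longrightarrow> continuous_on S f"
  by (metis smooth_on_def times_differentiable_on.simps(1))

lemma smooth_on_differentiable: "smooth_on f S \<Longrightarrow> x \<in> S \<Longrightarrow> f differentiable (at x)"
  by (metis smooth_on_def times_differentiable_on.simps(2))

lemma smooth_on_has_derivative:
  "smooth_on f S \<Longrightarrow> x \<in> S \<Longrightarrow> (f has_derivative frechet_derivative f (at x)) (at x)"
  by (metis frechet_derivative_works smooth_on_differentiable)

lemma smooth_on_derivative: "smooth_on f S \<Longrightarrow> smooth_on (\<lambda>x. frechet_derivative f (at x) v) S"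
  by (metis smooth_on_def times_differentiable_on.simps(2))

text \<open>Serves the functions pasted together from different formulas, such as extensions by 0
  and variations of the immersion.\<close>

lemma smooth_on_local:
  assumes "\<And>x. x \<in> S \<Longrightarrow> \<exists>U g. open U \<and> x \<in> U \<and> smooth_on g U \<and> (\<forall>y\<in>U. f y = g y)"
  shows "smooth_on f S"
proof -
  obtain U where U: "\<And>x. x \<in> S \<Longrightarrow> open (U x) \<and> x \<in> U x \<and> smooth_on f (U x)"
    using assms by (metis smooth_on_cong)
  then have "smooth_on f (\<Union>x\<in>S. U x)"
    unfolding smooth_on_def by (intro allI times_differentiable_on_UN) auto
  then show ?thesis using U by (rule_tac smooth_on_subset) auto
qed

lemma smooth_on_const: "smooth_on (\<lambda>x. c) S"
  by (simp add: smooth_on_def times_differentiable_on_const)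

lemma smooth_on_linear: "bounded_linear h \<Longrightarrow> smooth_on h S"
  by (simp add: smooth_on_def times_differentiable_on_linear)

lemma smooth_on_id: "smooth_on (\<lambda>x. x) S"
  by (intro smooth_on_linear bounded_linear_ident)

lemma smooth_on_compose_linear: "open S \<Longrightarrow> bounded_linear h \<Longrightarrow> smooth_on f S \<Longrightarrow> smooth_on (\<lambda>x. h (f x)) S"
  by (simp add: smooth_on_def times_differentiable_on_compose_linear)

lemma smooth_on_add:
  "open S \<Longrightarrow> smooth_on f S \<Longrightarrow> smooth_on g S \<Longrightarrow> smooth_on (\<lambda>x. f x + g x) S"
  by (simp add: smooth_on_def times_differentiable_on_add)

lemma smooth_on_minus: "open S \<Longrightarrow> smooth_on f S \<Longrightarrow> smooth_on (\<lambda>x. - f x) S"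
  by (rule smooth_on_compose_linear[OF _ bounded_linear_minus[OF bounded_linear_ident]])

lemma smooth_on_diff:
  "open S \<Longrightarrow> smooth_on f S \<Longrightarrow> smooth_on g S \<Longrightarrow> smooth_on (\<lambda>x. f x - g x) S"
  using smooth_on_add[of S f "\<lambda>x. - g x"] smooth_on_minus[of S g] by simp

lemma smooth_on_sum:
  "open S \<Longrightarrow> (\<And>i. i \<in> I \<Longrightarrow> smooth_on (f i) S) \<Longrightarrow> smooth_on (\<lambda>x. \<Sum>i\<in>I. f i x) S"
  by (simp add: smooth_on_def times_differentiable_on_sum)

lemma smooth_on_bilinear:
  "bounded_bilinear h \<Longrightarrow> open S \<Longrightarrow> smooth_on f S \<Longrightarrow> smooth_on g S \<Longrightarrow> smooth_on (\<lambda>x. h (f x) (g x)) S"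
  by (simp add: smooth_on_def times_differentiable_on_bilinear)

lemmas smooth_on_scaleR = smooth_on_bilinear[OF bounded_bilinear_scaleR]
lemmas smooth_on_inner = smooth_on_bilinear[OF bounded_bilinear_inner]

lemma smooth_on_mult:
  fixes f g :: "'a::euclidean_space \<Rightarrow> 'b::{euclidean_space,real_normed_field}"
  shows "open S \<Longrightarrow> smooth_on f S \<Longrightarrow> smooth_on g S \<Longrightarrow> smooth_on (\<lambda>x. f x * g x) S"
  by (rule smooth_on_bilinear[OF bounded_bilinear_mult])

lemma smooth_on_power:
  fixes f :: "'a::euclidean_space \<Rightarrow> 'b::{euclidean_space,real_normed_field}"
  shows "open S \<Longrightarrow> smooth_on f S \<Longrightarrow> smooth_on (\<lambda>x. f x ^ n) S"
  by (induction n) (simp_all add: smooth_on_const smooth_on_mult)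

lemma smooth_on_inverse:
  fixes f :: "'a::euclidean_space \<Rightarrow> 'b::{euclidean_space,real_normed_field}"
  shows "open S \<Longrightarrow> smooth_on f S \<Longrightarrow> (\<And>x. x \<in> S \<Longrightarrow> f x \<noteq> 0) \<Longrightarrow> smooth_on (\<lambda>x. inverse (f x)) S"
  by (simp add: smooth_on_def times_differentiable_on_inverse)

lemma smooth_on_divide:
  fixes f g :: "'a::euclidean_space \<Rightarrow> 'b::{euclidean_space,real_normed_field}"
  shows "open S \<Longrightarrow> smooth_on f S \<Longrightarrow> smooth_on g S \<Longrightarrow> (\<And>x. x \<in> S \<Longrightarrow> g x \<noteq> 0) \<Longrightarrow> smooth_on (\<lambda>x. f x / g x) S"
  unfolding divide_inverse by (intro smooth_on_mult smooth_on_inverse)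

lemma smooth_on_compose:
  "smooth_on f T \<Longrightarrow> open T \<Longrightarrow> open S \<Longrightarrow> smooth_on g S \<Longrightarrow> (\<And>x. x \<in> S \<Longrightarrow> g x \<in> T) \<Longrightarrow> smooth_on (\<lambda>x. f (g x)) S"
  unfolding smooth_on_def by (blast intro: times_differentiable_on_compose)

lemmas smooth_on_Re = smooth_on_compose_linear[OF _ bounded_linear_Re]
lemmas smooth_on_Im = smooth_on_compose_linear[OF _ bounded_linear_Im]
lemmas smooth_on_cnj = smooth_on_compose_linear[OF _ bounded_linear_cnj]
lemmas smooth_on_of_real = smooth_on_compose_linear[OF _ bounded_linear_of_real]
lemmas smooth_on_vec_nth = smooth_on_compose_linear[OF _ bounded_linear_vec_nth]
lemmas smooth_on_fst = smooth_on_compose_linear[OF _ bounded_linear_fst]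
lemmas smooth_on_snd = smooth_on_compose_linear[OF _ bounded_linear_snd]

lemma smooth_on_Pair:
  fixes f :: "'a::euclidean_space \<Rightarrow> 'b::euclidean_space" and g :: "'a \<Rightarrow> 'c::euclidean_space"
  assumes "open S" "smooth_on f S" "smooth_on g S"
  shows "smooth_on (\<lambda>x. (f x, g x)) S"
proof -
  have 1: "bounded_linear (\<lambda>y::'b. (y, 0::'c))" and 2: "bounded_linear (\<lambda>y::'c. (0::'b, y))"
    by (intro bounded_linear_Pair bounded_linear_ident bounded_linear_zero)+
  have "smooth_on (\<lambda>x. (f x, 0::'c) + (0::'b, g x)) S"
    using assms smooth_on_compose_linear[OF _ 1] smooth_on_compose_linear[OF _ 2] by (intro smooth_on_add) blast+
  then show ?thesis by simp
qed

section \<open>Iterated derivatives and order of vanishing\<close>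

abbreviation dir_deriv :: "'a::euclidean_space \<Rightarrow> ('a \<Rightarrow> 'b::euclidean_space) \<Rightarrow> 'a \<Rightarrow> 'b" where
  "dir_deriv v f \<equiv> \<lambda>x. frechet_derivative f (at x) v"

primrec iter_deriv :: "'a::euclidean_space list \<Rightarrow> ('a \<Rightarrow> 'b::euclidean_space) \<Rightarrow> 'a \<Rightarrow> 'b" where
  "iter_deriv [] f = f"
| "iter_deriv (v # vs) f = iter_deriv vs (dir_deriv v f)"

text \<open>Iterated forward differences. Unlike iterated derivatives they visibly do not depend on
  the order of the directions and are bounded by values of \<open>f\<close>; both facts pass to the
  limit \<open>s \<rightarrow> 0\<close>.\<close>

primrec iter_diff :: "real \<Rightarrow> 'a::euclidean_space list \<Rightarrow> ('a \<Rightarrow> 'b::euclidean_space) \<Rightarrow> 'a \<Rightarrow> 'b" where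
  "iter_diff s [] f = f"
| "iter_diff s (v # vs) f = (\<lambda>x. iter_diff s vs f (x + s *\<^sub>R v) - iter_diff s vs f x)"

lemma smooth_on_iter_deriv: "smooth_on f S \<Longrightarrow> smooth_on (iter_deriv vs f) S"
  by (induction vs arbitrary: f) (auto intro: smooth_on_derivative)

lemma frechet_derivative_cong:
  assumes "open S" "\<And>x. x \<in> S \<Longrightarrow> f x = g x" "x \<in> S"
  shows "frechet_derivative f (at x) = frechet_derivative g (at x)"
proof -
  have "(f has_derivative D) (at x) \<longleftrightarrow> (g has_derivative D) (at x)" for D
    by (rule iffI; erule has_derivative_transform_within_open[OF _ assms(1,3)]) (simp_all add: assms(2))
  then show ?thesis by (simp add: frechet_derivative_def)
qed

lemma iter_deriv_cong:
  assumes "open S" "\<And>x. x \<in> S \<Longrightarrow> f x = g x" "x \<in> S"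
  shows "iter_deriv vs f x = iter_deriv vs g x"
  using assms(2)
proof (induction vs arbitrary: f g)
  case (Cons v vs)
  have "dir_deriv v f x = dir_deriv v g x" if "x \<in> S" for x
    using frechet_derivative_cong[OF assms(1) Cons.prems that] by simp
  from Cons.IH[OF this] show ?case by simp
qed (use assms in auto)

text \<open>The last assumption keeps every vertex of the parallelepiped spanned by the steps inside
  the ball on which \<open>g\<close> is smooth.\<close>

lemma iter_diff_has_derivative:
  assumes "smooth_on g S" "s > 0" "ball x0 r \<subseteq> S"
    and "dist x0 x + s * (\<Sum>v\<leftarrow>vs. norm v) < r"
  shows "(iter_diff s vs g has_derivative (\<lambda>w. iter_diff s vs (dir_deriv w g) x)) (at x)"
  using assms(4)
proof (induction vs arbitrary: x)
  case Nil
  then show ?case using assms by (auto intro!: smooth_on_has_derivative)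
next
  case (Cons v vs)
  have t: "dist x0 (x + s *\<^sub>R v) \<le> dist x0 x + s * norm v"
    using dist_triangle[of x0 "x + s *\<^sub>R v" x] assms(2) by (simp add: dist_norm)
  have p: "0 \<le> s * norm v" using assms(2) by simp
  have c: "dist x0 x + s * norm v + s * (\<Sum>v\<leftarrow>vs. norm v) < r" using Cons.prems by (simp add: algebra_simps)
  have 1: "(iter_diff s vs g has_derivative (\<lambda>w. iter_diff s vs (dir_deriv w g) (x + s *\<^sub>R v))) (at (x + s *\<^sub>R v))"
    using t c by (intro Cons.IH) linarith
  have 2: "(iter_diff s vs g has_derivative (\<lambda>w. iter_diff s vs (dir_deriv w g) x)) (at x)"
    using p c by (intro Cons.IH) linarith
  have 3: "((\<lambda>x. x + s *\<^sub>R v) has_derivative (\<lambda>w. w)) (at x)"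
    by (auto intro!: derivative_eq_intros)
  show ?case using has_derivative_diff[OF diff_chain_at[OF 3 1] 2] by (simp add: o_def)
qed

text \<open>The mean value theorem is applied to one direction at a time, and each application moves
  the base point by at most \<open>s * norm v\<close>. It needs real values; vector-valued functions
  are treated through their components \<open>g x \<bullet> b\<close>.\<close>

lemma iter_diff_mean_value:
  fixes g :: "'a::euclidean_space \<Rightarrow> real"
  assumes "smooth_on g S" "s > 0" "ball x0 r \<subseteq> S"
    and "dist x0 x + s * (\<Sum>v\<leftarrow>vs. norm v) < r"
  shows "\<exists>y. dist x y \<le> s * (\<Sum>v\<leftarrow>vs. norm v) \<and> iter_diff s vs g x = s ^ length vs * iter_deriv vs g y"
  using assms(1,4)
proof (induction vs arbitrary: x g)
  case (Cons v vs)
  let ?N = "\<Sum>v\<leftarrow>vs. norm v"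
  have nn: "0 \<le> s * norm v" using assms(2) by simp
  have c: "dist x0 x + s * norm v + s * ?N < r" using Cons.prems by (simp add: algebra_simps)
  have in_range: "dist x0 (x + (t * s) *\<^sub>R v) + s * ?N < r" and d: "dist x (x + (t * s) *\<^sub>R v) \<le> s * norm v"
    if "0 \<le> t" "t \<le> 1" for t
  proof -
    have "dist x (x + (t * s) *\<^sub>R v) = t * (s * norm v)" using that assms(2) by (simp add: dist_norm abs_mult)
    also have "\<dots> \<le> s * norm v" using that nn by (simp add: mult_left_le_one_le)
    finally show d: "dist x (x + (t * s) *\<^sub>R v) \<le> s * norm v" .
    then show "dist x0 (x + (t * s) *\<^sub>R v) + s * ?N < r"
      using dist_triangle[of x0 "x + (t * s) *\<^sub>R v" x] c by linarith
  qed
  let ?G = "\<lambda>t. iter_diff s vs g (x + (t * s) *\<^sub>R v)"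
  have G: "(?G has_derivative (\<lambda>h. iter_diff s vs (dir_deriv ((h * s) *\<^sub>R v) g) (x + (t * s) *\<^sub>R v))) (at t)"
    if "0 \<le> t" "t \<le> 1" for t
  proof -
    have 1: "((\<lambda>t. x + (t * s) *\<^sub>R v) has_derivative (\<lambda>h. (h * s) *\<^sub>R v)) (at t)"
      by (auto intro!: derivative_eq_intros)
    show ?thesis
      using diff_chain_at[OF 1 iter_diff_has_derivative[OF Cons.prems(1) assms(2,3) in_range[OF that]]]
      by (simp add: o_def)
  qed
  obtain \<xi> where \<xi>: "0 < \<xi>" "\<xi> < 1"
    "?G 1 - ?G 0 = iter_diff s vs (dir_deriv (((1 - 0) * s) *\<^sub>R v) g) (x + (\<xi> * s) *\<^sub>R v)"
    by (rule mvt[of 0 1 ?G "\<lambda>t h. iter_diff s vs (dir_deriv ((h * s) *\<^sub>R v) g) (x + (t * s) *\<^sub>R v)"])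
       (use G in \<open>auto intro!: continuous_at_imp_continuous_on has_derivative_continuous[OF G]\<close>)
  let ?z = "x + (\<xi> * s) *\<^sub>R v"
  have lin: "iter_diff s vs (dir_deriv (s *\<^sub>R v) g) ?z = s * iter_diff s vs (dir_deriv v g) ?z"
    using linear.scaleR[OF bounded_linear.linear[OF has_derivative_bounded_linear[OF
      iter_diff_has_derivative[OF Cons.prems(1) assms(2,3) in_range[of \<xi>]]]], of s v] \<xi> by simp
  obtain y where y: "dist ?z y \<le> s * ?N" "iter_diff s vs (dir_deriv v g) ?z = s ^ length vs * iter_deriv vs (dir_deriv v g) y"
    using Cons.IH[OF smooth_on_derivative[OF Cons.prems(1)], of ?z v] in_range[of \<xi>] \<xi> by auto
  have "dist x y \<le> s * norm v + s * ?N"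
    using dist_triangle[of x y ?z] d[of \<xi>] y(1) \<xi> by linarith
  moreover have "iter_diff s (v # vs) g x = s ^ length (v # vs) * iter_deriv (v # vs) g y"
    using \<xi>(3) lin y(2) by simp
  ultimately show ?case by (intro exI[of _ y]) (simp add: algebra_simps)
qed simp

lemma iter_deriv_inner:
  assumes "open S" "smooth_on g S" "x \<in> S"
  shows "iter_deriv vs (\<lambda>x. g x \<bullet> b) x = iter_deriv vs g x \<bullet> b"
  using assms(2)
proof (induction vs arbitrary: g)
  case (Cons v vs)
  have "dir_deriv v (\<lambda>x. g x \<bullet> b) y = dir_deriv v g y \<bullet> b" if "y \<in> S" for y
  proof -
    have "((\<lambda>x. g x \<bullet> b) has_derivative (\<lambda>w. frechet_derivative g (at y) w \<bullet> b)) (at y)"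
      by (intro has_derivative_inner_left smooth_on_has_derivative[OF Cons.prems that])
    from frechet_derivative_at[OF this, symmetric] show ?thesis by simp
  qed
  from iter_deriv_cong[OF assms(1) this assms(3)]
  have "iter_deriv vs (dir_deriv v (\<lambda>x. g x \<bullet> b)) x = iter_deriv vs (\<lambda>y. dir_deriv v g y \<bullet> b) x" by simp
  then show ?case using Cons.IH[OF smooth_on_derivative[OF Cons.prems]] by simp
qed simp

lemma tendsto_from_mean_values:
  fixes c :: "real \<Rightarrow> real"
  assumes "open S" "x \<in> S" "continuous_on S D"
    and "\<forall>\<^sub>F s in at_right 0. \<exists>y. dist x y \<le> s * N \<and> c s = D y"
  shows "(c \<longlongrightarrow> D x) (at_right 0)"
proof (rule tendstoI)
  fix e :: real assume "e > 0"
  have "(D \<longlongrightarrow> D x) (nhds x)"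
    using assms(1-3) by (metis continuous_on_eq_continuous_at continuous_at tendsto_at_iff_tendsto_nhds)
  then have "\<forall>\<^sub>F y in nhds x. dist (D y) (D x) < e" using \<open>e > 0\<close> by (rule tendstoD)
  then obtain d where d: "d > 0" "\<And>y. dist y x < d \<Longrightarrow> dist (D y) (D x) < e"
    by (auto simp: eventually_nhds_metric)
  have "((\<lambda>s. s * N) \<longlongrightarrow> 0) (at_right 0)" by (auto intro!: tendsto_eq_intros)
  then have "\<forall>\<^sub>F s in at_right 0. s * N < d" using d(1) by (rule order_tendstoD)
  with assms(4) show "\<forall>\<^sub>F s in at_right 0. dist (c s) (D x) < e"
    by eventually_elim (use d in \<open>force simp: dist_commute\<close>)
qed

lemma iter_diff_tendsto:
  fixes g :: "'a::euclidean_space \<Rightarrow> real"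
  assumes "smooth_on g S" "open S" "x \<in> S"
  shows "((\<lambda>s. iter_diff s vs g x / s ^ length vs) \<longlongrightarrow> iter_deriv vs g x) (at_right 0)"
proof (rule tendsto_from_mean_values[OF assms(2,3) smooth_on_continuous[OF smooth_on_iter_deriv[OF assms(1)]]])
  obtain r where r: "r > 0" "ball x r \<subseteq> S" using assms by (meson openE)
  let ?N = "\<Sum>v\<leftarrow>vs. norm v"
  have "((\<lambda>s. s * ?N) \<longlongrightarrow> 0) (at_right 0)" by (auto intro!: tendsto_eq_intros)
  then have "\<forall>\<^sub>F s in at_right 0. s * ?N < r" using r(1) by (rule order_tendstoD)
  moreover have "\<forall>\<^sub>F s::real in at_right 0. s > 0" by (simp add: eventually_at_right_less)
  ultimately show "\<forall>\<^sub>F s in at_right 0. \<exists>y. dist x y \<le> s * ?N \<and> iter_diff s vs g x / s ^ length vs = iter_deriv vs g y"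
  proof eventually_elim
    case (elim s)
    then show ?case using iter_diff_mean_value[OF assms(1) elim(2) r(2), of x vs] by auto
  qed
qed

text \<open>The second differences taken in the two orders are one and the same expression, so their
  quotients have the same limit.\<close>

lemma mixed_derivatives_commute:
  assumes "smooth_on g S" "open S" "x \<in> S"
  shows "iter_deriv [u, v] g x = iter_deriv [v, u] g x"
proof (rule euclidean_eqI)
  fix b :: 'b
  have s: "smooth_on (\<lambda>x. g x \<bullet> b) S" using assms by (intro smooth_on_inner smooth_on_const)
  have eq: "(\<lambda>t. iter_diff t [u, v] (\<lambda>x. g x \<bullet> b) x / t ^ length [u, v]) =
    (\<lambda>t. iter_diff t [v, u] (\<lambda>x. g x \<bullet> b) x / t ^ length [v, u])"
    by (simp add: algebra_simps)
  have "iter_deriv [u, v] (\<lambda>x. g x \<bullet> b) x = iter_deriv [v, u] (\<lambda>x. g x \<bullet> b) x"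
    using tendsto_unique[OF trivial_limit_at_right_real iter_diff_tendsto[OF s assms(2,3), of "[u,v]", unfolded eq]
      iter_diff_tendsto[OF s assms(2,3), of "[v,u]"]] .
  then show "iter_deriv [u, v] g x \<bullet> b = iter_deriv [v, u] g x \<bullet> b"
    by (simp only: iter_deriv_inner[OF assms(2,1,3)])
qed

lemma iter_deriv_mset:
  assumes "smooth_on g S" "open S" "x \<in> S" "mset us = mset vs"
  shows "iter_deriv us g x = iter_deriv vs g x"
  using assms(1,4)
proof (induction us arbitrary: g vs)
  case (Cons u us)
  then obtain as bs where vs: "vs = as @ u # bs"
    by (metis list.set_intros(1) mset_eq_setD split_list)
  \<comment> \<open>Moves \<open>u\<close> to the front by transpositions with its left
    neighbour.\<close>
  have "iter_deriv (as @ u # bs) g x = iter_deriv (u # as @ bs) g x"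
    using Cons.prems(1)
  proof (induction as arbitrary: g)
    case (Cons a as)
    have "iter_deriv (u # as @ bs) (dir_deriv a g) x = iter_deriv (as @ bs) (iter_deriv [a, u] g) x"
      by simp
    also have "\<dots> = iter_deriv (as @ bs) (iter_deriv [u, a] g) x"
      by (rule iter_deriv_cong[OF assms(2) _ assms(3)]) (rule mixed_derivatives_commute[OF Cons.prems assms(2)])
    finally show ?case using Cons.IH[OF smooth_on_derivative[OF Cons.prems]] by simp
  qed simp
  moreover have "iter_deriv us (dir_deriv u g) x = iter_deriv (as @ bs) (dir_deriv u g) x"
    using Cons.prems vs by (intro Cons.IH smooth_on_derivative) auto
  ultimately show ?case using vs by simp
qed auto

text \<open>Phrased through values rather than derivatives, which makes products and quotients easy.
  For smooth functions \<open>iter_deriv_eq_0\<close> and \<open>vanishing_order_geI\<close>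
  translate it into the vanishing of all derivatives of order below \<open>m\<close>.\<close>

definition vanishing_order_ge :: "nat \<Rightarrow> ('a::euclidean_space \<Rightarrow> 'b::euclidean_space) \<Rightarrow> 'a \<Rightarrow> bool" where
  "vanishing_order_ge m g x0 \<longleftrightarrow> (\<exists>C. \<forall>\<^sub>F x in nhds x0. norm (g x) \<le> C * norm (x - x0) ^ m)"

text \<open>An iterated difference is a signed sum of \<open>2 ^ length vs\<close> values of
  \<open>g\<close>, all taken within distance \<open>s * M\<close> of \<open>x0\<close>.\<close>

lemma iter_diff_bound:
  assumes "\<And>x. dist x0 x \<le> s * M \<Longrightarrow> norm (g x) \<le> B" "s > 0"
    and "dist x0 x + s * (\<Sum>v\<leftarrow>vs. norm v) \<le> s * M"
  shows "norm (iter_diff s vs g x) \<le> 2 ^ length vs * B"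
  using assms(3)
proof (induction vs arbitrary: x)
  case Nil
  then show ?case using assms(1) by simp
next
  case (Cons v vs)
  have "dist x0 (x + s *\<^sub>R v) \<le> dist x0 x + s * norm v"
    using dist_triangle[of x0 "x + s *\<^sub>R v" x] assms(2) by (simp add: dist_norm)
  moreover have "0 \<le> s * norm v" using assms(2) by simp
  moreover have "dist x0 x + s * norm v + s * (\<Sum>v\<leftarrow>vs. norm v) \<le> s * M" using Cons.prems by (simp add: algebra_simps)
  ultimately have "norm (iter_diff s vs g (x + s *\<^sub>R v)) \<le> 2 ^ length vs * B" "norm (iter_diff s vs g x) \<le> 2 ^ length vs * B"
    using Cons.IH[of x] Cons.IH[of "x + s *\<^sub>R v"] by linarith+
  then show ?case using norm_triangle_ineq4[of "iter_diff s vs g (x + s *\<^sub>R v)" "iter_diff s vs g x"] by simp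
qed

text \<open>The difference quotient of order \<open>length vs\<close> is at most a constant times
  \<open>s ^ (m - length vs)\<close>, which tends to 0.\<close>

lemma iter_deriv_eq_0:
  fixes g :: "'a::euclidean_space \<Rightarrow> 'b::euclidean_space"
  assumes "smooth_on g S" "open S" "x0 \<in> S" "vanishing_order_ge m g x0" "length vs < m"
  shows "iter_deriv vs g x0 = 0"
proof (rule euclidean_eqI)
  fix b :: 'b assume b: "b \<in> Basis"
  let ?g = "\<lambda>x. g x \<bullet> b"
  let ?N = "\<Sum>v\<leftarrow>vs. norm v"
  let ?k = "length vs"
  have s: "smooth_on ?g S" using assms by (intro smooth_on_inner smooth_on_const)
  obtain C r where r: "r > 0" and C: "\<And>x. dist x x0 < r \<Longrightarrow> norm (g x) \<le> C * norm (x - x0) ^ m"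
    using assms(4) by (auto simp: vanishing_order_ge_def eventually_nhds_metric)
  have N: "?N \<ge> 0" by (auto intro!: sum_list_nonneg)
  have "((\<lambda>s. s * ?N) \<longlongrightarrow> 0) (at_right 0)" by (auto intro!: tendsto_eq_intros)
  then have "\<forall>\<^sub>F s in at_right 0. s * ?N < r" using r(1) by (rule order_tendstoD)
  moreover have "\<forall>\<^sub>F s::real in at_right 0. s > 0" by (simp add: eventually_at_right_less)
  ultimately have *: "\<forall>\<^sub>F s in at_right 0. norm (iter_diff s vs ?g x0 / s ^ ?k) \<le> 2 ^ ?k * (\<bar>C\<bar> * ?N ^ m) * s ^ (m - ?k)"
  proof eventually_elim
    case (elim s)
    have "norm (iter_diff s vs ?g x0) \<le> 2 ^ ?k * (\<bar>C\<bar> * (s * ?N) ^ m)"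
    proof (rule iter_diff_bound[of x0 s ?N])
      fix x assume x: "dist x0 x \<le> s * ?N"
      have "norm (?g x) \<le> norm (g x)" using b by (metis Basis_le_norm real_norm_def)
      also have "\<dots> \<le> C * norm (x - x0) ^ m" using x elim by (intro C) (simp add: dist_commute)
      also have "\<dots> \<le> \<bar>C\<bar> * (s * ?N) ^ m"
        using x by (intro mult_mono power_mono) (auto simp: dist_norm norm_minus_commute)
      finally show "norm (?g x) \<le> \<bar>C\<bar> * (s * ?N) ^ m" .
    qed (use elim in auto)
    also have "\<dots> = 2 ^ ?k * (\<bar>C\<bar> * ?N ^ m) * s ^ (m - ?k) * s ^ ?k"
      using assms(5) by (simp add: power_mult_distrib power_add[symmetric])
    finally show ?case using elim by (simp add: divide_le_eq)
  qed
  have "((\<lambda>s. 2 ^ ?k * (\<bar>C\<bar> * ?N ^ m) * s ^ (m - ?k)) \<longlongrightarrow> 0) (at_right (0::real))"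
    using assms(5) by (auto intro!: tendsto_eq_intros)
  from Lim_null_comparison[OF * this] have "iter_deriv vs ?g x0 = 0"
    using tendsto_unique[OF _ iter_diff_tendsto[OF s assms(2,3), of vs]] by simp
  then show "iter_deriv vs g x0 \<bullet> b = 0 \<bullet> b"
    using iter_deriv_inner[OF assms(2,1,3)] by simp
qed

text \<open>Taylor's bound by induction on \<open>m\<close>: the first derivatives vanish to order
  \<open>m\<close>, and the mean value inequality on the closed ball through \<open>x\<close> adds
  one power of the radius.\<close>

lemma vanishing_order_geI:
  fixes g :: "'a::euclidean_space \<Rightarrow> 'b::euclidean_space"
  assumes "smooth_on g S" "open S" "x0 \<in> S" 
    and "\<And>vs. set vs \<subseteq> Basis \<Longrightarrow> length vs < m \<Longrightarrow> iter_deriv vs g x0 = 0"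
  shows "vanishing_order_ge m g x0"
  using assms(1,4)
proof (induction m arbitrary: g)
  case 0
  have "(g \<longlongrightarrow> g x0) (nhds x0)"
    using smooth_on_continuous[OF 0(1)] assms(2,3)
    by (metis continuous_on_eq_continuous_at continuous_at tendsto_at_iff_tendsto_nhds)
  then have "\<forall>\<^sub>F x in nhds x0. dist (g x) (g x0) < 1" by (rule tendstoD) simp
  then have "\<forall>\<^sub>F x in nhds x0. norm (g x) \<le> (norm (g x0) + 1) * norm (x - x0) ^ 0"
  proof eventually_elim
    case (elim x)
    then show ?case using norm_triangle_ineq2[of "g x" "g x0"] by (simp add: dist_norm)
  qed
  then show ?case unfolding vanishing_order_ge_def by blast
next
  case (Suc m)
  have "vanishing_order_ge m (dir_deriv b g) x0" if "b \<in> Basis" for b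
    using that by (intro Suc.IH smooth_on_derivative[OF Suc.prems(1)]) (use Suc.prems(2)[of "b # _"] in auto)
  then obtain C where C: "\<And>b. b \<in> Basis \<Longrightarrow> \<forall>\<^sub>F x in nhds x0. norm (dir_deriv b g x) \<le> C b * norm (x - x0) ^ m"
    unfolding vanishing_order_ge_def by metis
  have "\<forall>\<^sub>F x in nhds x0. (\<forall>b\<in>Basis. norm (dir_deriv b g x) \<le> C b * norm (x - x0) ^ m) \<and> x \<in> S"
    using C assms(2,3) by (intro eventually_conj eventually_ball_finite) (auto intro: eventually_nhds_in_open)
  then obtain r where r: "r > 0"
    and D: "\<And>x b. dist x x0 < r \<Longrightarrow> b \<in> Basis \<Longrightarrow> norm (dir_deriv b g x) \<le> C b * norm (x - x0) ^ m"
    and S: "\<And>x. dist x x0 < r \<Longrightarrow> x \<in> S"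
    unfolding eventually_nhds_metric by metis
  define K where "K = (\<Sum>b\<in>(Basis::'a set). \<bar>C b\<bar>)"
  have on: "onorm (frechet_derivative g (at x)) \<le> K * norm (x - x0) ^ m" if "dist x x0 < r" for x
  proof (rule onorm_le)
    fix v
    have "frechet_derivative g (at x) v = (\<Sum>b\<in>Basis. (v \<bullet> b) *\<^sub>R dir_deriv b g x)"
      by (rule linear_Basis_expansion[OF has_derivative_bounded_linear[OF smooth_on_has_derivative[OF Suc.prems(1) S[OF that]]]])
    also have "norm \<dots> \<le> (\<Sum>b\<in>Basis. \<bar>C b\<bar> * (norm (x - x0) ^ m * norm v))"
    proof (rule sum_norm_le)
      fix b :: 'a assume b: "b \<in> Basis"
      have "norm ((v \<bullet> b) *\<^sub>R dir_deriv b g x) \<le> norm v * (\<bar>C b\<bar> * norm (x - x0) ^ m)"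
        unfolding norm_scaleR
      proof (rule mult_mono)
        show "\<bar>v \<bullet> b\<bar> \<le> norm v" using b by (rule Basis_le_norm)
        show "norm (dir_deriv b g x) \<le> \<bar>C b\<bar> * norm (x - x0) ^ m"
          using D[OF that b] by (rule order_trans) (auto intro!: mult_right_mono)
      qed auto
      then show "norm ((v \<bullet> b) *\<^sub>R dir_deriv b g x) \<le> \<bar>C b\<bar> * (norm (x - x0) ^ m * norm v)"
        by (simp add: algebra_simps)
    qed
    also have "\<dots> = K * norm (x - x0) ^ m * norm v" by (simp add: K_def sum_distrib_right mult.assoc)
    finally show "norm (frechet_derivative g (at x) v) \<le> K * norm (x - x0) ^ m * norm v" .
  qed
  have K: "K \<ge> 0" by (auto simp: K_def intro!: sum_nonneg)
  have "norm (g x) \<le> K * norm (x - x0) ^ Suc m" if x: "dist x x0 < r" for x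
  proof -
    have "norm (g x - g x0) \<le> K * norm (x - x0) ^ m * norm (x - x0)"
    proof (rule differentiable_bound[where f' = "\<lambda>y. frechet_derivative g (at y)" and S = "cball x0 (dist x x0)"])
      fix y assume y: "y \<in> cball x0 (dist x x0)"
      then have yr: "dist y x0 < r" using x by (simp add: dist_commute)
      show "(g has_derivative frechet_derivative g (at y)) (at y within cball x0 (dist x x0))"
        using smooth_on_has_derivative[OF Suc.prems(1) S[OF yr]] by (rule has_derivative_at_withinI)
      have "norm (y - x0) ^ m \<le> norm (x - x0) ^ m" using y by (intro power_mono) (auto simp: dist_norm norm_minus_commute)
      then show "onorm (frechet_derivative g (at y)) \<le> K * norm (x - x0) ^ m"
        using on[OF yr] K by (meson mult_left_mono order_trans)
    qed (auto simp: dist_commute)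
    moreover have "g x0 = 0" using Suc.prems(2)[of "[]"] by simp
    ultimately show ?thesis by (simp add: algebra_simps)
  qed
  then show ?case using r unfolding vanishing_order_ge_def eventually_nhds_metric by blast
qed

text \<open>A bound on values cannot be differentiated in general. For smooth \<open>g\<close> it
  can, because it amounts to the vanishing of Taylor coefficients.\<close>

lemma vanishing_order_ge_deriv:
  assumes "smooth_on g S" "open S" "x0 \<in> S" "vanishing_order_ge (Suc m) g x0"
  shows "vanishing_order_ge m (dir_deriv v g) x0"
proof (rule vanishing_order_geI[OF smooth_on_derivative[OF assms(1)] assms(2,3)])
  fix vs :: "'a list" assume "length vs < m"
  then show "iter_deriv vs (dir_deriv v g) x0 = 0"
    using iter_deriv_eq_0[OF assms, of "v # vs"] by simp
qed

section \<open>Smooth cutoff functions\<close>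

text \<open>All functions \<open>exp (- 1/t) / t ^ n\<close> at once, extended by 0: the derivative
  of each is a combination of two others, so an induction on the order of differentiability stays
  inside the family.\<close>

definition exp_inv :: "nat \<Rightarrow> real \<Rightarrow> real" where
  "exp_inv n t = (if t > 0 then exp (- inverse t) * inverse t ^ n else 0)"

lemma exp_inv_tendsto_0: "(exp_inv n \<longlongrightarrow> 0) (at 0)"
proof -
  have "((\<lambda>t. exp (- inverse t) * inverse t ^ n) \<longlongrightarrow> 0) (at_right (0::real))"
    using filterlim_compose[OF tendsto_power_div_exp_0 filterlim_inverse_at_top_right]
    by (simp add: exp_minus field_simps)
  moreover have "\<forall>\<^sub>F t::real in at_right 0. exp (- inverse t) * inverse t ^ n = exp_inv n t"
    by (rule eventually_mono[OF eventually_at_right_less[of 0]]) (simp add: exp_inv_def)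
  ultimately have "(exp_inv n \<longlongrightarrow> 0) (at_right 0)" by (rule Lim_transform_eventually)
  moreover have "\<forall>\<^sub>F t::real in at_left 0. 0 = exp_inv n t"
    by (rule eventually_mono[of "\<lambda>t. t < 0"]) (auto simp: exp_inv_def eventually_at_filter)
  then have "(exp_inv n \<longlongrightarrow> 0) (at_left 0)" by (rule Lim_transform_eventually[OF tendsto_const])
  ultimately show ?thesis by (simp add: filterlim_split_at)
qed

lemma exp_inv_has_derivative:
  "(exp_inv n has_real_derivative exp_inv (n + 2) t - n * exp_inv (n + 1) t) (at t)"
proof -
  consider "t > 0" | "t < 0" | "t = 0" by linarith
  then show ?thesis
  proof cases
    case 1
    have "((\<lambda>t. exp (- inverse t) * inverse t ^ n) has_real_derivative exp_inv (n + 2) t - n * exp_inv (n + 1) t) (at t)"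
    proof (cases n)
      case 0
      then show ?thesis using 1 by (auto intro!: derivative_eq_intros simp: exp_inv_def field_simps power2_eq_square)
    next
      case (Suc m)
      then show ?thesis using 1 
        by (auto intro!: derivative_eq_intros simp: exp_inv_def algebra_simps power2_eq_square) (cases m, auto)
    qed
    then show ?thesis
      by (rule has_field_derivative_transform_within_open[of _ _ _ "{0<..}"]) (use 1 in \<open>auto simp: exp_inv_def\<close>)
  next
    case 2
    have "((\<lambda>t. 0) has_real_derivative 0) (at t)" by simp
    then have "(exp_inv n has_real_derivative 0) (at t)"
      by (rule has_field_derivative_transform_within_open[of _ _ _ "{..<0}"]) (use 2 in \<open>auto simp: exp_inv_def\<close>)
    then show ?thesis using 2 by (simp add: exp_inv_def)
  next
    case 3
    \<comment> \<open>At 0 the difference quotient of \<open>exp_inv n\<close> is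
      \<open>exp_inv (n + 1)\<close> itself, also for negative \<open>h\<close>, where both are
      0.\<close>
    have "((\<lambda>h. (exp_inv n (0 + h) - exp_inv n 0) / h) \<longlongrightarrow> 0) (at 0)"
    proof (rule Lim_transform_eventually[OF exp_inv_tendsto_0[of "n + 1"]])
      show "\<forall>\<^sub>F h in at 0. exp_inv (n + 1) h = (exp_inv n (0 + h) - exp_inv n 0) / h"
        by (auto simp: exp_inv_def eventually_at_filter divide_inverse)
    qed
    then show ?thesis using 3 by (simp add: DERIV_def exp_inv_def)
  qed
qed

lemma smooth_on_exp_inv: "smooth_on (exp_inv n) S"
proof -
  have "times_differentiable_on k (exp_inv n) UNIV" for k
  proof (induction k arbitrary: n)
    case 0
    show ?case using exp_inv_has_derivative
      by (auto intro!: continuous_at_imp_continuous_on DERIV_isCont)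
  next
    case (Suc k)
    show ?case
    proof (rule times_differentiable_on_SucI)
      show "(exp_inv n has_derivative (\<lambda>v. (exp_inv (n + 2) t - n * exp_inv (n + 1) t) * v)) (at t)" for t
        using exp_inv_has_derivative[of n t] by (simp add: has_field_derivative_def)
      show "times_differentiable_on k (\<lambda>t. (exp_inv (n + 2) t - n * exp_inv (n + 1) t) * v) UNIV" for v
      proof -
        have eq: "(\<lambda>t. (exp_inv (n + 2) t - n * exp_inv (n + 1) t) * v) = (\<lambda>t. v * exp_inv (n + 2) t + (- n * v) * exp_inv (n + 1) t)"
          by (auto simp: algebra_simps)
        show ?thesis unfolding eq
          by (intro times_differentiable_on_add times_differentiable_on_bilinear[OF _ bounded_bilinear_mult]
              times_differentiable_on_const Suc.IH open_UNIV)
      qed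
    qed simp
  qed
  then show ?thesis unfolding smooth_on_def by (blast intro: times_differentiable_on_subset)
qed

lemma smooth_on_prod:
  fixes f :: "'i \<Rightarrow> 'a::euclidean_space \<Rightarrow> real"
  assumes "open S" "\<And>i. i \<in> I \<Longrightarrow> smooth_on (f i) S"
  shows "smooth_on (\<lambda>x. \<Prod>i\<in>I. f i x) S"
  using assms(2)
  by (induction I rule: infinite_finite_induct) (simp_all add: smooth_on_const smooth_on_mult assms(1))

text \<open>An even function that is 1 for \<open>\<bar>t\<bar> \<le> 1/2\<close> and 0 for
  \<open>\<bar>t\<bar> \<ge> 1\<close>. Using the square of \<open>t\<close> avoids the corner of
  the absolute value, and as 1/4 < 1 the two summands of the denominator never vanish
  together.\<close>

definition plateau :: "real \<Rightarrow> real" where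
  "plateau t = exp_inv 0 (1 - t\<^sup>2) / (exp_inv 0 (1 - t\<^sup>2) + exp_inv 0 (t\<^sup>2 - 1/4))"

lemma exp_inv_nonneg: "exp_inv n t \<ge> 0" and exp_inv_pos: "t > 0 \<Longrightarrow> exp_inv n t > 0" and exp_inv_0: "t \<le> 0 \<Longrightarrow> exp_inv n t = 0"
  by (auto simp: exp_inv_def)

lemma plateau_denominator_pos: "exp_inv 0 (1 - t\<^sup>2) + exp_inv 0 (t\<^sup>2 - 1/4) > 0"
  using exp_inv_nonneg[of 0 "1 - t\<^sup>2"] exp_inv_nonneg[of 0 "t\<^sup>2 - 1/4"] exp_inv_pos[of "1 - t\<^sup>2" 0] exp_inv_pos[of "t\<^sup>2 - 1/4" 0]
  by (cases "1 - t\<^sup>2 > 0") auto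

lemma smooth_on_plateau: "smooth_on plateau UNIV"
proof -
  have "smooth_on (\<lambda>t::real. exp_inv 0 (1 - t\<^sup>2)) UNIV" "smooth_on (\<lambda>t::real. exp_inv 0 (t\<^sup>2 - 1/4)) UNIV"
    by (intro smooth_on_compose[OF smooth_on_exp_inv[of 0 UNIV]] smooth_on_diff smooth_on_power smooth_on_const smooth_on_id open_UNIV; simp)+
  then have "smooth_on (\<lambda>t. exp_inv 0 (1 - t\<^sup>2) / (exp_inv 0 (1 - t\<^sup>2) + exp_inv 0 (t\<^sup>2 - 1/4))) UNIV"
    using plateau_denominator_pos by (intro smooth_on_divide smooth_on_add open_UNIV) (auto simp: less_imp_neq[symmetric])
  then show ?thesis by (simp add: plateau_def[abs_def])
qed

lemma plateau_nonneg: "plateau t \<ge> 0"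
  using plateau_denominator_pos[of t] exp_inv_nonneg[of 0 "1 - t\<^sup>2"] by (simp add: plateau_def)

lemma plateau_eq_1: "\<bar>t\<bar> \<le> 1/2 \<Longrightarrow> plateau t = 1"
  using plateau_denominator_pos[of t] power_mono[of "\<bar>t\<bar>" "1/2" 2] exp_inv_0[of "t\<^sup>2 - 1/4" 0]
  by (simp add: plateau_def power_divide)

lemma plateau_eq_0: "\<bar>t\<bar> \<ge> 1 \<Longrightarrow> plateau t = 0"
  using power_mono[of 1 "\<bar>t\<bar>" 2] exp_inv_0[of "1 - t\<^sup>2" 0] by (simp add: plateau_def)

text \<open>Cubes take the place of closed balls because a cube is a \<open>cbox\<close>, over which
  continuous functions are integrable, and because products of one-variable plateaus are supported
  in cubes.\<close>

definition cube :: "'a::euclidean_space \<Rightarrow> real \<Rightarrow> 'a set" where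
  "cube x0 r = cbox (x0 - r *\<^sub>R One) (x0 + r *\<^sub>R One)"

lemma mem_cube: "x \<in> cube x0 r \<longleftrightarrow> (\<forall>b\<in>Basis. \<bar>(x - x0) \<bullet> b\<bar> \<le> r)"
  by (auto simp: cube_def mem_box inner_diff_left inner_add_left abs_le_iff algebra_simps)

lemma cube_subset_cball: "cube (x0::'a::euclidean_space) r \<subseteq> cball x0 (r * DIM('a))"
proof
  fix x assume "x \<in> cube x0 r"
  then have "norm (x - x0) \<le> (\<Sum>b\<in>(Basis::'a set). r)"
    by (intro order_trans[OF norm_le_l1] sum_mono) (auto simp: mem_cube)
  then show "x \<in> cball x0 (r * DIM('a))" by (simp add: dist_norm norm_minus_commute mult.commute)
qed

lemma ball_subset_cube: "ball x0 r \<subseteq> cube x0 r"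
proof
  fix x assume "x \<in> ball x0 r"
  then show "x \<in> cube x0 r"
    unfolding mem_cube using Basis_le_norm[of _ "x - x0"] by (force simp: dist_norm norm_minus_commute)
qed

lemma cube_in_open:
  assumes "open S" "(x0::'a::euclidean_space) \<in> S"
  obtains r where "r > 0" "cube x0 r \<subseteq> S"
proof -
  obtain e where e: "e > 0" "cball x0 e \<subseteq> S" using assms open_contains_cball by metis
  show ?thesis
    using cube_subset_cball[of x0 "e / DIM('a)"] e by (intro that[of "e / DIM('a)"]) auto
qed

definition cutoff :: "'a::euclidean_space \<Rightarrow> real \<Rightarrow> 'a \<Rightarrow> real" where
  "cutoff x0 r x = (\<Prod>b\<in>Basis. plateau (((x - x0) \<bullet> b) / r))"

lemma smooth_on_cutoff: "smooth_on (cutoff (x0::'a::euclidean_space) r) S"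
proof -
  have "smooth_on (\<lambda>x::'a. plateau (((x - x0) \<bullet> b) / r)) UNIV" for b
    unfolding divide_inverse
    by (intro smooth_on_compose[OF smooth_on_plateau] smooth_on_mult smooth_on_inner smooth_on_diff smooth_on_const smooth_on_id open_UNIV UNIV_I)
  then have "smooth_on (cutoff x0 r) UNIV"
    unfolding cutoff_def[abs_def] by (intro smooth_on_prod) auto
  then show ?thesis by (rule smooth_on_subset) simp
qed

lemma cutoff_nonneg: "cutoff x0 r x \<ge> 0"
  unfolding cutoff_def by (intro prod_nonneg) (simp add: plateau_nonneg)

lemma cutoff_eq_1:
  assumes "r > 0" "x \<in> cube x0 (r/2)"
  shows "cutoff x0 r x = 1"
  unfolding cutoff_def
proof (rule prod.neutral, intro ballI plateau_eq_1)
  fix b :: 'a assume "b \<in> Basis"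
  then show "\<bar>(x - x0) \<bullet> b / r\<bar> \<le> 1 / 2" using assms by (auto simp: mem_cube field_simps)
qed

lemma cutoff_eq_0:
  assumes "r > 0" "x \<notin> cube x0 r"
  shows "cutoff x0 r x = 0"
proof -
  obtain b where b: "b \<in> Basis" "\<bar>(x - x0) \<bullet> b\<bar> > r" using assms by (auto simp: mem_cube not_le)
  then have "plateau (((x - x0) \<bullet> b) / r) = 0" using assms by (intro plateau_eq_0) auto
  then show ?thesis using b(1) unfolding cutoff_def by (intro prod_zero) auto
qed

text \<open>The open sets \<open>S\<close> and \<open>- K\<close> cover the space, and on each of
  them the extended function has a smooth formula.\<close>

lemma smooth_on_extend_by_0:
  assumes "open S" "closed K" "K \<subseteq> S" "smooth_on f S" "\<And>x. x \<in> S \<Longrightarrow> x \<notin> K \<Longrightarrow> f x = 0"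
  shows "smooth_on (\<lambda>x. if x \<in> S then f x else 0) UNIV"
proof (rule smooth_on_local)
  fix x
  show "\<exists>U g. open U \<and> x \<in> U \<and> smooth_on g U \<and> (\<forall>y\<in>U. (if y \<in> S then f y else 0) = g y)"
  proof (cases "x \<in> S")
    case True
    then show ?thesis using assms by (intro exI[of _ S] exI[of _ f]) auto
  next
    case False
    then show ?thesis using assms by (intro exI[of _ "- K"] exI[of _ "\<lambda>x. 0"]) (auto intro: smooth_on_const)
  qed
qed

section \<open>Integrals of derivatives\<close>

lemma integral_eq_integral_UNIV:
  fixes f :: "'a::euclidean_space \<Rightarrow> 'b::euclidean_space"
  assumes "\<And>x. x \<notin> S \<Longrightarrow> f x = 0"
  shows "integral S f = integral UNIV f"
proof -
  have "(\<lambda>x. if x \<in> S then f x else 0) = f" using assms by auto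
  then show ?thesis using integral_restrict_UNIV[of S f] by simp
qed

text \<open>The integral of the translate \<open>h (x + s *\<^sub>R v)\<close> does not depend on
  \<open>s\<close>; differentiating under the integral sign at \<open>s = 0\<close> gives the
  claim.\<close>

lemma integral_dir_deriv_eq_0:
  fixes h :: "'a::euclidean_space \<Rightarrow> real"
  assumes h: "smooth_on h UNIV" and 0: "\<And>x. x \<notin> cube x0 r \<Longrightarrow> h x = 0"
  shows "integral (cube x0 r) (dir_deriv v h) = 0"
proof -
  \<comment> \<open>Large enough to contain the supports of all translates with \<open>s\<close>
    between -1 and 1, so that their integrals over one fixed cube agree.\<close>
  let ?R = "r + norm v"
  have d: "(h has_derivative frechet_derivative h (at x)) (at x)" for x
    using smooth_on_has_derivative[OF h] by simp
  have D0: "dir_deriv v h x = 0" if "x \<notin> cube x0 r" for x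
  proof -
    have "frechet_derivative h (at x) = frechet_derivative (\<lambda>x. 0) (at x)"
      using that 0 by (intro frechet_derivative_cong[of "- cube x0 r"]) (auto simp: cube_def open_Compl)
    then show ?thesis by simp
  qed
  have const: "integral (cube x0 ?R) (\<lambda>x. h (x + s *\<^sub>R v)) = integral UNIV h" if "s \<in> {-1..1}" for s
  proof -
    have "integral (cube x0 ?R) (\<lambda>x. h (x + s *\<^sub>R v)) = integral (cbox (x0 - ?R *\<^sub>R One + s *\<^sub>R v) (x0 + ?R *\<^sub>R One + s *\<^sub>R v)) h"
      unfolding cube_def integral_shift_cbox_plus[symmetric] by (simp add: o_def add.commute)
    also have "\<dots> = integral UNIV h"
    proof (rule integral_eq_integral_UNIV, rule 0)
      fix x assume x: "x \<notin> cbox (x0 - ?R *\<^sub>R One + s *\<^sub>R v) (x0 + ?R *\<^sub>R One + s *\<^sub>R v)"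
      show "x \<notin> cube x0 r"
      proof
        assume "x \<in> cube x0 r"
        moreover have "\<bar>s * (v \<bullet> b)\<bar> \<le> norm v" if "b \<in> Basis" for b
          using Basis_le_norm[OF that, of v] \<open>s \<in> {-1..1}\<close> mult_mono[of "\<bar>s\<bar>" 1 "\<bar>v \<bullet> b\<bar>" "norm v"] by (auto simp: abs_mult)
        ultimately show False
          using x by (fastforce simp: mem_cube mem_box inner_simps abs_le_iff algebra_simps)
      qed
    qed
    finally show ?thesis .
  qed
  have "((\<lambda>s. integral (cbox (x0 - ?R *\<^sub>R One) (x0 + ?R *\<^sub>R One)) (\<lambda>x. h (x + s *\<^sub>R v))) has_field_derivative
      integral (cbox (x0 - ?R *\<^sub>R One) (x0 + ?R *\<^sub>R One)) (\<lambda>x. dir_deriv v h (x + 0 *\<^sub>R v))) (at 0 within {-1..1})"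
  proof (rule leibniz_rule_field_derivative)
    fix s :: real and x :: 'a
    have "((\<lambda>s. x + s *\<^sub>R v) has_derivative (\<lambda>k. k *\<^sub>R v)) (at s within {-1..1})"
      by (auto intro!: derivative_eq_intros)
    from has_derivative_compose[OF this d]
    have "((\<lambda>s. h (x + s *\<^sub>R v)) has_derivative (\<lambda>k. frechet_derivative h (at (x + s *\<^sub>R v)) (k *\<^sub>R v))) (at s within {-1..1})" .
    moreover have "frechet_derivative h (at (x + s *\<^sub>R v)) (k *\<^sub>R v) = dir_deriv v h (x + s *\<^sub>R v) * k" for k
      using linear.scaleR[OF bounded_linear.linear[OF has_derivative_bounded_linear[OF d[of "x + s *\<^sub>R v"]]], of k v] by simp
    ultimately show "((\<lambda>s. h (x + s *\<^sub>R v)) has_field_derivative dir_deriv v h (x + s *\<^sub>R v)) (at s within {-1..1})"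
      by (simp add: has_field_derivative_def)
  next
    fix s :: real
    show "(\<lambda>x. h (x + s *\<^sub>R v)) integrable_on cbox (x0 - ?R *\<^sub>R One) (x0 + ?R *\<^sub>R One)"
      by (intro integrable_continuous continuous_intros continuous_on_compose2[OF smooth_on_continuous[OF h]]) auto
    show "continuous_on ({- 1..1} \<times> cbox (x0 - ?R *\<^sub>R One) (x0 + ?R *\<^sub>R One)) (\<lambda>(s, x). dir_deriv v h (x + s *\<^sub>R v))"
      unfolding split_beta
      by (intro continuous_intros continuous_on_compose2[OF smooth_on_continuous[OF smooth_on_derivative[OF h]]]) auto
  qed auto
  then have 1: "((\<lambda>s. integral (cube x0 ?R) (\<lambda>x. h (x + s *\<^sub>R v))) has_field_derivative integral (cube x0 ?R) (dir_deriv v h)) (at 0 within {-1..1})"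
    by (simp add: cube_def)
  have 2: "((\<lambda>s. integral (cube x0 ?R) (\<lambda>x. h (x + s *\<^sub>R v))) has_field_derivative 0) (at 0 within {-1..1})"
    by (rule has_field_derivative_transform_within[of "\<lambda>s. integral UNIV h" _ _ _ 1]) (use const in auto)
  have "at (0::real) within {-1..1} = at 0" by (rule at_within_interior) auto
  then have "integral (cube x0 ?R) (dir_deriv v h) = 0"
    using DERIV_unique[of _ _ 0] 1 2 by metis
  moreover have "integral (cube x0 ?R) (dir_deriv v h) = integral UNIV (dir_deriv v h)"
  proof (rule integral_eq_integral_UNIV)
    fix x assume "x \<notin> cube x0 ?R"
    moreover have "cube x0 r \<subseteq> cube x0 ?R" by (fastforce simp: mem_cube intro: order_trans[of _ r])
    ultimately have "x \<notin> cube x0 r" by blast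
    then show "dir_deriv v h x = 0" by (rule D0)
  qed
  moreover have "integral (cube x0 r) (dir_deriv v h) = integral UNIV (dir_deriv v h)"
    using D0 by (rule integral_eq_integral_UNIV)
  ultimately show ?thesis by simp
qed

abbreviation e1 :: "real^2" where "e1 \<equiv> axis 1 1"
abbreviation e2 :: "real^2" where "e2 \<equiv> axis 2 1"

lemma Basis_real2: "(Basis :: (real^2) set) = {e1, e2}"
  by (auto simp: Basis_vec_def UNIV_2)

lemma e1_ne_e2: "e1 \<noteq> e2" by (simp add: axis_eq_axis)

lemma real2_expansion: "bounded_linear f \<Longrightarrow> f v = (v $ 1) *\<^sub>R f e1 + (v $ 2) *\<^sub>R f e2"
  using linear_Basis_expansion[of f v] e1_ne_e2 by (simp add: Basis_real2 inner_axis)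

section \<open>An energy estimate\<close>

text \<open>The derivative in direction \<open>v\<close> of
  \<open>((x - x0) \<bullet> v) * (g x \<bullet> g x)\<close> has integral 0, and the linear factor
  is at most \<open>r\<close> in absolute value on the cube.\<close>

lemma poincare_inequality:
  fixes g :: "'a::euclidean_space \<Rightarrow> 'b::euclidean_space"
  assumes g: "smooth_on g UNIV" and 0: "\<And>x. x \<notin> cube x0 r \<Longrightarrow> g x = 0" and v: "v \<in> Basis"
  shows "integral (cube x0 r) (\<lambda>x. (norm (g x))\<^sup>2) \<le> 4 * r\<^sup>2 * integral (cube x0 r) (\<lambda>x. (norm (dir_deriv v g x))\<^sup>2)"
proof -
  let ?h = "\<lambda>x. ((x - x0) \<bullet> v) * (g x \<bullet> g x)"
  have sh: "smooth_on ?h UNIV"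
    by (intro smooth_on_mult smooth_on_inner smooth_on_diff smooth_on_const smooth_on_id g open_UNIV)
  have h: "dir_deriv v ?h x = (norm (g x))\<^sup>2 + ((x - x0) \<bullet> v) * (2 * (g x \<bullet> dir_deriv v g x))" for x
  proof -
    have "(?h has_derivative (\<lambda>u. ((x - x0) \<bullet> v) * (g x \<bullet> frechet_derivative g (at x) u + frechet_derivative g (at x) u \<bullet> g x) + (u \<bullet> v) * (g x \<bullet> g x))) (at x)"
      by (intro has_derivative_mult has_derivative_inner has_derivative_inner_left smooth_on_has_derivative[OF g])
        (auto intro!: derivative_eq_intros)
    from frechet_derivative_at[OF this, symmetric] show ?thesis
      using v by (simp add: inner_commute power2_norm_eq_inner)
  qed
  have cg: "continuous_on (cube x0 r) g" and cdg: "continuous_on (cube x0 r) (dir_deriv v g)"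
    and ch: "continuous_on (cube x0 r) (dir_deriv v ?h)"
    by (auto intro!: continuous_on_subset[OF smooth_on_continuous] smooth_on_derivative g sh)
  have "integral (cube x0 r) (\<lambda>x. (norm (g x))\<^sup>2 / 2 - 2 * r\<^sup>2 * (norm (dir_deriv v g x))\<^sup>2)
      \<le> integral (cube x0 r) (dir_deriv v ?h)"
  proof (rule integral_le)
    fix x assume x: "x \<in> cube x0 r"
    define A where "A = norm (g x)"
    define B where "B = norm (dir_deriv v g x)"
    have "\<bar>(x - x0) \<bullet> v\<bar> * \<bar>g x \<bullet> dir_deriv v g x\<bar> \<le> r * (A * B)"
      using x v by (intro mult_mono) (auto simp: mem_cube A_def B_def Cauchy_Schwarz_ineq2 intro: order_trans[of 0 "\<bar>(x-x0)\<bullet>v\<bar>"])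
    then have "- (((x - x0) \<bullet> v) * (g x \<bullet> dir_deriv v g x)) \<le> r * (A * B)"
      by (simp add: abs_mult[symmetric] abs_le_iff)
    \<comment> \<open>The square is weighted so that half of \<open>A\<^sup>2\<close> survives,
      which produces the constant \<open>4 * r\<^sup>2\<close>.\<close>
    moreover have "0 \<le> (A / 2 - r * B)\<^sup>2" by simp
    then have "2 * (r * (A * B)) \<le> A\<^sup>2 / 2 + 2 * r\<^sup>2 * B\<^sup>2" by (simp add: power2_eq_square field_simps)
    ultimately show "(norm (g x))\<^sup>2 / 2 - 2 * r\<^sup>2 * (norm (dir_deriv v g x))\<^sup>2 \<le> dir_deriv v ?h x"
      unfolding h A_def[symmetric] B_def[symmetric] by simp
  qed (auto simp: cube_def intro!: integrable_continuous continuous_intros cg[unfolded cube_def] cdg[unfolded cube_def] ch[unfolded cube_def])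
  also have "\<dots> = 0" by (rule integral_dir_deriv_eq_0[OF sh]) (simp add: 0)
  also have "integral (cube x0 r) (\<lambda>x. (norm (g x))\<^sup>2 / 2 - 2 * r\<^sup>2 * (norm (dir_deriv v g x))\<^sup>2)
     = integral (cube x0 r) (\<lambda>x. (norm (g x))\<^sup>2) / 2 - 2 * r\<^sup>2 * integral (cube x0 r) (\<lambda>x. (norm (dir_deriv v g x))\<^sup>2)"
    by (subst integral_diff) (auto simp: cube_def intro!: integrable_continuous continuous_intros cg[unfolded cube_def] cdg[unfolded cube_def])
  finally show ?thesis by simp
qed

text \<open>The Jacobian determinant is a divergence: in the curl of \<open>Im g\<close> times the
  gradient of \<open>Re g\<close> the second derivatives cancel.\<close>

lemma integral_jacobian_eq_0:
  fixes g :: "real^2 \<Rightarrow> complex"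
  assumes g: "smooth_on g UNIV" and 0: "\<And>x. x \<notin> cube x0 r \<Longrightarrow> g x = 0"
  shows "integral (cube x0 r) (\<lambda>x. Im (dir_deriv e1 g x) * Re (dir_deriv e2 g x) - Re (dir_deriv e1 g x) * Im (dir_deriv e2 g x)) = 0"
proof -
  let ?h = "\<lambda>v x. Im (g x) * Re (dir_deriv v g x)"
  have dg: "smooth_on (dir_deriv v g) UNIV" for v by (rule smooth_on_derivative[OF g])
  have sh: "smooth_on (?h v) UNIV" for v
    by (intro smooth_on_mult smooth_on_Re smooth_on_Im dg g open_UNIV)
  have h: "dir_deriv u (?h v) x = Im (dir_deriv u g x) * Re (dir_deriv v g x) + Im (g x) * Re (iter_deriv [v, u] g x)" for u v x
  proof -
    have "(?h v has_derivative (\<lambda>w. Im (g x) * Re (frechet_derivative (dir_deriv v g) (at x) w) + Im (frechet_derivative g (at x) w) * Re (dir_deriv v g x))) (at x)"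
      by (intro has_derivative_mult has_derivative_Re has_derivative_Im smooth_on_has_derivative[OF g] smooth_on_has_derivative[OF dg] UNIV_I)
    from frechet_derivative_at[OF this, symmetric] show ?thesis by simp
  qed
  have "integral (cube x0 r) (\<lambda>x. dir_deriv e1 (?h e2) x - dir_deriv e2 (?h e1) x) =
    integral (cube x0 r) (dir_deriv e1 (?h e2)) - integral (cube x0 r) (dir_deriv e2 (?h e1))"
    by (rule integral_diff) (auto simp: cube_def intro!: integrable_continuous continuous_on_subset[OF smooth_on_continuous[OF smooth_on_derivative[OF sh]]])
  also have "\<dots> = 0"
    using integral_dir_deriv_eq_0[OF sh, of x0 r] 0 by simp
  also have "(\<lambda>x. dir_deriv e1 (?h e2) x - dir_deriv e2 (?h e1) x) =
    (\<lambda>x. Im (dir_deriv e1 g x) * Re (dir_deriv e2 g x) - Re (dir_deriv e1 g x) * Im (dir_deriv e2 g x))"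
    using mixed_derivatives_commute[OF g open_UNIV UNIV_I, of e1 e2] by (simp add: h algebra_simps)
  finally show ?thesis .
qed

text \<open>Up to the Jacobian term, the left-hand square is the real quadratic form with diagonal
  entries |b|^2, |a|^2 and off-diagonal entry - Re (b cnj a). Its determinant is the numerator of
  \<open>l\<close> and its trace the denominator, and determinant over trace is a lower bound for
  the smallest eigenvalue.\<close>

lemma quadratic_form_bound:
  fixes a b x y :: complex
  assumes I: "Im (b * cnj a) \<noteq> 0"
  defines "l \<equiv> (Im (b * cnj a))\<^sup>2 / ((cmod a)\<^sup>2 + (cmod b)\<^sup>2)"
  shows "l > 0"
    and "(cmod (b * x - a * y))\<^sup>2 \<ge> l * ((cmod x)\<^sup>2 + (cmod y)\<^sup>2) + 2 * Im (b * cnj a) * (Im x * Re y - Re x * Im y)"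
proof -
  define A B R I' where "A = (cmod b)\<^sup>2" and "B = (cmod a)\<^sup>2" and "R = Re (b * cnj a)" and "I' = Im (b * cnj a)"
  have AB: "A * B = R\<^sup>2 + I'\<^sup>2"
    unfolding A_def B_def R_def I'_def cmod_power2 by (simp add: power2_eq_square algebra_simps)
  have "a \<noteq> 0" "b \<noteq> 0" using I by auto
  then have A: "A > 0" and B: "B > 0" by (simp_all add: A_def B_def)
  have I0: "I'\<^sup>2 > 0" using I by (simp add: I'_def)
  have l: "l * (A + B) = I'\<^sup>2" using A B by (simp add: l_def A_def B_def I'_def add.commute)
  show l0: "l > 0" using A B I0 by (simp add: l_def A_def B_def I'_def add_pos_pos)
  have "l * A + l * B < A * A + A * B"
    using l AB mult_pos_pos[OF A A] zero_le_power2[of R] unfolding distrib_left by linarith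
  then have Al: "A > l" using A B by (metis add_pos_pos distrib_left mult.commute mult_less_cancel_left_pos)
  \<comment> \<open>By the choice of \<open>l\<close>, subtracting it from the diagonal leaves the
    determinant \<open>l\<^sup>2\<close>; hence completing the square below has a nonnegative
    remainder.\<close>
  have det: "(A - l) * (B - l) - R\<^sup>2 = l\<^sup>2" using l AB by (simp add: algebra_simps power2_eq_square)
  define P where "P = Re x * Re y + Im x * Im y"
  have "(A - l) * ((A - l) * (cmod x)\<^sup>2 + (B - l) * (cmod y)\<^sup>2 - 2 * R * P)
     = (cmod ((A - l) *\<^sub>R x - R *\<^sub>R y))\<^sup>2 + ((A - l) * (B - l) - R\<^sup>2) * (cmod y)\<^sup>2"
    unfolding P_def cmod_power2 by (simp add: power2_eq_square algebra_simps)
  also have "\<dots> \<ge> 0" unfolding det by simp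
  finally have "(A - l) * (cmod x)\<^sup>2 + (B - l) * (cmod y)\<^sup>2 - 2 * R * P \<ge> 0"
    using Al by (simp add: zero_le_mult_iff)
  moreover have "(cmod (b * x - a * y))\<^sup>2 = A * (cmod x)\<^sup>2 + B * (cmod y)\<^sup>2 - 2 * R * P + 2 * I' * (Im x * Re y - Re x * Im y)"
    unfolding A_def B_def R_def I'_def P_def cmod_power2 by (simp add: power2_eq_square algebra_simps)
  ultimately show "(cmod (b * x - a * y))\<^sup>2 \<ge> l * ((cmod x)\<^sup>2 + (cmod y)\<^sup>2) + 2 * Im (b * cnj a) * (Im x * Re y - Re x * Im y)"
    unfolding I'_def[symmetric] by (simp add: algebra_simps)
qed

text \<open>With constant coefficients \<open>a\<close> and \<open>b\<close> the indefinite Jacobian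
  term integrates to 0, so the pointwise bound becomes coercivity of the operator. Variable
  coefficients are handled later as a small perturbation.\<close>

lemma energy_estimate:
  fixes g :: "real^2 \<Rightarrow> complex"
  assumes g: "smooth_on g UNIV" and 0: "\<And>x. x \<notin> cube x0 r \<Longrightarrow> g x = 0"
    and I: "Im (b * cnj a) \<noteq> 0"
  defines "l \<equiv> (Im (b * cnj a))\<^sup>2 / ((cmod a)\<^sup>2 + (cmod b)\<^sup>2)"
  shows "l * integral (cube x0 r) (\<lambda>x. (cmod (dir_deriv e1 g x))\<^sup>2 + (cmod (dir_deriv e2 g x))\<^sup>2) \<le>
    integral (cube x0 r) (\<lambda>x. (cmod (b * dir_deriv e1 g x - a * dir_deriv e2 g x))\<^sup>2)"
proof -
  let ?J = "\<lambda>x. Im (dir_deriv e1 g x) * Re (dir_deriv e2 g x) - Re (dir_deriv e1 g x) * Im (dir_deriv e2 g x)"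
  have cont: "continuous_on S (dir_deriv v g)" for S v
    by (auto intro!: continuous_on_subset[OF smooth_on_continuous] smooth_on_derivative g)
  have "integral (cube x0 r) (\<lambda>x. l * ((cmod (dir_deriv e1 g x))\<^sup>2 + (cmod (dir_deriv e2 g x))\<^sup>2) + (2 * Im (b * cnj a)) * ?J x)
    \<le> integral (cube x0 r) (\<lambda>x. (cmod (b * dir_deriv e1 g x - a * dir_deriv e2 g x))\<^sup>2)"
    using quadratic_form_bound(2)[OF I] I unfolding l_def
    by (intro integral_le) (auto simp: cube_def mult.assoc intro!: integrable_continuous continuous_intros cont)
  also have "integral (cube x0 r) (\<lambda>x. l * ((cmod (dir_deriv e1 g x))\<^sup>2 + (cmod (dir_deriv e2 g x))\<^sup>2) + (2 * Im (b * cnj a)) * ?J x)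
    = l * integral (cube x0 r) (\<lambda>x. (cmod (dir_deriv e1 g x))\<^sup>2 + (cmod (dir_deriv e2 g x))\<^sup>2) + (2 * Im (b * cnj a)) * integral (cube x0 r) ?J"
    by (subst integral_add) (auto simp: cube_def intro!: integrable_continuous continuous_intros cont)
  finally show ?thesis using integral_jacobian_eq_0[OF g 0] by simp
qed

section \<open>Functions vanishing to infinite order\<close>

lemma vanishing_order_ge_mult:
  fixes f g :: "'a::euclidean_space \<Rightarrow> complex"
  assumes "vanishing_order_ge i f x0" "vanishing_order_ge j g x0"
  shows "vanishing_order_ge (i + j) (\<lambda>x. f x * g x) x0"
proof -
  obtain C D where "\<forall>\<^sub>F x in nhds x0. norm (f x) \<le> C * norm (x - x0) ^ i" "\<forall>\<^sub>F x in nhds x0. norm (g x) \<le> D * norm (x - x0) ^ j"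
    using assms by (auto simp: vanishing_order_ge_def)
  then have "\<forall>\<^sub>F x in nhds x0. norm (f x * g x) \<le> (\<bar>C\<bar> * \<bar>D\<bar>) * norm (x - x0) ^ (i + j)"
  proof eventually_elim
    case (elim x)
    have "norm (f x) \<le> \<bar>C\<bar> * norm (x - x0) ^ i"
      using elim(1) by (rule order_trans) (auto intro!: mult_right_mono)
    moreover have "norm (g x) \<le> \<bar>D\<bar> * norm (x - x0) ^ j"
      using elim(2) by (rule order_trans) (auto intro!: mult_right_mono)
    ultimately have "norm (f x) * norm (g x) \<le> (\<bar>C\<bar> * norm (x - x0) ^ i) * (\<bar>D\<bar> * norm (x - x0) ^ j)"
      by (intro mult_mono) auto
    then show ?case by (simp add: norm_mult power_add algebra_simps)
  qed
  then show ?thesis unfolding vanishing_order_ge_def by blast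
qed

lemma vanishing_order_ge_add:
  assumes "vanishing_order_ge i f x0" "vanishing_order_ge i g x0"
  shows "vanishing_order_ge i (\<lambda>x. f x + g x) x0"
proof -
  obtain C D where "\<forall>\<^sub>F x in nhds x0. norm (f x) \<le> C * norm (x - x0) ^ i" "\<forall>\<^sub>F x in nhds x0. norm (g x) \<le> D * norm (x - x0) ^ i"
    using assms by (auto simp: vanishing_order_ge_def)
  then have "\<forall>\<^sub>F x in nhds x0. norm (f x + g x) \<le> (C + D) * norm (x - x0) ^ i"
    by eventually_elim (use norm_triangle_ineq in \<open>fastforce simp: distrib_right intro: order_trans add_mono\<close>)
  then show ?thesis unfolding vanishing_order_ge_def by blast
qed

lemma vanishing_order_ge_minus: "vanishing_order_ge i f x0 \<Longrightarrow> vanishing_order_ge i (\<lambda>x. - f x) x0"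
  by (simp add: vanishing_order_ge_def)

lemma vanishing_order_ge_diff:
  "vanishing_order_ge i f x0 \<Longrightarrow> vanishing_order_ge i g x0 \<Longrightarrow> vanishing_order_ge i (\<lambda>x. f x - g x) x0"
  using vanishing_order_ge_add[of i f x0 "\<lambda>x. - g x"] vanishing_order_ge_minus[of i g x0] by simp

lemma vanishing_order_ge_0: "smooth_on g S \<Longrightarrow> open S \<Longrightarrow> x0 \<in> S \<Longrightarrow> vanishing_order_ge 0 g x0"
  by (rule vanishing_order_geI) auto

lemma vanishing_order_ge_1:
  "smooth_on g S \<Longrightarrow> open S \<Longrightarrow> x0 \<in> S \<Longrightarrow> g x0 = 0 \<Longrightarrow> vanishing_order_ge 1 g x0"
  by (rule vanishing_order_geI) auto

lemma vanishing_order_ge_eq_0: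
  "vanishing_order_ge (Suc m) g x0 \<Longrightarrow> g x0 = 0"
  using eventually_nhds_x_imp_x by (fastforce simp: vanishing_order_ge_def)

lemma has_derivative_0_if_quadratic:
  fixes h :: "'a::euclidean_space \<Rightarrow> 'b::euclidean_space"
  assumes "vanishing_order_ge 2 h x0"
  shows "(h has_derivative (\<lambda>v. 0)) (at x0)"
proof -
  obtain C where C: "\<forall>\<^sub>F x in nhds x0. norm (h x) \<le> C * norm (x - x0) ^ 2"
    using assms by (auto simp: vanishing_order_ge_def)
  have h0: "h x0 = 0" using assms vanishing_order_ge_eq_0[of 1 h x0] by (simp add: numeral_2_eq_2)
  have "((\<lambda>y. (1 / norm (y - x0)) *\<^sub>R (h y - (h x0 + 0))) \<longlongrightarrow> 0) (at x0)"
  proof (rule Lim_null_comparison)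
    show "\<forall>\<^sub>F y in at x0. norm ((1 / norm (y - x0)) *\<^sub>R (h y - (h x0 + 0))) \<le> C * norm (y - x0)"
      using C[unfolded eventually_nhds_conv_at, THEN conjunct1]
      by eventually_elim (auto simp: h0 divide_le_eq power2_eq_square mult.assoc)
    show "((\<lambda>y. C * norm (y - x0)) \<longlongrightarrow> 0) (at x0)"
      by (auto intro!: tendsto_eq_intros)
  qed
  then show ?thesis by (simp add: has_derivative_at_within bounded_linear_zero has_derivative_def Lim_at divide_inverse_commute)
qed

text \<open>Prepares the functions \<open>w / \<zeta> ^ n\<close> of the unique continuation
  argument: if \<open>w\<close> vanishes to infinite order at \<open>x0\<close>, they are smooth
  across the zero of \<zeta>. Their value at \<open>x0\<close> is the right one, 0, by the
  convention for division by 0.\<close>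

locale flat_quotient =
  fixes S :: "'a::euclidean_space set" and x0 :: 'a and \<zeta> :: "'a \<Rightarrow> complex" and c :: real
  assumes S: "open S" "x0 \<in> S" and \<zeta>: "smooth_on \<zeta> S" "\<zeta> x0 = 0" and c: "c > 0"
    and lower: "\<And>x. x \<in> S \<Longrightarrow> c * norm (x - x0) \<le> cmod (\<zeta> x)"
begin

lemma nonzero: "x \<in> S \<Longrightarrow> x \<noteq> x0 \<Longrightarrow> \<zeta> x \<noteq> 0"
  using lower[of x] c by (metis mult_pos_pos norm_zero not_le right_minus_eq zero_less_norm_iff)

lemma vanishing_order_ge_quotient:
  assumes "vanishing_order_ge (m + n) k x0"
  shows "vanishing_order_ge m (\<lambda>x. k x / \<zeta> x ^ n) x0"
proof -
  obtain C where "\<forall>\<^sub>F x in nhds x0. norm (k x) \<le> C * norm (x - x0) ^ (m + n)"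
    using assms by (auto simp: vanishing_order_ge_def)
  moreover have "\<forall>\<^sub>F x in nhds x0. x \<in> S" using S by (rule eventually_nhds_in_open)
  ultimately have "\<forall>\<^sub>F x in nhds x0. norm (k x / \<zeta> x ^ n) \<le> (\<bar>C\<bar> / c ^ n) * norm (x - x0) ^ m"
  proof eventually_elim
    case (elim x)
    show ?case
    proof (cases "\<zeta> x = 0 \<and> n > 0")
      case True
      then show ?thesis using c by (simp add: power_0_left)
    next
      case False
      then have p: "cmod (\<zeta> x) ^ n > 0" by auto
      have "norm (k x) \<le> \<bar>C\<bar> * norm (x - x0) ^ m * norm (x - x0) ^ n"
        using elim(1) by (rule order_trans) (auto simp: power_add mult.assoc intro!: mult_right_mono)
      also have "norm (x - x0) ^ n \<le> (cmod (\<zeta> x) / c) ^ n"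
        using lower[OF elim(2)] c by (intro power_mono) (auto simp: field_simps)
      finally have "norm (k x) \<le> \<bar>C\<bar> * norm (x - x0) ^ m * (cmod (\<zeta> x) / c) ^ n"
        by (simp add: mult_left_mono)
      then show ?thesis using p c by (simp add: norm_divide norm_power power_divide divide_le_eq)
    qed
  qed
  then show ?thesis unfolding vanishing_order_ge_def by blast
qed

lemma quotient_has_derivative:
  assumes k: "smooth_on k S" and flat: "\<And>m. vanishing_order_ge m k x0" and x: "x \<in> S"
  shows "((\<lambda>x. k x / \<zeta> x ^ n) has_derivative
    (\<lambda>v. (dir_deriv v k x * \<zeta> x - of_nat n * k x * dir_deriv v \<zeta> x) / \<zeta> x ^ Suc n)) (at x)"
proof (cases "x = x0")
  case True
  \<comment> \<open>At \<open>x0\<close> the claimed derivative is 0 as well, since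
    \<open>\<zeta> x0 = 0\<close> stands in its denominator.\<close>
  then show ?thesis using has_derivative_0_if_quadratic[OF vanishing_order_ge_quotient[OF flat]] \<zeta> by simp
next
  case False
  have z: "\<zeta> x \<noteq> 0" using nonzero[OF x False] .
  have "((\<lambda>x. k x / \<zeta> x ^ n) has_derivative
    (\<lambda>v. (frechet_derivative k (at x) v * \<zeta> x ^ n - k x * (of_nat n * frechet_derivative \<zeta> (at x) v * \<zeta> x ^ (n - 1))) / (\<zeta> x ^ n * \<zeta> x ^ n))) (at x)"
    by (intro has_derivative_divide' has_derivative_power smooth_on_has_derivative[OF k x] smooth_on_has_derivative[OF \<zeta>(1) x])
      (use z in simp)
  moreover have "(p * \<zeta> x ^ n - k x * (of_nat n * q * \<zeta> x ^ (n - 1))) / (\<zeta> x ^ n * \<zeta> x ^ n)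
     = (p * \<zeta> x - of_nat n * k x * q) / \<zeta> x ^ Suc n" for p q
    using z by (cases n) (auto simp: field_simps)
  ultimately show ?thesis by simp
qed

text \<open>The derivative of a quotient is again a flat function over a power of \<zeta>, with
  \<open>n\<close> raised by one. The induction therefore runs over all numerators and exponents
  simultaneously.\<close>

lemma smooth_on_quotient:
  assumes "smooth_on k S" "\<And>m. vanishing_order_ge m k x0"
  shows "smooth_on (\<lambda>x. k x / \<zeta> x ^ n) S"
proof -
  have "times_differentiable_on N (\<lambda>x. k x / \<zeta> x ^ n) S" for N
    using assms
  proof (induction N arbitrary: k n)
    case 0
    have "continuous (at x) (\<lambda>x. k x / \<zeta> x ^ n)" if "x \<in> S" for x
      using quotient_has_derivative[OF 0 that] by (rule has_derivative_continuous)
    then show ?case by (simp add: continuous_at_imp_continuous_on)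
  next
    case (Suc N)
    show ?case
    proof (rule times_differentiable_on_SucI[OF S(1) quotient_has_derivative[OF Suc.prems]])
      fix v
      show "times_differentiable_on N (\<lambda>x. (dir_deriv v k x * \<zeta> x - of_nat n * k x * dir_deriv v \<zeta> x) / \<zeta> x ^ Suc n) S"
      proof (rule Suc.IH)
        show "smooth_on (\<lambda>x. dir_deriv v k x * \<zeta> x - of_nat n * k x * dir_deriv v \<zeta> x) S"
          by (intro smooth_on_diff smooth_on_mult smooth_on_derivative smooth_on_const Suc.prems \<zeta> S)
        fix m
        have "vanishing_order_ge (m + 0) (\<lambda>x. dir_deriv v k x * \<zeta> x) x0"
          by (intro vanishing_order_ge_mult vanishing_order_ge_deriv[OF Suc.prems(1) S] Suc.prems vanishing_order_ge_0[OF \<zeta>(1) S])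
        moreover have "vanishing_order_ge (m + 0) (\<lambda>x. k x * (of_nat n * dir_deriv v \<zeta> x)) x0"
          by (intro vanishing_order_ge_mult Suc.prems vanishing_order_ge_0[OF _ S] smooth_on_mult smooth_on_const smooth_on_derivative \<zeta> S)
        ultimately show "vanishing_order_ge m (\<lambda>x. dir_deriv v k x * \<zeta> x - of_nat n * k x * dir_deriv v \<zeta> x) x0"
          using vanishing_order_ge_diff[of m "\<lambda>x. dir_deriv v k x * \<zeta> x" x0] by (simp add: mult_ac)
      qed
    qed
  qed
  then show ?thesis by (simp add: smooth_on_def)
qed

end

section \<open>Maps of the plane with invertible differential\<close>

lemma eventually_cubeD:
  assumes "\<forall>\<^sub>F x in nhds (x0::'a::euclidean_space). P x"
  obtains d where "d > 0" "\<And>r x. r \<le> d \<Longrightarrow> x \<in> cube x0 r \<Longrightarrow> P x"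
proof -
  obtain U where U: "open U" "x0 \<in> U" "\<And>x. x \<in> U \<Longrightarrow> P x"
    using assms by (auto simp: eventually_nhds)
  obtain d where d: "d > 0" "cube x0 d \<subseteq> U" using cube_in_open[OF U(1,2)] .
  have "cube x0 r \<subseteq> cube x0 d" if "r \<le> d" for r using that by (fastforce simp: mem_cube intro: order_trans)
  then show ?thesis using that[of d] d U(3) by blast
qed

lemma smooth_on_tendsto: "smooth_on f S \<Longrightarrow> open S \<Longrightarrow> x \<in> S \<Longrightarrow> (f \<longlongrightarrow> f x) (nhds x)"
  by (metis smooth_on_continuous continuous_on_eq_continuous_at continuous_at tendsto_at_iff_tendsto_nhds)

text \<open>The quantity assumed to be nonzero is the real Jacobian determinant of \<zeta> at
  \<open>x0\<close>, so the differential is injective.\<close>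

lemma derivative_bounded_below:
  fixes \<zeta> :: "real^2 \<Rightarrow> complex"
  assumes \<zeta>: "smooth_on \<zeta> S" "open S" "x0 \<in> S"
    and I: "Im (dir_deriv e2 \<zeta> x0 * cnj (dir_deriv e1 \<zeta> x0)) \<noteq> 0"
  obtains B where "B > 0" "\<And>v. B * norm v \<le> cmod (dir_deriv v \<zeta> x0)"
proof -
  let ?L = "frechet_derivative \<zeta> (at x0)"
  have d: "(\<zeta> has_derivative ?L) (at x0)" by (rule smooth_on_has_derivative[OF \<zeta>(1,3)])
  have lin: "linear ?L" using has_derivative_bounded_linear[OF d] by (rule bounded_linear.linear)
  have "v = 0" if "?L v = 0" for v
  proof -
    let ?a = "dir_deriv e1 \<zeta> x0" and ?b = "dir_deriv e2 \<zeta> x0"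
    have eq: "of_real (v $ 1) * ?a + of_real (v $ 2) * ?b = 0"
      using real2_expansion[OF has_derivative_bounded_linear[OF d], of v] that by (simp add: scaleR_conv_of_real)
    then have "Im ((of_real (v $ 1) * ?a + of_real (v $ 2) * ?b) * cnj ?a) = 0" "Im ((of_real (v $ 1) * ?a + of_real (v $ 2) * ?b) * cnj ?b) = 0"
      by simp_all
    then have "v $ 2 * Im (?b * cnj ?a) = 0" "v $ 1 * Im (?b * cnj ?a) = 0"
      by (auto simp: algebra_simps)
    then show "v = 0" using I by (simp add: vec_eq_iff forall_2)
  qed
  then have "inj ?L" using lin by (simp add: linear_injective_0)
  then show ?thesis using linear_inj_bounded_below_pos[OF lin] that by metis
qed

lemma derivative_lower_bound:
  fixes \<zeta> :: "real^2 \<Rightarrow> complex"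
  assumes \<zeta>: "smooth_on \<zeta> S" "open S" "x0 \<in> S" and 0: "\<zeta> x0 = 0"
    and I: "Im (dir_deriv e2 \<zeta> x0 * cnj (dir_deriv e1 \<zeta> x0)) \<noteq> 0"
  obtains c where "c > 0" "\<forall>\<^sub>F x in nhds x0. c * norm (x - x0) \<le> cmod (\<zeta> x)"
proof -
  let ?L = "frechet_derivative \<zeta> (at x0)"
  have d: "(\<zeta> has_derivative ?L) (at x0)" by (rule smooth_on_has_derivative[OF \<zeta>(1,3)])
  obtain B where B: "B > 0" "\<And>v. B * norm v \<le> norm (?L v)"
    by (rule derivative_bounded_below[OF \<zeta> I]) blast
  then have "\<exists>d>0. \<forall>y. norm (y - x0) < d \<longrightarrow> norm (\<zeta> y - \<zeta> x0 - ?L (y - x0)) \<le> (B / 2) * norm (y - x0)"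
    using d unfolding has_derivative_at_alt by (metis half_gt_zero)
  then have "\<forall>\<^sub>F y in nhds x0. norm (\<zeta> y - \<zeta> x0 - ?L (y - x0)) \<le> (B / 2) * norm (y - x0)"
    by (simp add: eventually_nhds_metric dist_norm)
  then have "\<forall>\<^sub>F y in nhds x0. (B / 2) * norm (y - x0) \<le> cmod (\<zeta> y)"
  proof eventually_elim
    case (elim y)
    then show ?case using B(2)[of "y - x0"] norm_triangle_ineq2[of "?L (y - x0)" "\<zeta> y"] 0 by (simp add: norm_minus_commute)
  qed
  then show ?thesis using that[of "B / 2"] B(1) by simp
qed

lemma sum_squares_3: "(x + y + z)\<^sup>2 \<le> 3 * (x\<^sup>2 + y\<^sup>2 + z\<^sup>2)" for x y z :: real
proof -
  have "0 \<le> (x - y)\<^sup>2 + (y - z)\<^sup>2 + (x - z)\<^sup>2" by simp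
  then show ?thesis by (simp add: power2_eq_square algebra_simps)
qed

text \<open>The operator \<open>w \<mapsto> \<zeta>\<^sub>2 w\<^sub>1 - \<zeta>\<^sub>1 w\<^sub>2\<close> is a multiple of the Cauchy--Riemann operator in the coordinate \<open>\<zeta>\<close>.\<close>

lemma cauchy_riemann_estimate:
  fixes \<zeta> g :: "real^2 \<Rightarrow> complex"
  assumes \<zeta>: "smooth_on \<zeta> S" "open S" "x0 \<in> S"
    and I: "Im (dir_deriv e2 \<zeta> x0 * cnj (dir_deriv e1 \<zeta> x0)) \<noteq> 0"
  obtains M d where "M > 0" "d > 0" 
    and "\<And>r g. 0 < r \<Longrightarrow> r \<le> d \<Longrightarrow> smooth_on g UNIV \<Longrightarrow> (\<And>x. x \<notin> cube x0 r \<Longrightarrow> g x = 0) \<Longrightarrow>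
      integral (cube x0 r) (\<lambda>x. (cmod (g x))\<^sup>2) \<le> M * r\<^sup>2 *
      integral (cube x0 r) (\<lambda>x. (cmod (dir_deriv e2 \<zeta> x * dir_deriv e1 g x - dir_deriv e1 \<zeta> x * dir_deriv e2 g x))\<^sup>2)"
proof -
  let ?a = "dir_deriv e1 \<zeta> x0" and ?b = "dir_deriv e2 \<zeta> x0"
  define l where "l = (Im (?b * cnj ?a))\<^sup>2 / ((cmod ?a)\<^sup>2 + (cmod ?b)\<^sup>2)"
  have l: "l > 0" unfolding l_def by (rule quadratic_form_bound(1)[OF I])
  \<comment> \<open>The square of a sum of three terms costs a factor 3, and
    \<open>3 * e\<^sup>2 = l / 2\<close> can then be absorbed into the left-hand side.\<close>
  define e where "e = sqrt (l / 6)"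
  have e: "e > 0" "e\<^sup>2 = l / 6" using l by (auto simp: e_def)
  have close: "\<forall>\<^sub>F x in nhds x0. cmod (dir_deriv v \<zeta> x - dir_deriv v \<zeta> x0) < e" for v
    using tendstoD[OF smooth_on_tendsto[OF smooth_on_derivative[OF \<zeta>(1)] \<zeta>(2,3)] e(1)] by (simp add: dist_norm)
  have "\<forall>\<^sub>F x in nhds x0. x \<in> S \<and> cmod (dir_deriv e1 \<zeta> x - ?a) < e \<and> cmod (dir_deriv e2 \<zeta> x - ?b) < e"
    by (intro eventually_conj close eventually_nhds_in_open \<zeta>)
  then obtain d where d: "d > 0"
    and near: "\<And>r x. r \<le> d \<Longrightarrow> x \<in> cube x0 r \<Longrightarrow> x \<in> S \<and> cmod (dir_deriv e1 \<zeta> x - ?a) < e \<and> cmod (dir_deriv e2 \<zeta> x - ?b) < e"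
    by (rule eventually_cubeD) blast
  show ?thesis
  \<comment> \<open>The constant is the Poincare factor 4 times \<open>6 / l\<close>, the latter
    from \<open>l / 2\<close> on the left and 3 on the right of the energy comparison.\<close>
  proof (rule that[of "24 / l" d])
    fix r :: real and g :: "real^2 \<Rightarrow> complex"
    assume r: "0 < r" "r \<le> d" and g: "smooth_on g UNIV" and g0: "\<And>x. x \<notin> cube x0 r \<Longrightarrow> g x = 0"
    let ?T = "\<lambda>x. dir_deriv e2 \<zeta> x * dir_deriv e1 g x - dir_deriv e1 \<zeta> x * dir_deriv e2 g x"
    let ?E = "\<lambda>x. (cmod (dir_deriv e1 g x))\<^sup>2 + (cmod (dir_deriv e2 g x))\<^sup>2"
    have sub: "cube x0 r \<subseteq> S" using near r by blast
    have cg: "continuous_on (cube x0 r) (dir_deriv v g)" for v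
      by (auto intro!: continuous_on_subset[OF smooth_on_continuous] smooth_on_derivative g)
    have c\<zeta>: "continuous_on (cube x0 r) (dir_deriv v \<zeta>)" for v
      by (rule continuous_on_subset[OF smooth_on_continuous[OF smooth_on_derivative[OF \<zeta>(1)]] sub])
    have iE: "?E integrable_on cube x0 r" and iT: "(\<lambda>x. (cmod (?T x))\<^sup>2) integrable_on cube x0 r"
      unfolding cube_def
      by (intro integrable_continuous continuous_intros cg[unfolded cube_def] c\<zeta>[unfolded cube_def])+
    have "l * integral (cube x0 r) ?E \<le> integral (cube x0 r) (\<lambda>x. (cmod (?b * dir_deriv e1 g x - ?a * dir_deriv e2 g x))\<^sup>2)"
      unfolding l_def by (rule energy_estimate[OF g g0 I])
    also have "\<dots> \<le> integral (cube x0 r) (\<lambda>x. 3 * (cmod (?T x))\<^sup>2 + l / 2 * ?E x)"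
    proof (rule integral_le)
      fix x assume x: "x \<in> cube x0 r"
      let ?A = "cmod (dir_deriv e1 g x)" and ?B = "cmod (dir_deriv e2 g x)"
      \<comment> \<open>The operator with coefficients frozen at \<open>x0\<close> differs from the
        true one by coefficients smaller than \<open>e\<close> on the cube.\<close>
      have "?b * dir_deriv e1 g x - ?a * dir_deriv e2 g x =
        ?T x - (dir_deriv e2 \<zeta> x - ?b) * dir_deriv e1 g x + (dir_deriv e1 \<zeta> x - ?a) * dir_deriv e2 g x"
        by (simp add: algebra_simps)
      also have "cmod \<dots> \<le> cmod (?T x) + e * ?A + e * ?B"
      proof (rule order_trans[OF norm_triangle_ineq add_mono])
        show "cmod (?T x - (dir_deriv e2 \<zeta> x - ?b) * dir_deriv e1 g x) \<le> cmod (?T x) + e * ?A"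
          using near[OF r(2) x] by (intro order_trans[OF norm_triangle_ineq4 add_mono]) (auto simp: norm_mult intro!: mult_right_mono)
        show "cmod ((dir_deriv e1 \<zeta> x - ?a) * dir_deriv e2 g x) \<le> e * ?B"
          using near[OF r(2) x] by (auto simp: norm_mult intro!: mult_right_mono)
      qed
      finally have "(cmod (?b * dir_deriv e1 g x - ?a * dir_deriv e2 g x))\<^sup>2 \<le> (cmod (?T x) + e * ?A + e * ?B)\<^sup>2"
        by (intro power_mono) auto
      also have "\<dots> \<le> 3 * ((cmod (?T x))\<^sup>2 + (e * ?A)\<^sup>2 + (e * ?B)\<^sup>2)" by (rule sum_squares_3)
      also have "\<dots> = 3 * (cmod (?T x))\<^sup>2 + l / 2 * ?E x"
        unfolding power_mult_distrib e by (simp add: algebra_simps)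
      finally show "(cmod (?b * dir_deriv e1 g x - ?a * dir_deriv e2 g x))\<^sup>2 \<le> 3 * (cmod (?T x))\<^sup>2 + l / 2 * ?E x" .
    qed (auto simp: cube_def intro!: integrable_continuous continuous_intros cg[unfolded cube_def] c\<zeta>[unfolded cube_def])
    also have "\<dots> = integral (cube x0 r) (\<lambda>x. 3 * (cmod (?T x))\<^sup>2) + integral (cube x0 r) (\<lambda>x. l / 2 * ?E x)"
      using iE iT by (intro integral_add integrable_on_mult_right)
    also have "\<dots> = 3 * integral (cube x0 r) (\<lambda>x. (cmod (?T x))\<^sup>2) + l / 2 * integral (cube x0 r) ?E" by simp
    finally have 1: "l / 2 * integral (cube x0 r) ?E \<le> 3 * integral (cube x0 r) (\<lambda>x. (cmod (?T x))\<^sup>2)" by simp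
    have "integral (cube x0 r) (\<lambda>x. (cmod (g x))\<^sup>2) \<le> 4 * r\<^sup>2 * integral (cube x0 r) (\<lambda>x. (cmod (dir_deriv e1 g x))\<^sup>2)"
      by (rule poincare_inequality[OF g g0]) (simp_all add: Basis_real2)
    also have "\<dots> \<le> 4 * r\<^sup>2 * integral (cube x0 r) ?E"
      using iE by (intro mult_left_mono integral_le) (auto simp: cube_def intro!: integrable_continuous continuous_intros cg[unfolded cube_def])
    also have "\<dots> \<le> 4 * r\<^sup>2 * (6 / l * integral (cube x0 r) (\<lambda>x. (cmod (?T x))\<^sup>2))"
      using 1 l by (intro mult_left_mono) (auto simp: field_simps)
    finally show "integral (cube x0 r) (\<lambda>x. (cmod (g x))\<^sup>2) \<le> 24 / l * r\<^sup>2 * integral (cube x0 r) (\<lambda>x. (cmod (?T x))\<^sup>2)"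
      by simp
  qed (use l d in auto)
qed

section \<open>Unique continuation\<close>

text \<open>The estimate is applied to a cutoff times \<open>w / \<zeta> ^ n\<close>. As the
  operator annihilates \<zeta>, this quotient satisfies the same inequality as \<open>w\<close> with
  the same \<open>C\<close>, so one cube serves all \<open>n\<close>. What the cutoff adds is
  supported where |\<zeta>| is at least a fixed bound; near \<open>x0\<close>, where |\<zeta>| is
  less than half of it, the comparison forces \<open>w\<close> to be 0.\<close>

lemma strong_unique_continuation:
  fixes w \<zeta> :: "real^2 \<Rightarrow> complex"
  assumes opS: "open S" "x0 \<in> S" and w: "smooth_on w S" and sm\<zeta>: "smooth_on \<zeta> S" and \<zeta>0: "\<zeta> x0 = 0"
    and I: "Im (dir_deriv e2 \<zeta> x0 * cnj (dir_deriv e1 \<zeta> x0)) \<noteq> 0"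
    and C: "\<And>x. x \<in> S \<Longrightarrow> cmod (dir_deriv e2 \<zeta> x * dir_deriv e1 w x - dir_deriv e1 \<zeta> x * dir_deriv e2 w x) \<le> C * cmod (w x)"
    and flat: "\<And>m. vanishing_order_ge m w x0"
  shows "\<forall>\<^sub>F x in nhds x0. w x = 0"
proof -
  obtain c where c: "c > 0" "\<forall>\<^sub>F x in nhds x0. c * norm (x - x0) \<le> cmod (\<zeta> x)"
    using derivative_lower_bound[OF sm\<zeta> opS \<zeta>0 I] .
  from c(2) obtain U where U: "open U" "x0 \<in> U" "\<And>x. x \<in> U \<Longrightarrow> c * norm (x - x0) \<le> cmod (\<zeta> x)"
    by (auto simp: eventually_nhds)
  define V where "V = S \<inter> U"
  have V: "open V" "x0 \<in> V" "V \<subseteq> S" "V \<subseteq> U" using opS U by (auto simp: V_def)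
  have wV: "smooth_on w V" and \<zeta>V: "smooth_on \<zeta> V" using w sm\<zeta> V smooth_on_subset by blast+
  interpret flat_quotient V x0 \<zeta> c
    using V U c \<zeta>V \<zeta>0 by unfold_locales auto
  obtain M d where M: "M > 0" and d: "d > 0" 
    and est: "\<And>r g. 0 < r \<Longrightarrow> r \<le> d \<Longrightarrow> smooth_on g UNIV \<Longrightarrow> (\<And>x. x \<notin> cube x0 r \<Longrightarrow> g x = 0) \<Longrightarrow>
      integral (cube x0 r) (\<lambda>x. (cmod (g x))\<^sup>2) \<le> M * r\<^sup>2 *
      integral (cube x0 r) (\<lambda>x. (cmod (dir_deriv e2 \<zeta> x * dir_deriv e1 g x - dir_deriv e1 \<zeta> x * dir_deriv e2 g x))\<^sup>2)"
    by (rule cauchy_riemann_estimate[OF sm\<zeta> opS I]) blast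
  obtain d' where d': "d' > 0" "cube x0 d' \<subseteq> V" using cube_in_open[OF V(1,2)] .
  \<comment> \<open>Small enough that the term \<open>C * cmod (g x)\<close> contributes at most
    half of the left-hand side of the estimate, and chosen before \<open>n\<close>. The summand 1
    avoids division by 0 when \<open>C\<close> is 0.\<close>
  define r where "r = min (min d d') (1 / sqrt (4 * M * (C\<^sup>2 + 1)))"
  have MC: "4 * M * (C\<^sup>2 + 1) > 0" using M by (auto intro!: mult_pos_pos add_nonneg_pos)
  have r: "r > 0" "r \<le> d" "r \<le> d'" and r1: "r \<le> 1 / sqrt (4 * M * (C\<^sup>2 + 1))"
    using d d' MC by (auto simp: r_def)
  have rM: "M * r\<^sup>2 * (2 * C\<^sup>2) \<le> 1 / 2"
  proof -
    have "r\<^sup>2 \<le> (1 / sqrt (4 * M * (C\<^sup>2 + 1)))\<^sup>2" using r r1 by (intro power_mono) auto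
    also have "\<dots> = 1 / (4 * M * (C\<^sup>2 + 1))" using MC by (simp add: power_divide)
    finally have "r\<^sup>2 * (4 * M * (C\<^sup>2 + 1)) \<le> 1" using MC by (simp add: field_simps)
    moreover have "M * r\<^sup>2 \<ge> 0" using M by simp
    ultimately show ?thesis by (simp add: algebra_simps)
  qed
  let ?Q = "cube x0 r"
  have "cube x0 r \<subseteq> cube x0 d'" using r by (fastforce simp: mem_cube intro: order_trans)
  then have Q: "?Q \<subseteq> V" using d' by blast
  let ?T = "\<lambda>g x. dir_deriv e2 \<zeta> x * dir_deriv e1 g x - dir_deriv e1 \<zeta> x * dir_deriv e2 g x"
  define \<phi> where "\<phi> = (\<lambda>x. complex_of_real (cutoff x0 r x))"
  have \<phi>: "smooth_on \<phi> S'" for S'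
    unfolding \<phi>_def by (rule smooth_on_subset[OF smooth_on_of_real[OF open_UNIV smooth_on_cutoff]]) simp
  have \<phi>0: "\<phi> x = 0" if "x \<notin> ?Q" for x using cutoff_eq_0[OF r(1) that] by (simp add: \<phi>_def)
  \<comment> \<open>The commutator of the operator with the cutoff, applied to \<open>w\<close>; it
    is 0 wherever the cutoff is locally constant.\<close>
  define E where "E = (\<lambda>x. w x * ?T \<phi> x)"
  have cE: "continuous_on ?Q E"
    unfolding E_def
    by (intro continuous_intros continuous_on_subset[OF smooth_on_continuous Q] wV \<zeta>V smooth_on_derivative \<phi>)
  have "compact ?Q" by (simp add: cube_def compact_cbox)
  then have "bounded (E ` ?Q)" using cE compact_continuous_image compact_imp_bounded by blast
  then obtain K where K: "\<And>x. x \<in> ?Q \<Longrightarrow> cmod (E x) \<le> K" by (auto simp: bounded_iff)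
  \<comment> \<open>A lower bound for |\<zeta>| at distance at least \<open>r / 2\<close> from
    \<open>x0\<close>; within that distance the cutoff is 1.\<close>
  define \<rho> where "\<rho> = c * (r / 2)"
  have \<rho>: "\<rho> > 0" using c r by (simp add: \<rho>_def)
  have E0: "E x = 0 \<or> \<rho> \<le> cmod (\<zeta> x)" if x: "x \<in> ?Q" for x
  proof (cases "norm (x - x0) < r / 2")
    case True
    have "frechet_derivative \<phi> (at x) = frechet_derivative (\<lambda>x. 1) (at x)"
    proof (rule frechet_derivative_cong[of "ball x0 (r/2)"])
      show "\<phi> y = 1" if "y \<in> ball x0 (r/2)" for y
        using cutoff_eq_1[OF r(1) subsetD[OF ball_subset_cube that]] by (simp add: \<phi>_def)
    qed (use True in \<open>auto simp: dist_norm norm_minus_commute\<close>)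
    then show ?thesis by (simp add: E_def)
  next
    case False
    then have "\<rho> \<le> c * norm (x - x0)" using c by (simp add: \<rho>_def)
    also have "\<dots> \<le> cmod (\<zeta> x)" using lower Q x by blast
    finally show ?thesis by simp
  qed
  have "K \<ge> 0" using K[of x0] r order_trans[OF norm_ge_zero] by (auto simp: mem_cube)
  have "\<forall>\<^sub>F x in nhds x0. cmod (\<zeta> x) < \<rho> / 2"
    using tendstoD[OF smooth_on_tendsto[OF sm\<zeta> opS], of "\<rho> / 2"] \<rho> \<zeta>0 by (simp add: dist_norm)
  then obtain s' where s': "s' > 0" "\<And>s x. s \<le> s' \<Longrightarrow> x \<in> cube x0 s \<Longrightarrow> cmod (\<zeta> x) < \<rho> / 2"
    by (rule eventually_cubeD) blast
  \<comment> \<open>On this cube |\<zeta>| is less than half of \<rho> and the cutoff is 1.\<close>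
  define s where "s = min s' (r / 2)"
  have s: "s > 0" "s \<le> r / 2" "s \<le> s'" using s' r by (auto simp: s_def)
  have \<zeta>s: "\<And>x. x \<in> cube x0 s \<Longrightarrow> cmod (\<zeta> x) < \<rho> / 2" by (rule s'(2)[OF s(3)])
  have sr: "cube x0 s \<subseteq> cube x0 (r/2)" using s by (fastforce simp: mem_cube intro: order_trans)
  also have "cube x0 (r/2) \<subseteq> ?Q" using r by (fastforce simp: mem_cube intro: order_trans)
  finally have sQ: "cube x0 s \<subseteq> ?Q" .
  \<comment> \<open>\<open>M * r\<^sup>2\<close> times \<open>2 * K\<^sup>2\<close> times the
    volume, doubled because half of the left-hand side is absorbed.\<close>
  define B where "B = M * r\<^sup>2 * 4 * K\<^sup>2 * measure lborel ?Q"
  have main: "integral (cube x0 s) (\<lambda>x. (cmod (w x))\<^sup>2) \<le> B * (1 / 4) ^ n" for n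
  proof -
    let ?q = "\<lambda>x. w x / \<zeta> x ^ n"
    define g where "g = (\<lambda>x. if x \<in> V then \<phi> x * ?q x else 0)"
    have sq: "smooth_on ?q V" by (rule smooth_on_quotient[OF wV flat])
    have "smooth_on (\<lambda>x. \<phi> x * ?q x) V" by (intro smooth_on_mult \<phi> sq V)
    from smooth_on_extend_by_0[OF V(1) _ Q this] have g: "smooth_on g UNIV"
      using \<phi>0 by (simp add: g_def cube_def closed_cbox)
    have g0: "g x = 0" if "x \<notin> ?Q" for x using \<phi>0[OF that] by (simp add: g_def)
    have dg: "dir_deriv v g x = \<phi> x * dir_deriv v ?q x + dir_deriv v \<phi> x * ?q x" if "x \<in> V" for v x
    proof -
      have eq: "frechet_derivative g (at x) = frechet_derivative (\<lambda>x. \<phi> x * ?q x) (at x)"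
        by (rule frechet_derivative_cong[OF V(1) _ that]) (simp add: g_def)
      have D: "((\<lambda>x. \<phi> x * ?q x) has_derivative (\<lambda>v. \<phi> x * frechet_derivative ?q (at x) v + frechet_derivative \<phi> (at x) v * ?q x)) (at x)"
        by (intro has_derivative_mult smooth_on_has_derivative[OF sq that] smooth_on_has_derivative[OF \<phi>[of V] that])
      show ?thesis unfolding eq frechet_derivative_at[OF D, symmetric] by (rule refl)
    qed
    have Tq: "cmod (?T ?q x) \<le> C * cmod (?q x)" if x: "x \<in> V" for x
    proof -
      have dq: "dir_deriv v ?q x = (dir_deriv v w x * \<zeta> x - of_nat n * w x * dir_deriv v \<zeta> x) / \<zeta> x ^ Suc n" for v
        unfolding frechet_derivative_at[OF quotient_has_derivative[OF wV flat x, of n], symmetric] by (rule refl)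
      show ?thesis
      proof (cases "x = x0")
        case True
        then have "w x = 0" "\<zeta> x = 0" using \<zeta>0 flat[of 1] vanishing_order_ge_eq_0[of 0] by auto
        then show ?thesis unfolding dq by simp
      next
        case False
        then have z: "\<zeta> x \<noteq> 0" using nonzero x by blast
        \<comment> \<open>The terms with derivatives of \<zeta> cancel: the operator is a derivation
          and maps \<zeta> to 0.\<close>
        have "?T ?q x = ?T w x / \<zeta> x ^ n"
          unfolding dq using z by (simp add: field_simps)
        moreover have "cmod (?T w x) \<le> C * cmod (w x)" using C x V by blast
        ultimately show ?thesis using z by (simp add: norm_divide divide_right_mono)
      qed
    qed
    have Tg: "(cmod (?T g x))\<^sup>2 \<le> 2 * C\<^sup>2 * (cmod (g x))\<^sup>2 + 2 * K\<^sup>2 * (1 / \<rho>\<^sup>2) ^ n" if x: "x \<in> ?Q" for x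
    proof -
      have xV: "x \<in> V" using x Q by blast
      have "?T g x = \<phi> x * ?T ?q x + E x / \<zeta> x ^ n"
        unfolding dg[OF xV] E_def by (simp add: algebra_simps diff_divide_distrib)
      then have "cmod (?T g x) \<le> cmod (\<phi> x) * cmod (?T ?q x) + cmod (E x / \<zeta> x ^ n)"
        using norm_triangle_ineq[of "\<phi> x * ?T ?q x" "E x / \<zeta> x ^ n"] by (simp add: norm_mult)
      also have "\<dots> \<le> C * cmod (g x) + K * (1 / \<rho>) ^ n"
      proof (rule add_mono)
        have "cmod (\<phi> x) * cmod (?T ?q x) \<le> cmod (\<phi> x) * (C * cmod (?q x))"
          by (rule mult_left_mono[OF Tq[OF xV] norm_ge_zero])
        then show "cmod (\<phi> x) * cmod (?T ?q x) \<le> C * cmod (g x)"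
          using xV by (simp add: g_def norm_mult norm_divide algebra_simps)
        show "cmod (E x / \<zeta> x ^ n) \<le> K * (1 / \<rho>) ^ n"
        proof (cases "E x = 0")
          case True
          then show ?thesis using \<open>K \<ge> 0\<close> \<rho> by simp
        next
          case False
          then have "\<rho> \<le> cmod (\<zeta> x)" using E0[OF x] by simp
          then show ?thesis using K[OF x] \<rho> \<open>K \<ge> 0\<close> unfolding norm_divide norm_power power_one_over
            by (simp add: frac_le power_mono)
        qed
      qed
      finally have "(cmod (?T g x))\<^sup>2 \<le> (C * cmod (g x) + K * (1 / \<rho>) ^ n)\<^sup>2" by (intro power_mono) auto
      also have "\<dots> \<le> 2 * (C * cmod (g x))\<^sup>2 + 2 * (K * (1 / \<rho>) ^ n)\<^sup>2"
        using sum_squares_bound[of "C * cmod (g x)" "K * (1 / \<rho>) ^ n"] by (simp add: power2_sum)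
      finally show ?thesis
        by (simp add: power_mult_distrib power_divide power_mult[symmetric] mult.commute[of 2 n] mult.assoc)
    qed
    have cg: "continuous_on A g" "continuous_on A (dir_deriv v g)" for A v
      by (auto intro!: continuous_on_subset[OF smooth_on_continuous] smooth_on_derivative g)
    have c\<zeta>: "continuous_on ?Q (dir_deriv v \<zeta>)" for v
      by (rule continuous_on_subset[OF smooth_on_continuous[OF smooth_on_derivative[OF \<zeta>V]] Q])
    have ig: "(\<lambda>x. (cmod (g x))\<^sup>2) integrable_on cube x0 R" for R
      unfolding cube_def by (intro integrable_continuous continuous_intros cg)
    have "integral ?Q (\<lambda>x. (cmod (g x))\<^sup>2) \<le> M * r\<^sup>2 * integral ?Q (\<lambda>x. (cmod (?T g x))\<^sup>2)"
      by (rule est[OF r(1,2) g g0])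
    also have "\<dots> \<le> M * r\<^sup>2 * integral ?Q (\<lambda>x. 2 * C\<^sup>2 * (cmod (g x))\<^sup>2 + 2 * K\<^sup>2 * (1 / \<rho>\<^sup>2) ^ n)"
      using M Tg
      by (intro mult_left_mono integral_le)
         (auto simp: cube_def intro!: integrable_continuous continuous_intros cg c\<zeta>[unfolded cube_def])
    also have "integral ?Q (\<lambda>x. 2 * C\<^sup>2 * (cmod (g x))\<^sup>2 + 2 * K\<^sup>2 * (1 / \<rho>\<^sup>2) ^ n)
      = integral ?Q (\<lambda>x. 2 * C\<^sup>2 * (cmod (g x))\<^sup>2) + integral ?Q (\<lambda>x. 2 * K\<^sup>2 * (1 / \<rho>\<^sup>2) ^ n)"
      using ig by (intro integral_add integrable_on_mult_right) (auto simp: cube_def)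
    also have "\<dots> = 2 * C\<^sup>2 * integral ?Q (\<lambda>x. (cmod (g x))\<^sup>2) + 2 * K\<^sup>2 * (1 / \<rho>\<^sup>2) ^ n * measure lborel ?Q"
      by (simp add: cube_def)
    finally have "integral ?Q (\<lambda>x. (cmod (g x))\<^sup>2) \<le> (M * r\<^sup>2 * (2 * C\<^sup>2)) * integral ?Q (\<lambda>x. (cmod (g x))\<^sup>2) + B / 2 * (1 / \<rho>\<^sup>2) ^ n"
      by (simp add: B_def algebra_simps)
    also have "\<dots> \<le> 1 / 2 * integral ?Q (\<lambda>x. (cmod (g x))\<^sup>2) + B / 2 * (1 / \<rho>\<^sup>2) ^ n"
      using rM by (intro add_mono mult_right_mono integral_nonneg ig) auto
    finally have 1: "integral ?Q (\<lambda>x. (cmod (g x))\<^sup>2) \<le> B * (1 / \<rho>\<^sup>2) ^ n" by simp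
    have "integral (cube x0 s) (\<lambda>x. (cmod (w x))\<^sup>2) \<le> integral (cube x0 s) (\<lambda>x. ((\<rho> / 2)\<^sup>2) ^ n * (cmod (g x))\<^sup>2)"
    proof (rule integral_le)
      fix x assume x: "x \<in> cube x0 s"
      then have xV: "x \<in> V" using sQ Q by blast
      have gx: "g x = w x / \<zeta> x ^ n" using xV x sr cutoff_eq_1[OF r(1)] by (auto simp: g_def \<phi>_def)
      show "(cmod (w x))\<^sup>2 \<le> ((\<rho> / 2)\<^sup>2) ^ n * (cmod (g x))\<^sup>2"
      proof (cases "x = x0")
        case True
        then have "w x = 0" using flat[of "Suc 0"] vanishing_order_ge_eq_0 by blast
        then show ?thesis by simp
      next
        case False
        then have "\<zeta> x \<noteq> 0" using nonzero xV by blast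
        then have "w x = \<zeta> x ^ n * g x" by (simp add: gx)
        then have "(cmod (w x))\<^sup>2 = ((cmod (\<zeta> x))\<^sup>2) ^ n * (cmod (g x))\<^sup>2"
          by (simp add: norm_mult norm_power power_mult_distrib power_mult[symmetric] mult.commute)
        also have "\<dots> \<le> ((\<rho> / 2)\<^sup>2) ^ n * (cmod (g x))\<^sup>2"
          using \<zeta>s[OF x] by (intro mult_right_mono power_mono) auto
        finally show ?thesis .
      qed
    next
      show "(\<lambda>x. (cmod (w x))\<^sup>2) integrable_on cube x0 s"
        using continuous_on_subset[OF smooth_on_continuous[OF wV], of "cube x0 s"] sQ Q
        unfolding cube_def by (intro integrable_continuous continuous_intros) blast
    qed (intro integrable_on_mult_right ig)
    also have "\<dots> = ((\<rho> / 2)\<^sup>2) ^ n * integral (cube x0 s) (\<lambda>x. (cmod (g x))\<^sup>2)" by simp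
    also have "\<dots> \<le> ((\<rho> / 2)\<^sup>2) ^ n * integral ?Q (\<lambda>x. (cmod (g x))\<^sup>2)"
      using sQ by (intro mult_left_mono integral_subset_le ig) auto
    also have "\<dots> \<le> ((\<rho> / 2)\<^sup>2) ^ n * (B * (1 / \<rho>\<^sup>2) ^ n)" using 1 by (intro mult_left_mono) auto
    also have "\<dots> = B * (((\<rho> / 2)\<^sup>2) * (1 / \<rho>\<^sup>2)) ^ n" by (simp only: power_mult_distrib mult_ac)
    also have "((\<rho> / 2)\<^sup>2) * (1 / \<rho>\<^sup>2) = 1 / 4" using \<rho> by (simp add: power_divide)
    finally show ?thesis .
  qed
  let ?I = "integral (cube x0 s) (\<lambda>x. (cmod (w x))\<^sup>2)"
  have cw: "continuous_on (cube x0 s) (\<lambda>x. (cmod (w x))\<^sup>2)"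
    using continuous_on_subset[OF smooth_on_continuous[OF wV], of "cube x0 s"] sQ Q by (intro continuous_intros) blast
  have int: "(\<lambda>x. (cmod (w x))\<^sup>2) integrable_on cube x0 s"
    using cw unfolding cube_def by (rule integrable_continuous)
  have "(\<lambda>n. B * (1 / 4) ^ n) \<longlonglongrightarrow> B * 0" by (intro tendsto_intros LIMSEQ_power_zero) auto
  then have "?I \<le> 0" using main by (intro LIMSEQ_le_const[of _ 0 ?I]) auto
  moreover have "?I \<ge> 0" using int by (rule integral_nonneg) simp
  ultimately have "?I = 0" by simp
  then have hi: "((\<lambda>x. (cmod (w x))\<^sup>2) has_integral 0) (cube x0 s)"
    using integrable_integral[OF int] by simp
  \<comment> \<open>A nonnegative continuous function with integral 0 vanishes on the whole
    cube.\<close>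
  have "w x = 0" if x: "x \<in> cube x0 s" for x
  proof -
    have "(cmod (w x))\<^sup>2 = 0"
      by (rule has_integral_0_cbox_imp_0[of "x0 - s *\<^sub>R One" "x0 + s *\<^sub>R One" "\<lambda>x. (cmod (w x))\<^sup>2"])
        (use cw hi x s in \<open>auto simp: cube_def box_ne_empty inner_simps\<close>)
    then show ?thesis by simp
  qed
  then show ?thesis
    using ball_subset_cube[of x0 s] s by (auto simp: eventually_nhds intro!: exI[of _ "ball x0 s"])
qed

section \<open>Taylor coefficients and the leading term\<close>

lemma iter_deriv_linear_combination:
  fixes f g :: "'a::euclidean_space \<Rightarrow> complex"
  assumes "open S" "x \<in> S" "smooth_on f S" "smooth_on g S"
  shows "iter_deriv vs (\<lambda>x. a * f x - b * g x) x = a * iter_deriv vs f x - b * iter_deriv vs g x"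
  using assms(3,4)
proof (induction vs arbitrary: f g)
  case (Cons v vs)
  have "dir_deriv v (\<lambda>x. a * f x - b * g x) y = a * dir_deriv v f y - b * dir_deriv v g y" if "y \<in> S" for y
  proof -
    have "((\<lambda>x. a * f x - b * g x) has_derivative (\<lambda>v. a * frechet_derivative f (at y) v - b * frechet_derivative g (at y) v)) (at y)"
      by (intro has_derivative_diff has_derivative_mult_right smooth_on_has_derivative[OF Cons.prems(1) that] smooth_on_has_derivative[OF Cons.prems(2) that])
    from frechet_derivative_at[OF this, symmetric] show ?thesis by simp
  qed
  from iter_deriv_cong[OF assms(1) this assms(2)] show ?case
    using Cons.IH[OF smooth_on_derivative[OF Cons.prems(1)] smooth_on_derivative[OF Cons.prems(2)]] by simp
qed simp

lemma iter_deriv_linear_power: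
  fixes L :: "'a::euclidean_space \<Rightarrow> complex"
  assumes L: "bounded_linear L" and "length vs \<le> m"
  shows "iter_deriv vs (\<lambda>x. c * L (x - x0) ^ m) x0 = (if length vs = m then c * fact m * prod_list (map L vs) else 0)"
  using assms(2)
proof (induction vs arbitrary: c m)
  case Nil
  then show ?case using linear_0[OF bounded_linear.linear[OF L]] by (cases m) auto
next
  case (Cons v vs)
  obtain k where m: "m = Suc k" using Cons.prems by (cases m) auto
  have "dir_deriv v (\<lambda>x. c * L (x - x0) ^ m) = (\<lambda>x. (c * of_nat m * L v) * L (x - x0) ^ k)"
  proof
    fix x
    have "((\<lambda>x. L (x - x0)) has_derivative (\<lambda>v. L (v - 0))) (at x)"
      by (intro bounded_linear.has_derivative[OF L] has_derivative_diff has_derivative_const has_derivative_ident)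
    then have "((\<lambda>x. c * L (x - x0) ^ m) has_derivative (\<lambda>v. c * (of_nat m * L (v - 0) * L (x - x0) ^ (m - 1)))) (at x)"
      by (intro has_derivative_mult_right has_derivative_power)
    from frechet_derivative_at[OF this, symmetric] show "dir_deriv v (\<lambda>x. c * L (x - x0) ^ m) x = (c * of_nat m * L v) * L (x - x0) ^ k"
      by (simp add: m)
  qed
  then show ?case using Cons.IH[of k "c * of_nat m * L v"] Cons.prems by (simp add: m algebra_simps)
qed

text \<open>Differentiating the relation \<open>T\<close> shows that replacing a derivative along
  \<open>e2\<close> by one along \<open>e1\<close> multiplies a derivative of order \<open>m\<close>
  by \<open>L e1 / L e2\<close>. So all derivatives of order \<open>m\<close> are proportional to
  the products of the values of \<open>L\<close>, which are those of \<open>L (x - x0) ^ m\<close>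
  up to a factor.\<close>

lemma leading_term:
  fixes w :: "real^2 \<Rightarrow> complex"
  assumes S: "open S" "x0 \<in> S" and w: "smooth_on w S" and L: "bounded_linear L" and ne: "L e1 \<noteq> 0" "L e2 \<noteq> 0"
    and vo: "vanishing_order_ge m w x0"
    and T: "vanishing_order_ge m (\<lambda>x. L e2 * dir_deriv e1 w x - L e1 * dir_deriv e2 w x) x0"
  obtains c where "vanishing_order_ge (Suc m) (\<lambda>x. w x - c * L (x - x0) ^ m) x0"
proof -
  define M where "M = (\<lambda>vs. iter_deriv vs w x0)"
  define \<kappa> where "\<kappa> = M (replicate m e1) / L e1 ^ m"
  have rel: "L e2 * M (e1 # us) = L e1 * M (e2 # us)" if "length us < m" for us
  proof -
    have "iter_deriv us (\<lambda>x. L e2 * dir_deriv e1 w x - L e1 * dir_deriv e2 w x) x0 = 0"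
      by (rule iter_deriv_eq_0[OF _ S T that])
        (intro smooth_on_diff smooth_on_mult smooth_on_const smooth_on_derivative w S)
    then show ?thesis
      unfolding M_def iter_deriv_linear_combination[OF S smooth_on_derivative[OF w] smooth_on_derivative[OF w]] by simp
  qed
  have M_mset: "M us = M vs" if "mset us = mset vs" for us vs
    unfolding M_def by (rule iter_deriv_mset[OF w S that])
  have M: "M vs = \<kappa> * prod_list (map L vs)" if "set vs \<subseteq> {e1, e2}" "length vs = m" for vs
    using that
  \<comment> \<open>Each step brings one \<open>e2\<close> to the front, by symmetry of the
    derivatives, and trades it for \<open>e1\<close> with \<open>rel\<close>. The base case is the
    derivative along \<open>e1\<close> only, which fixes \<kappa>.\<close>
  proof (induction "count_list vs e2" arbitrary: vs)
    case 0
    then have "set vs \<subseteq> {e1}" by (auto simp: count_list_0_iff)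
    then have "vs = replicate m e1" using 0 by (metis replicate_eqI singletonD subsetD)
    then show ?case using ne by (simp add: \<kappa>_def prod_list_replicate)
  next
    case (Suc n)
    then have "e2 \<in> set vs" by (metis count_list_0_iff nat.distinct(1))
    then obtain as bs where vs: "vs = as @ e2 # bs" by (metis split_list)
    have "M vs = M (e2 # as @ bs)" by (rule M_mset) (simp add: vs)
    then have "L e1 * M vs = L e2 * M (e1 # as @ bs)" using rel[of "as @ bs"] Suc.prems vs by simp
    moreover have "M (e1 # as @ bs) = \<kappa> * prod_list (map L (e1 # as @ bs))"
      using Suc.hyps(2) Suc.prems vs e1_ne_e2 by (intro Suc.hyps(1)) auto
    ultimately show ?case using ne vs by simp
  qed
  let ?P = "\<lambda>x. (\<kappa> / fact m) * L (x - x0) ^ m"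
  have P: "smooth_on ?P S"
    by (intro smooth_on_mult smooth_on_power smooth_on_const smooth_on_compose_linear[OF _ L] smooth_on_diff smooth_on_id S)
  have "vanishing_order_ge (Suc m) (\<lambda>x. 1 * w x - 1 * ?P x) x0"
  proof (rule vanishing_order_geI[OF _ S])
    show "smooth_on (\<lambda>x. 1 * w x - 1 * ?P x) S" by (intro smooth_on_mult smooth_on_diff smooth_on_const w P S)
    fix vs :: "(real^2) list" assume vs: "set vs \<subseteq> Basis" "length vs < Suc m"
    have "iter_deriv vs w x0 = iter_deriv vs ?P x0"
    proof (cases "length vs = m")
      case True
      then show ?thesis
        using M[of vs] vs iter_deriv_linear_power[OF L, of vs m "\<kappa> / fact m" x0] by (simp add: M_def Basis_real2)
    next
      case False
      then show ?thesis
        using iter_deriv_eq_0[OF w S vo, of vs] vs iter_deriv_linear_power[OF L, of vs m "\<kappa> / fact m" x0] by simp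
    qed
    then show "iter_deriv vs (\<lambda>x. 1 * w x - 1 * ?P x) x0 = 0"
      unfolding iter_deriv_linear_combination[OF S w P] by simp
  qed
  then show ?thesis using that[of "\<kappa> / fact m"] by simp
qed

theorem zeros_isolated_or_locally_zero:
  fixes w \<zeta> :: "real^2 \<Rightarrow> complex"
  assumes S: "open S" "x0 \<in> S" and w: "smooth_on w S" and \<zeta>: "smooth_on \<zeta> S"
    and I: "Im (dir_deriv e2 \<zeta> x0 * cnj (dir_deriv e1 \<zeta> x0)) \<noteq> 0"
    and C: "\<And>x. x \<in> S \<Longrightarrow> cmod (dir_deriv e2 \<zeta> x * dir_deriv e1 w x - dir_deriv e1 \<zeta> x * dir_deriv e2 w x) \<le> C * cmod (w x)"
  shows "(\<forall>\<^sub>F x in nhds x0. w x = 0) \<or> (\<forall>\<^sub>F x in at x0. w x \<noteq> 0)"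
proof (cases "\<forall>m. vanishing_order_ge m w x0")
  case True
  \<comment> \<open>Normalised to vanish at \<open>x0\<close>; only derivatives of \<zeta> enter the
    inequality.\<close>
  let ?\<zeta> = "\<lambda>x. \<zeta> x - \<zeta> x0"
  have d: "dir_deriv v ?\<zeta> x = dir_deriv v \<zeta> x" if "x \<in> S" for v x
  proof -
    have "(?\<zeta> has_derivative (\<lambda>v. frechet_derivative \<zeta> (at x) v - 0)) (at x)"
      by (intro has_derivative_diff has_derivative_const smooth_on_has_derivative[OF \<zeta> that])
    from frechet_derivative_at[OF this, symmetric] show ?thesis by simp
  qed
  have "\<forall>\<^sub>F x in nhds x0. w x = 0"
    by (rule strong_unique_continuation[of S x0 w ?\<zeta> C])
      (use S w \<zeta> I C True d in \<open>auto intro: smooth_on_diff smooth_on_const\<close>)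
  then show ?thesis ..
next
  case False
  \<comment> \<open>The exact order of vanishing: at least \<open>m\<close>, but not at least
    \<open>Suc m\<close>.\<close>
  define m where "m = (LEAST m. \<not> vanishing_order_ge (Suc m) w x0)"
  obtain k where k: "\<not> vanishing_order_ge k w x0" using False by blast
  then have "k \<noteq> 0" using vanishing_order_ge_0[OF w S] by metis
  then obtain k' where "\<not> vanishing_order_ge (Suc k') w x0" using k by (metis not0_implies_Suc)
  then have m: "\<not> vanishing_order_ge (Suc m) w x0" unfolding m_def by (rule LeastI)
  have vo: "vanishing_order_ge m w x0"
  proof (cases m)
    case 0
    then show ?thesis using vanishing_order_ge_0[OF w S] by simp
  next
    case (Suc j)
    then show ?thesis using not_less_Least[of j "\<lambda>m. \<not> vanishing_order_ge (Suc m) w x0"] by (auto simp: m_def)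
  qed
  let ?L = "frechet_derivative \<zeta> (at x0)"
  let ?a = "dir_deriv e1 \<zeta> x0" and ?b = "dir_deriv e2 \<zeta> x0"
  have L: "bounded_linear ?L" using smooth_on_has_derivative[OF \<zeta> S(2)] by (rule has_derivative_bounded_linear)
  have ne: "?a \<noteq> 0" "?b \<noteq> 0" using I by auto
  have T: "vanishing_order_ge m (\<lambda>x. ?b * dir_deriv e1 w x - ?a * dir_deriv e2 w x) x0"
  proof (cases m)
    case 0
    then show ?thesis
      by (auto intro!: vanishing_order_ge_0[OF _ S] smooth_on_diff smooth_on_mult smooth_on_const smooth_on_derivative w S)
  next
    case (Suc j)
    have d: "vanishing_order_ge j (dir_deriv v w) x0" for v
      using vo Suc by (intro vanishing_order_ge_deriv[OF w S]) simp
    have z: "vanishing_order_ge 1 (\<lambda>x. dir_deriv v \<zeta> x - dir_deriv v \<zeta> x0) x0" for v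
      by (rule vanishing_order_ge_1[OF smooth_on_diff[OF S(1) smooth_on_derivative[OF \<zeta>] smooth_on_const] S]) simp
    \<comment> \<open>Freezing the coefficients at \<open>x0\<close> costs a factor that vanishes at
      \<open>x0\<close> times a derivative of \<open>w\<close>, which vanishes to order
      \<open>m - 1\<close>. The total is again order \<open>m\<close>.\<close>
    have p: "vanishing_order_ge m (\<lambda>x. (dir_deriv u \<zeta> x - dir_deriv u \<zeta> x0) * dir_deriv v w x) x0" for u v
      using vanishing_order_ge_mult[OF z d] Suc by simp
    obtain K where "\<forall>\<^sub>F x in nhds x0. norm (w x) \<le> K * norm (x - x0) ^ m"
      using vo by (auto simp: vanishing_order_ge_def)
    moreover have "\<forall>\<^sub>F x in nhds x0. x \<in> S" using S by (rule eventually_nhds_in_open)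
    ultimately have "\<forall>\<^sub>F x in nhds x0. cmod (dir_deriv e2 \<zeta> x * dir_deriv e1 w x - dir_deriv e1 \<zeta> x * dir_deriv e2 w x) \<le> (\<bar>C\<bar> * K) * norm (x - x0) ^ m"
    proof eventually_elim
      case (elim x)
      have "C * cmod (w x) \<le> \<bar>C\<bar> * (K * norm (x - x0) ^ m)" using elim by (intro mult_mono) auto
      then show ?case using C[OF elim(2)] by simp
    qed
    then have t: "vanishing_order_ge m (\<lambda>x. dir_deriv e2 \<zeta> x * dir_deriv e1 w x - dir_deriv e1 \<zeta> x * dir_deriv e2 w x) x0"
      unfolding vanishing_order_ge_def by blast
    show ?thesis
      using vanishing_order_ge_add[OF vanishing_order_ge_diff[OF t p[of e2 e1]] p[of e1 e2]] by (simp add: algebra_simps)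
  qed
  obtain c where c: "vanishing_order_ge (Suc m) (\<lambda>x. w x - c * ?L (x - x0) ^ m) x0"
    using leading_term[OF S w L ne vo T] .
  have "c \<noteq> 0" using c m by auto
  obtain B where B: "B > 0" "\<And>v. B * norm v \<le> cmod (?L v)"
    by (rule derivative_bounded_below[OF \<zeta> S I]) blast
  obtain K where K: "\<forall>\<^sub>F x in nhds x0. cmod (w x - c * ?L (x - x0) ^ m) \<le> K * norm (x - x0) ^ Suc m"
    using c by (auto simp: vanishing_order_ge_def)
  have "((\<lambda>x. K * norm (x - x0)) \<longlongrightarrow> 0) (nhds x0)" by (auto intro!: tendsto_eq_intros filterlim_ident)
  \<comment> \<open>The leading term is at least \<open>cmod c * B ^ m * norm (x - x0) ^ m\<close>;
    close to \<open>x0\<close> it outweighs the remainder of order \<open>Suc m\<close>.\<close>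
  then have "\<forall>\<^sub>F x in nhds x0. K * norm (x - x0) < cmod c * B ^ m"
    using B \<open>c \<noteq> 0\<close> by (intro order_tendstoD) auto
  with K have "\<forall>\<^sub>F x in nhds x0. x \<noteq> x0 \<longrightarrow> w x \<noteq> 0"
  proof eventually_elim
    case (elim x)
    show ?case
    proof (intro impI notI)
      assume x: "x \<noteq> x0" "w x = 0"
      then have p: "norm (x - x0) ^ m > 0" by simp
      have "cmod c * (B * norm (x - x0)) ^ m \<le> cmod c * cmod (?L (x - x0)) ^ m"
        using B by (intro mult_left_mono power_mono) auto
      also have "\<dots> \<le> (K * norm (x - x0)) * norm (x - x0) ^ m" using elim(1) x by (simp add: norm_mult norm_power mult.assoc)
      also have "\<dots> < (cmod c * B ^ m) * norm (x - x0) ^ m" using elim(2) p by (rule mult_strict_right_mono)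
      finally show False by (simp add: power_mult_distrib)
    qed
  qed
  then show ?thesis by (simp add: eventually_at_filter)
qed

section \<open>The Kaehler form in a holomorphic chart\<close>

abbreviation z1 :: "complex^2" where "z1 \<equiv> axis 1 1"
abbreviation z2 :: "complex^2" where "z2 \<equiv> axis 2 1"

text \<open>The holomorphic 2-form dz1 wedge dz2. It vanishes exactly on pairs that are linearly
  dependent over the complex numbers.\<close>

definition cdet :: "complex^2 \<Rightarrow> complex^2 \<Rightarrow> complex" where
  "cdet u v = u $ 1 * v $ 2 - u $ 2 * v $ 1"

lemma J_nth [simp]: "J v $ k = \<i> * v $ k"
  by (simp add: J_def)

lemma J_add: "J (u + v) = J u + J v" and J_scaleR: "J (r *\<^sub>R v) = r *\<^sub>R J v"
  and J_J: "J (J v) = - v"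
  by (simp_all add: vec_eq_iff algebra_simps)

lemma bounded_linear_J: "bounded_linear J"
  by (simp add: linear_conv_bounded_linear[symmetric] linear_iff J_add J_scaleR)

lemma complex2_expansion:
  "v = Re (v $ 1) *\<^sub>R z1 + Im (v $ 1) *\<^sub>R J z1 + Re (v $ 2) *\<^sub>R z2 + Im (v $ 2) *\<^sub>R J z2"
  by (simp add: vec_eq_iff forall_2 complex_eq_iff axis_def)

locale hermitian_form =
  fixes h :: "complex^2 \<Rightarrow> complex^2 \<Rightarrow> real"
  assumes bilin: "bilinear h" and alt: "h u u = 0" and J_inv: "h (J u) (J v) = h u v"
    and pos: "u \<noteq> 0 \<Longrightarrow> h u (J u) > 0"
begin

lemmas h_simps = bilinear_ladd[OF bilin] bilinear_radd[OF bilin] bilinear_lmul[OF bilin] bilinear_rmul[OF bilin]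
  bilinear_lneg[OF bilin] bilinear_rneg[OF bilin]

lemma swap: "h u v = - h v u"
  using alt[of "u + v"] unfolding h_simps unfolding alt by linarith

lemma J_left: "h (J u) v = - h u (J v)"
  using J_inv[of u "J v"] unfolding J_J h_simps by linarith

text \<open>Antisymmetry and \<open>J\<close>-invariance leave four real coefficients free, those of
  a Hermitian matrix.\<close>

lemma components:
  "h u v = h z1 (J z1) * (Re (u $ 1) * Im (v $ 1) - Im (u $ 1) * Re (v $ 1))
    + h z2 (J z2) * (Re (u $ 2) * Im (v $ 2) - Im (u $ 2) * Re (v $ 2))
    + h z1 z2 * (Re (u $ 1) * Re (v $ 2) - Re (u $ 2) * Re (v $ 1) + Im (u $ 1) * Im (v $ 2) - Im (u $ 2) * Im (v $ 1))
    + h z1 (J z2) * (Re (u $ 1) * Im (v $ 2) - Im (u $ 2) * Re (v $ 1) - Im (u $ 1) * Re (v $ 2) + Re (u $ 2) * Im (v $ 1))"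
proof -
  have s: "h z2 z1 = - h z1 z2" "h z2 (J z1) = h z1 (J z2)"
    using swap[of z2 z1] swap[of z2 "J z1"] J_left[of z1 z2] by auto
  have "h u v = h (Re (u $ 1) *\<^sub>R z1 + Im (u $ 1) *\<^sub>R J z1 + Re (u $ 2) *\<^sub>R z2 + Im (u $ 2) *\<^sub>R J z2)
    (Re (v $ 1) *\<^sub>R z1 + Im (v $ 1) *\<^sub>R J z1 + Re (v $ 2) *\<^sub>R z2 + Im (v $ 2) *\<^sub>R J z2)"
    using complex2_expansion[of u] complex2_expansion[of v] by simp
  then show ?thesis
    unfolding h_simps J_left J_J alt s by (simp add: algebra_simps)
qed

text \<open>The determinant of the Hermitian matrix of the metric: the last two squares add up to
  the squared modulus of its off-diagonal entry.\<close>

definition gram :: real where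
  "gram = h z1 (J z1) * h z2 (J z2) - (h z1 z2)\<^sup>2 - (h z1 (J z2))\<^sup>2"

text \<open>Wirtinger's inequality with an explicit defect. The proof is a polynomial identity in
  the real and imaginary parts of all coordinates.\<close>

lemma gram_identity:
  "h u (J u) * h v (J v) - h u (J v) * h v (J u) = (h u v)\<^sup>2 + gram * (cmod (cdet u v))\<^sup>2"
proof -
  define p q s t where "p = h z1 (J z1)" and "q = h z2 (J z2)" and "s = h z1 z2" and "t = h z1 (J z2)"
  obtain a b c d where u: "Re (u $ 1) = a" "Im (u $ 1) = b" "Re (u $ 2) = c" "Im (u $ 2) = d" by auto
  obtain a' b' c' d' where v: "Re (v $ 1) = a'" "Im (v $ 1) = b'" "Re (v $ 2) = c'" "Im (v $ 2) = d'" by auto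
  show ?thesis
    unfolding components[of u "J u"] components[of v "J v"] components[of u "J v"] components[of v "J u"] components[of u v]
      gram_def cdet_def cmod_power2 p_def[symmetric] q_def[symmetric] s_def[symmetric] t_def[symmetric]
    by (simp add: u v) (simp add: power2_eq_square algebra_simps)
qed

lemma gram_pos: "gram > 0"
proof -
  define p q s t where "p = h z1 (J z1)" and "q = h z2 (J z2)" and "s = h z1 z2" and "t = h z1 (J z2)"
  have "z1 \<noteq> 0" by (simp add: axis_eq_0_iff)
  then have p: "p > 0" unfolding p_def by (rule pos)
  \<comment> \<open>A multiple of \<open>z2\<close> made Hermitian-orthogonal to \<open>z1\<close>;
    its squared length is \<open>p * gram\<close>.\<close>
  define v where "v = (- t) *\<^sub>R z1 + (- s) *\<^sub>R J z1 + p *\<^sub>R z2"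
  have v: "v $ 1 = Complex (- t) (- s)" "v $ 2 = Complex p 0"
    by (simp_all add: v_def complex_eq_iff axis_def)
  then have "v \<noteq> 0" using p by (auto simp: complex_eq_iff)
  then have "h v (J v) > 0" by (rule pos)
  also have "h v (J v) = p * gram"
    unfolding components[of v "J v"] gram_def p_def[symmetric] q_def[symmetric] s_def[symmetric] t_def[symmetric]
    by (simp add: v power2_eq_square algebra_simps)
  finally show ?thesis using p by (simp add: zero_less_mult_iff)
qed

text \<open>If \<open>u\<close> and \<open>v\<close> span one complex line and every component ratio
  is real, then \<open>v\<close> is a real multiple of \<open>u\<close> and
  \<open>h u v = 0\<close>. At a complex point this provides the component of the immersion that has
  nonzero Jacobian.\<close>

lemma transversal_component:
  assumes "h u v \<noteq> 0" "cdet u v = 0"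
  shows "\<exists>k. Im (v $ k * cnj (u $ k)) \<noteq> 0"
proof (rule ccontr)
  assume "\<not> ?thesis"
  then have im: "Im (v $ k * cnj (u $ k)) = 0" for k by blast
  have "u \<noteq> 0" using assms(1) bilinear_lzero[OF bilin] by auto
  then obtain k where k: "u $ k \<noteq> 0" by (auto simp: vec_eq_iff)
  define r where "r = Re (v $ k * cnj (u $ k)) / (cmod (u $ k))\<^sup>2"
  have "v $ k * cnj (u $ k) = of_real (r * (cmod (u $ k))\<^sup>2)"
    using im[of k] k by (simp add: r_def complex_eq_iff)
  also have "\<dots> = of_real r * u $ k * cnj (u $ k)" by (simp only: of_real_mult complex_norm_square mult.assoc)
  finally have vk: "v $ k = of_real r * u $ k" using k by simp
  have "u $ 1 * v $ 2 = u $ 2 * v $ 1" using assms(2) by (simp add: cdet_def)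
  then have "v $ j = of_real r * u $ j" for j
    using vk k exhaust_2[of k] exhaust_2[of j] by (auto simp: mult_ac)
  then have "v = r *\<^sub>R u" unfolding vec_eq_iff vector_scaleR_component by (simp add: scaleR_conv_of_real)
  then have "h u v = 0" by (simp add: h_simps alt)
  then show False using assms(1) by simp
qed

end

locale kaehler_chart =
  fixes Y :: "(complex^2) set" and \<omega> :: "complex^2 \<Rightarrow> complex^2 \<Rightarrow> complex^2 \<Rightarrow> real"
  assumes open_Y: "open Y"
    and hermitian: "y \<in> Y \<Longrightarrow> hermitian_form (\<omega> y)"
    and smooth: "smooth_on (\<lambda>y. \<omega> y u v) Y"
    and closed: "y \<in> Y \<Longrightarrow> dir_deriv u (\<lambda>y. \<omega> y v w) y + dir_deriv v (\<lambda>y. \<omega> y w u) y + dir_deriv w (\<lambda>y. \<omega> y u v) y = 0"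
begin

text \<open>The locale speaks of \<omega> with constant arguments. Where the arguments vary along
  with the point, everything is reduced to these finitely many coefficient functions.\<close>

lemma expansion:
  assumes "y \<in> Y"
  shows "\<omega> y u v = (\<Sum>b\<in>Basis. \<Sum>b'\<in>Basis. (u \<bullet> b) * (v \<bullet> b') * \<omega> y b b')"
proof -
  interpret hermitian_form "\<omega> y" by (rule hermitian[OF assms])
  have "\<omega> y (\<Sum>b\<in>Basis. (u \<bullet> b) *\<^sub>R b) (\<Sum>b\<in>Basis. (v \<bullet> b) *\<^sub>R b) = (\<Sum>b\<in>Basis. \<Sum>b'\<in>Basis. (u \<bullet> b) * (v \<bullet> b') * \<omega> y b b')"
    by (subst bilinear_sum[OF bilin]) (simp_all add: sum.cartesian_product h_simps mult_ac case_prod_beta)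
  then show ?thesis by (simp add: euclidean_representation)
qed

lemma smooth_on_form:
  assumes "open S" "smooth_on f S" "smooth_on u S" "smooth_on v S" "\<And>x. x \<in> S \<Longrightarrow> f x \<in> Y"
  shows "smooth_on (\<lambda>x. \<omega> (f x) (u x) (v x)) S"
proof -
  have sm: "smooth_on (\<lambda>x. \<Sum>b\<in>Basis. \<Sum>b'\<in>Basis. (u x \<bullet> b) * (v x \<bullet> b') * \<omega> (f x) b b') S"
    by (intro smooth_on_sum smooth_on_mult smooth_on_inner smooth_on_const assms smooth_on_compose[OF smooth open_Y])
  have eq: "\<omega> (f x) (u x) (v x) = (\<Sum>b\<in>Basis. \<Sum>b'\<in>Basis. (u x \<bullet> b) * (v x \<bullet> b') * \<omega> (f x) b b')" if "x \<in> S" for x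
    by (rule expansion[OF assms(5)[OF that]])
  show ?thesis by (rule iffD2[OF smooth_on_cong[OF assms(1) eq] sm])
qed

lemma form_has_derivative:
  fixes f u v :: "'a::euclidean_space \<Rightarrow> complex^2"
  assumes "(f has_derivative f') (at x)" "(u has_derivative u') (at x)" "(v has_derivative v') (at x)" "f x \<in> Y"
  shows "((\<lambda>x. \<omega> (f x) (u x) (v x)) has_derivative
    (\<lambda>w. dir_deriv (f' w) (\<lambda>y. \<omega> y (u x) (v x)) (f x) + \<omega> (f x) (u' w) (v x) + \<omega> (f x) (u x) (v' w))) (at x)"
proof -
  let ?D = "\<lambda>b b' w. dir_deriv (f' w) (\<lambda>y. \<omega> y b b') (f x)"
  have d: "((\<lambda>x. \<omega> (f x) b b') has_derivative ?D b b') (at x)" for b b'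
    using diff_chain_at[OF assms(1) smooth_on_has_derivative[OF smooth assms(4)]] by (simp add: o_def)
  have 1: "((\<lambda>x. \<Sum>b\<in>Basis. \<Sum>b'\<in>Basis. (u x \<bullet> b) * (v x \<bullet> b') * \<omega> (f x) b b') has_derivative
    (\<lambda>w. \<Sum>b\<in>Basis. \<Sum>b'\<in>Basis. (u x \<bullet> b) * (v x \<bullet> b') * ?D b b' w + ((u x \<bullet> b) * (v' w \<bullet> b') + (u' w \<bullet> b) * (v x \<bullet> b')) * \<omega> (f x) b b')) (at x)"
    by (intro has_derivative_sum has_derivative_mult d has_derivative_inner_left assms)
  have D: "dir_deriv w (\<lambda>y. \<omega> y p q) (f x) = (\<Sum>b\<in>Basis. \<Sum>b'\<in>Basis. (p \<bullet> b) * (q \<bullet> b') * dir_deriv w (\<lambda>y. \<omega> y b b') (f x))" for w p q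
  proof -
    have eq: "frechet_derivative (\<lambda>y. \<omega> y p q) (at (f x)) = frechet_derivative (\<lambda>y. \<Sum>b\<in>Basis. \<Sum>b'\<in>Basis. (p \<bullet> b) * (q \<bullet> b') * \<omega> y b b') (at (f x))"
      by (rule frechet_derivative_cong[OF open_Y expansion assms(4)])
    have d: "((\<lambda>y. \<Sum>b\<in>Basis. \<Sum>b'\<in>Basis. (p \<bullet> b) * (q \<bullet> b') * \<omega> y b b') has_derivative
      (\<lambda>w. \<Sum>b\<in>Basis. \<Sum>b'\<in>Basis. (p \<bullet> b) * (q \<bullet> b') * dir_deriv w (\<lambda>y. \<omega> y b b') (f x))) (at (f x))"
      by (intro has_derivative_sum has_derivative_mult_right smooth_on_has_derivative[OF smooth assms(4)])
    show ?thesis unfolding eq frechet_derivative_at[OF d, symmetric] by (rule refl)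
  qed
  have 2: "((\<lambda>x. \<Sum>b\<in>Basis. \<Sum>b'\<in>Basis. (u x \<bullet> b) * (v x \<bullet> b') * \<omega> (f x) b b') has_derivative
    (\<lambda>w. dir_deriv (f' w) (\<lambda>y. \<omega> y (u x) (v x)) (f x) + \<omega> (f x) (u' w) (v x) + \<omega> (f x) (u x) (v' w))) (at x)"
    by (rule has_derivative_eq_rhs[OF 1])
      (rule ext, unfold D[of "u x" "v x"] expansion[OF assms(4), of "u' _"] expansion[OF assms(4), of _ "v' _"]
        sum.distrib[symmetric], intro sum.cong refl, simp add: algebra_simps)
  \<comment> \<open>The expansion holds on \<open>Y\<close> only, so the derivative is transferred
    on a neighbourhood of \<open>x\<close> that \<open>f\<close> maps into \<open>Y\<close>.\<close>
  have "(f \<longlongrightarrow> f x) (nhds x)"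
    using has_derivative_continuous[OF assms(1)] by (simp add: continuous_at tendsto_at_iff_tendsto_nhds)
  from topological_tendstoD[OF this open_Y assms(4)]
  obtain U where U: "open U" "x \<in> U" "\<And>z. z \<in> U \<Longrightarrow> f z \<in> Y" by (auto simp: eventually_nhds)
  show ?thesis
    by (rule has_derivative_transform_within_open[OF 2 U(1,2) expansion[OF U(3), symmetric]])
qed

end

section \<open>The Euler--Lagrange equation\<close>

lemma closed_cube: "closed (cube x r)" and compact_cube: "compact (cube x r)"
  by (simp_all add: cube_def closed_cbox compact_cbox)

lemma center_in_cube: "r \<ge> 0 \<Longrightarrow> x \<in> cube x r"
  by (simp add: mem_cube)

text \<open>The fundamental lemma of the calculus of variations, with the integration by parts
  included. A cutoff on a cube where the difference of the two sides has constant sign would give a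
  nonzero integral.\<close>

lemma fundamental_lemma:
  fixes P0 P1 P2 :: "real^2 \<Rightarrow> real"
  assumes \<Omega>: "open \<Omega>" and P: "smooth_on P0 \<Omega>" "smooth_on P1 \<Omega>" "smooth_on P2 \<Omega>"
    and I: "\<And>y s \<eta>. s > 0 \<Longrightarrow> cube y s \<subseteq> \<Omega> \<Longrightarrow> smooth_on \<eta> UNIV \<Longrightarrow> (\<And>x. x \<notin> cube y s \<Longrightarrow> \<eta> x = 0) \<Longrightarrow>
      integral (cube y s) (\<lambda>x. \<eta> x * P0 x + dir_deriv e1 \<eta> x * P1 x + dir_deriv e2 \<eta> x * P2 x) = 0"
    and x: "x \<in> \<Omega>"
  shows "P0 x = dir_deriv e1 P1 x + dir_deriv e2 P2 x"
proof (rule ccontr)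
  let ?Z = "\<lambda>x. P0 x - dir_deriv e1 P1 x - dir_deriv e2 P2 x"
  assume "\<not> ?thesis"
  then have "?Z x \<noteq> 0" by simp
  define \<epsilon> where "\<epsilon> = sgn (?Z x)"
  have \<epsilon>: "\<epsilon> * ?Z x > 0" using \<open>?Z x \<noteq> 0\<close> by (auto simp: \<epsilon>_def sgn_if)
  have sZ: "smooth_on ?Z \<Omega>" by (intro smooth_on_diff smooth_on_derivative P \<Omega>)
  have "((\<lambda>y. \<epsilon> * ?Z y) \<longlongrightarrow> \<epsilon> * ?Z x) (nhds x)"
    by (intro tendsto_mult tendsto_const smooth_on_tendsto[OF sZ \<Omega> x])
  then have "\<forall>\<^sub>F y in nhds x. 0 < \<epsilon> * ?Z y" using \<epsilon> by (rule order_tendstoD)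
  moreover have "\<forall>\<^sub>F y in nhds x. y \<in> \<Omega>" using \<Omega> x by (rule eventually_nhds_in_open)
  ultimately have "\<forall>\<^sub>F y in nhds x. 0 < \<epsilon> * ?Z y \<and> y \<in> \<Omega>" by (rule eventually_conj)
  then obtain s where s: "s > 0" and *: "\<And>r y. r \<le> s \<Longrightarrow> y \<in> cube x r \<Longrightarrow> 0 < \<epsilon> * ?Z y \<and> y \<in> \<Omega>"
    by (rule eventually_cubeD) blast
  let ?Q = "cube x s"
  have Q: "?Q \<subseteq> \<Omega>" and pos: "\<And>y. y \<in> ?Q \<Longrightarrow> 0 < \<epsilon> * ?Z y" using * by auto
  let ?\<eta> = "cutoff x s"
  have \<eta>: "smooth_on ?\<eta> S" for S by (rule smooth_on_cutoff)
  have \<eta>0: "\<And>y. y \<notin> ?Q \<Longrightarrow> ?\<eta> y = 0" by (rule cutoff_eq_0[OF s])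
  \<comment> \<open>Integration by parts: \<open>p\<close> lives on \<Omega> only, but its product
    with the cutoff extends smoothly by 0.\<close>
  have div: "integral ?Q (\<lambda>y. ?\<eta> y * dir_deriv v p y + dir_deriv v ?\<eta> y * p y) = 0" if p: "smooth_on p \<Omega>" for p v
  proof -
    let ?h = "\<lambda>y. if y \<in> \<Omega> then ?\<eta> y * p y else 0"
    have h: "smooth_on ?h UNIV"
      by (rule smooth_on_extend_by_0[OF \<Omega> closed_cube Q]) (auto intro: smooth_on_mult \<eta> p \<Omega> simp: \<eta>0)
    have "dir_deriv v ?h y = ?\<eta> y * dir_deriv v p y + dir_deriv v ?\<eta> y * p y" if "y \<in> \<Omega>" for y
    proof -
      have eq: "frechet_derivative ?h (at y) = frechet_derivative (\<lambda>y. ?\<eta> y * p y) (at y)"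
        by (rule frechet_derivative_cong[OF \<Omega> _ that]) simp
      have D: "((\<lambda>y. ?\<eta> y * p y) has_derivative (\<lambda>v. ?\<eta> y * frechet_derivative p (at y) v + frechet_derivative ?\<eta> (at y) v * p y)) (at y)"
        by (intro has_derivative_mult smooth_on_has_derivative[OF p that] smooth_on_has_derivative[OF \<eta>[of UNIV]] UNIV_I)
      show ?thesis unfolding eq frechet_derivative_at[OF D, symmetric] by (rule refl)
    qed
    then have "integral ?Q (\<lambda>y. ?\<eta> y * dir_deriv v p y + dir_deriv v ?\<eta> y * p y) = integral ?Q (dir_deriv v ?h)"
      using Q by (intro integral_cong) auto
    also have "\<dots> = 0" by (rule integral_dir_deriv_eq_0[OF h]) (simp add: \<eta>0)
    finally show ?thesis .
  qed
  have cont: "continuous_on ?Q p" if "smooth_on p \<Omega>" for p :: "real^2 \<Rightarrow> real"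
    using continuous_on_subset[OF smooth_on_continuous[OF that] Q] .
  note c = cont[OF \<eta>] cont[OF smooth_on_derivative[OF \<eta>]] P[THEN cont] P[THEN smooth_on_derivative, THEN cont]
  have int: "p integrable_on ?Q" if "continuous_on ?Q p" for p :: "real^2 \<Rightarrow> real"
    using that unfolding cube_def by (rule integrable_continuous)
  have "integral ?Q (\<lambda>y. ?\<eta> y * ?Z y) = integral ?Q (\<lambda>y. (?\<eta> y * P0 y + dir_deriv e1 ?\<eta> y * P1 y + dir_deriv e2 ?\<eta> y * P2 y)
     - (?\<eta> y * dir_deriv e1 P1 y + dir_deriv e1 ?\<eta> y * P1 y) - (?\<eta> y * dir_deriv e2 P2 y + dir_deriv e2 ?\<eta> y * P2 y))"
    by (simp add: algebra_simps)
  also have "\<dots> = integral ?Q (\<lambda>y. ?\<eta> y * P0 y + dir_deriv e1 ?\<eta> y * P1 y + dir_deriv e2 ?\<eta> y * P2 y)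
     - integral ?Q (\<lambda>y. ?\<eta> y * dir_deriv e1 P1 y + dir_deriv e1 ?\<eta> y * P1 y) - integral ?Q (\<lambda>y. ?\<eta> y * dir_deriv e2 P2 y + dir_deriv e2 ?\<eta> y * P2 y)"
    by (subst integral_diff integral_diff; (intro int continuous_intros c)?)+ simp
  also have "\<dots> = 0" unfolding div[OF P(2)] div[OF P(3)] using I[OF s Q \<eta> \<eta>0] by simp
  finally have 0: "integral ?Q (\<lambda>y. ?\<eta> y * ?Z y) = 0" .
  have ci: "continuous_on ?Q (\<lambda>y. \<epsilon> * (?\<eta> y * ?Z y))" by (intro continuous_intros c)
  have hi: "((\<lambda>y. \<epsilon> * (?\<eta> y * ?Z y)) has_integral 0) ?Q"
    using integrable_integral[OF int[OF ci]] 0 by simp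
  have "\<epsilon> * (?\<eta> x * ?Z x) = 0"
  proof (rule has_integral_0_cbox_imp_0[OF ci[unfolded cube_def] _ hi[unfolded cube_def]])
    show "box (x - s *\<^sub>R One) (x + s *\<^sub>R One) \<noteq> {}" using s by (simp add: box_ne_empty inner_simps)
    show "x \<in> cbox (x - s *\<^sub>R One) (x + s *\<^sub>R One)" using center_in_cube[of s x] s by (simp add: cube_def)
    fix y assume "y \<in> box (x - s *\<^sub>R One) (x + s *\<^sub>R One)"
    then have "y \<in> ?Q" using box_subset_cbox unfolding cube_def by blast
    then show "0 \<le> \<epsilon> * (?\<eta> y * ?Z y)"
      using mult_nonneg_nonneg[OF cutoff_nonneg[of x s y] less_imp_le[OF pos]] by (simp only: mult.left_commute)
  qed
  moreover have "?\<eta> x = 1" using s by (intro cutoff_eq_1 center_in_cube) auto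
  ultimately have "\<epsilon> * ?Z x = 0" by (simp only: mult_1_left)
  then show False using \<epsilon> by linarith
qed

text \<open>The integrand of \<open>L\<close> in coordinates. With area density \<open>D\<close> and
  \<open>cos \<alpha> = W / D\<close>, the quotient \<open>D / cos \<alpha>\<close> equals
  \<open>D\<^sup>2 / W\<close>, in which no square root remains.\<close>

definition lagrangian :: "(complex^2 \<Rightarrow> complex^2 \<Rightarrow> real) \<Rightarrow> complex^2 \<Rightarrow> complex^2 \<Rightarrow> real" where
  "lagrangian h u v = (h u (J u) * h v (J v) - h u (J v) * h v (J u)) / h u v"

lemma bounded_linear_cdet: "bounded_linear (cdet u)" "bounded_linear (\<lambda>u. cdet u v)"
  by (auto simp: linear_conv_bounded_linear[symmetric] linear_iff cdet_def algebra_simps scaleR_conv_of_real[symmetric])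

lemma bounded_bilinear_cdet: "bounded_bilinear cdet"
  using bounded_linear_cdet unfolding bilinear_conv_bounded_bilinear[symmetric] bilinear_def linear_conv_bounded_linear by blast

lemma cdet_swap: "cdet u v = - cdet v u"
  by (simp add: cdet_def)

context kaehler_chart
begin

text \<open>\<open>gram\<close> of the form at \<open>y\<close>, spelled out so that its smooth
  dependence on \<open>y\<close> can be read off.\<close>

definition rho :: "complex^2 \<Rightarrow> real" where
  "rho y = \<omega> y z1 (J z1) * \<omega> y z2 (J z2) - (\<omega> y z1 z2)\<^sup>2 - (\<omega> y z1 (J z2))\<^sup>2"

lemma rho_eq_gram: "y \<in> Y \<Longrightarrow> rho y = hermitian_form.gram (\<omega> y)"
  using hermitian_form.gram_def[OF hermitian] by (simp add: rho_def)

lemma rho_pos: "y \<in> Y \<Longrightarrow> rho y > 0"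
  using hermitian_form.gram_pos[OF hermitian] by (simp add: rho_eq_gram)

lemma smooth_on_rho: "smooth_on rho Y"
  unfolding rho_def[abs_def] by (intro smooth_on_diff smooth_on_mult smooth_on_power smooth open_Y)

lemma lagrangian_eq:
  assumes "y \<in> Y" "\<omega> y u v \<noteq> 0"
  shows "lagrangian (\<omega> y) u v = \<omega> y u v + rho y * (cmod (cdet u v))\<^sup>2 / \<omega> y u v"
  unfolding lagrangian_def hermitian_form.gram_identity[OF hermitian[OF assms(1)]] rho_eq_gram[OF assms(1)]
  using assms(2) by (simp add: add_divide_distrib power2_eq_square)

end


lemma dir_deriv_variation:
  fixes f :: "'a::euclidean_space \<Rightarrow> 'b::euclidean_space"
  assumes "smooth_on f \<Omega>" "smooth_on \<eta> UNIV" "x \<in> \<Omega>"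
  shows "dir_deriv v (\<lambda>x. f x + (t * \<eta> x) *\<^sub>R e) x = dir_deriv v f x + (t * dir_deriv v \<eta> x) *\<^sub>R e"
proof -
  have "((\<lambda>x. f x + (t * \<eta> x) *\<^sub>R e) has_derivative (\<lambda>v. frechet_derivative f (at x) v + (t * frechet_derivative \<eta> (at x) v) *\<^sub>R e)) (at x)"
    by (intro has_derivative_add has_derivative_scaleR_left has_derivative_mult_right smooth_on_has_derivative[OF assms(1,3)]
        smooth_on_has_derivative[OF assms(2)] UNIV_I)
  from frechet_derivative_at[OF this, symmetric] show ?thesis by simp
qed

text \<open>A critical surface seen through one pair of charts. Variations by a scalar test function
  times a constant vector \<open>e\<close> suffice, because each \<open>e\<close> yields one real
  equation at every point.\<close>

locale critical_map = kaehler_chart Y \<omega>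
  for Y :: "(complex^2) set" and \<omega> :: "complex^2 \<Rightarrow> complex^2 \<Rightarrow> complex^2 \<Rightarrow> real" +
  fixes \<Omega> :: "(real^2) set" and f :: "real^2 \<Rightarrow> complex^2"
  assumes open_\<Omega>: "open \<Omega>" and smooth_f: "smooth_on f \<Omega>" and f_in_Y: "x \<in> \<Omega> \<Longrightarrow> f x \<in> Y"
    and symplectic: "x \<in> \<Omega> \<Longrightarrow> \<omega> (f x) (dir_deriv e1 f x) (dir_deriv e2 f x) > 0"
    and critical: "s > 0 \<Longrightarrow> cube y s \<subseteq> \<Omega> \<Longrightarrow> smooth_on \<eta> UNIV \<Longrightarrow> (\<And>x. x \<notin> cube y s \<Longrightarrow> \<eta> x = 0) \<Longrightarrow>
      ((\<lambda>t. integral (cube y s) (\<lambda>x. lagrangian (\<omega> (f x + (t * \<eta> x) *\<^sub>R e))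
          (dir_deriv e1 (\<lambda>x. f x + (t * \<eta> x) *\<^sub>R e) x) (dir_deriv e2 (\<lambda>x. f x + (t * \<eta> x) *\<^sub>R e) x)))
        has_real_derivative 0) (at 0)"
begin

abbreviation "f1 \<equiv> dir_deriv e1 f"
abbreviation "f2 \<equiv> dir_deriv e2 f"
abbreviation "W x \<equiv> \<omega> (f x) (f1 x) (f2 x)"
abbreviation "\<delta> x \<equiv> cdet (f1 x) (f2 x)"
abbreviation "Dom e x \<equiv> dir_deriv e (\<lambda>y. \<omega> y (f1 x) (f2 x)) (f x)"
abbreviation "\<mu> x \<equiv> rho (f x) / (W x)\<^sup>2"

text \<open>Here \<open>n, n1, n2\<close> stand for the values at \<open>x\<close> of a test function and of its two partial derivatives.\<close>

lemma lagrangian_derivative: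
  assumes x: "x \<in> \<Omega>"
  shows "((\<lambda>t. \<omega> (f x + (t * n) *\<^sub>R e) (f1 x + (t * n1) *\<^sub>R e) (f2 x + (t * n2) *\<^sub>R e) +
      rho (f x + (t * n) *\<^sub>R e) * (cmod (cdet (f1 x + (t * n1) *\<^sub>R e) (f2 x + (t * n2) *\<^sub>R e)))\<^sup>2 /
      \<omega> (f x + (t * n) *\<^sub>R e) (f1 x + (t * n1) *\<^sub>R e) (f2 x + (t * n2) *\<^sub>R e)) has_real_derivative
    n * (Dom e x + (cmod (\<delta> x))\<^sup>2 * (dir_deriv e rho (f x) / W x - \<mu> x * Dom e x))
    + n1 * (\<omega> (f x) e (f2 x) + (2 * rho (f x) / W x * Re (cnj (\<delta> x) * cdet e (f2 x)) - (cmod (\<delta> x))\<^sup>2 * (\<mu> x * \<omega> (f x) e (f2 x))))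
    + n2 * (\<omega> (f x) (f1 x) e + (2 * rho (f x) / W x * Re (cnj (\<delta> x) * cdet (f1 x) e) - (cmod (\<delta> x))\<^sup>2 * (\<mu> x * \<omega> (f x) (f1 x) e)))) (at 0)"
proof -
  let ?F = "\<lambda>n u t. u + (t * n) *\<^sub>R e"
  have lin: "(?F n u has_derivative (\<lambda>k. (k * n) *\<^sub>R e)) (at t)" for n u and t :: real
    by (auto intro!: derivative_eq_intros)
  interpret hermitian_form "\<omega> (f x)" by (rule hermitian[OF f_in_Y[OF x]])
  have lin_eq: "dir_deriv (r *\<^sub>R e) g (f x) = r * dir_deriv e g (f x)" if "smooth_on g Y" for r and g :: "complex^2 \<Rightarrow> real"
    using linear.scaleR[OF bounded_linear.linear[OF has_derivative_bounded_linear[OF smooth_on_has_derivative[OF that f_in_Y[OF x]]]]] by simp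
  have "((\<lambda>t. \<omega> (?F n (f x) t) (?F n1 (f1 x) t) (?F n2 (f2 x) t)) has_derivative
    (\<lambda>k. dir_deriv ((k * n) *\<^sub>R e) (\<lambda>y. \<omega> y (?F n1 (f1 x) 0) (?F n2 (f2 x) 0)) (?F n (f x) 0)
      + \<omega> (?F n (f x) 0) ((k * n1) *\<^sub>R e) (?F n2 (f2 x) 0) + \<omega> (?F n (f x) 0) (?F n1 (f1 x) 0) ((k * n2) *\<^sub>R e))) (at 0)"
    by (rule form_has_derivative[OF lin lin lin]) (simp add: f_in_Y x)
  then have W': "((\<lambda>t. \<omega> (?F n (f x) t) (?F n1 (f1 x) t) (?F n2 (f2 x) t)) has_real_derivative
      n * Dom e x + n1 * \<omega> (f x) e (f2 x) + n2 * \<omega> (f x) (f1 x) e) (at 0)"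
    unfolding has_field_derivative_def
    by (rule has_derivative_eq_rhs) (simp add: lin_eq[OF smooth] h_simps fun_eq_iff algebra_simps)
  have r0: "(rho has_derivative frechet_derivative rho (at (f x))) (at (?F n (f x) 0))"
    using smooth_on_has_derivative[OF smooth_on_rho f_in_Y[OF x]] by simp
  have rho': "((\<lambda>t. rho (?F n (f x) t)) has_real_derivative n * dir_deriv e rho (f x)) (at 0)"
    unfolding has_field_derivative_def
    by (rule has_derivative_eq_rhs[OF diff_chain_at[OF lin r0, unfolded o_def]])
      (simp add: lin_eq[OF smooth_on_rho] fun_eq_iff algebra_simps)
  \<comment> \<open>There is no term in \<open>t\<^sup>2\<close>, since both variations point in the
    direction \<open>e\<close> and \<open>cdet e e = 0\<close>.\<close>
  have "cdet (?F n1 (f1 x) t) (?F n2 (f2 x) t) = \<delta> x + t *\<^sub>R (n1 *\<^sub>R cdet e (f2 x) + n2 *\<^sub>R cdet (f1 x) e)" for t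
    unfolding cdet_def vector_add_component vector_scaleR_component scaleR_conv_of_real[where 'a=complex]
    by (simp add: algebra_simps)
  then have sq: "(cmod (cdet (?F n1 (f1 x) t) (?F n2 (f2 x) t)))\<^sup>2 =
      (Re (\<delta> x) + t * (n1 * Re (cdet e (f2 x)) + n2 * Re (cdet (f1 x) e)))\<^sup>2 + (Im (\<delta> x) + t * (n1 * Im (cdet e (f2 x)) + n2 * Im (cdet (f1 x) e)))\<^sup>2" for t
    by (simp add: cmod_power2)
  have d': "((\<lambda>t. (cmod (cdet (?F n1 (f1 x) t) (?F n2 (f2 x) t)))\<^sup>2) has_real_derivative
     2 * (n1 * Re (cnj (\<delta> x) * cdet e (f2 x)) + n2 * Re (cnj (\<delta> x) * cdet (f1 x) e))) (at 0)"
    unfolding sq by (auto intro!: derivative_eq_intros simp: algebra_simps)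
  have W0: "W x > 0" by (rule symplectic[OF x])
  have "((\<lambda>t. \<omega> (?F n (f x) t) (?F n1 (f1 x) t) (?F n2 (f2 x) t) +
      rho (?F n (f x) t) * (cmod (cdet (?F n1 (f1 x) t) (?F n2 (f2 x) t)))\<^sup>2 / \<omega> (?F n (f x) t) (?F n1 (f1 x) t) (?F n2 (f2 x) t)) has_real_derivative
      (n * Dom e x + n1 * \<omega> (f x) e (f2 x) + n2 * \<omega> (f x) (f1 x) e) +
      (((n * dir_deriv e rho (f x)) * (cmod (cdet (?F n1 (f1 x) 0) (?F n2 (f2 x) 0)))\<^sup>2
        + (2 * (n1 * Re (cnj (\<delta> x) * cdet e (f2 x)) + n2 * Re (cnj (\<delta> x) * cdet (f1 x) e))) * rho (?F n (f x) 0))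
       * \<omega> (?F n (f x) 0) (?F n1 (f1 x) 0) (?F n2 (f2 x) 0)
       - rho (?F n (f x) 0) * (cmod (cdet (?F n1 (f1 x) 0) (?F n2 (f2 x) 0)))\<^sup>2 * (n * Dom e x + n1 * \<omega> (f x) e (f2 x) + n2 * \<omega> (f x) (f1 x) e))
      / (\<omega> (?F n (f x) 0) (?F n1 (f1 x) 0) (?F n2 (f2 x) 0) * \<omega> (?F n (f x) 0) (?F n1 (f1 x) 0) (?F n2 (f2 x) 0))) (at 0)"
    by (intro DERIV_add DERIV_divide DERIV_mult W' rho' d') (use W0 in simp)
  then show ?thesis
    by (rule DERIV_cong) (use W0 in \<open>simp add: field_simps power2_eq_square\<close>)
qed

lemma first_variation:
  assumes s: "s > 0" and Q: "cube y s \<subseteq> \<Omega>" and \<eta>: "smooth_on \<eta> UNIV" and \<eta>0: "\<And>x. x \<notin> cube y s \<Longrightarrow> \<eta> x = 0"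
  shows "integral (cube y s) (\<lambda>x. 
    \<eta> x * (Dom e x + (cmod (\<delta> x))\<^sup>2 * (dir_deriv e rho (f x) / W x - \<mu> x * Dom e x))
    + dir_deriv e1 \<eta> x * (\<omega> (f x) e (f2 x) + (2 * rho (f x) / W x * Re (cnj (\<delta> x) * cdet e (f2 x)) - (cmod (\<delta> x))\<^sup>2 * (\<mu> x * \<omega> (f x) e (f2 x))))
    + dir_deriv e2 \<eta> x * (\<omega> (f x) (f1 x) e + (2 * rho (f x) / W x * Re (cnj (\<delta> x) * cdet (f1 x) e) - (cmod (\<delta> x))\<^sup>2 * (\<mu> x * \<omega> (f x) (f1 x) e)))) = 0"
    (is "integral ?Q ?V = 0")
proof -
  define F where "F = (\<lambda>p. f (snd p) + (fst p * \<eta> (snd p)) *\<^sub>R e)"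
  define U where "U = (\<lambda>p. f1 (snd p) + (fst p * dir_deriv e1 \<eta> (snd p)) *\<^sub>R e)"
  define V where "V = (\<lambda>p. f2 (snd p) + (fst p * dir_deriv e2 \<eta> (snd p)) *\<^sub>R e)"
  let ?W = "\<lambda>p. \<omega> (F p) (U p) (V p)"
  let ?L = "\<lambda>p. ?W p + rho (F p) * (cmod (cdet (U p) (V p)))\<^sup>2 / ?W p"
  let ?S = "UNIV \<times> \<Omega> :: (real \<times> (real^2)) set"
  have S: "open ?S" using open_\<Omega> by (simp add: open_Times)
  have comp: "smooth_on (\<lambda>p. g (snd p)) ?S" if "smooth_on g \<Omega>" for g :: "real^2 \<Rightarrow> 'c::euclidean_space"
    by (rule smooth_on_compose[OF that open_\<Omega> S smooth_on_snd[OF S smooth_on_id]]) auto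
  have sFUV: "smooth_on F ?S" "smooth_on U ?S" "smooth_on V ?S"
    unfolding F_def U_def V_def
    by (intro smooth_on_add smooth_on_scaleR smooth_on_mult smooth_on_fst smooth_on_id smooth_on_const S comp
        smooth_on_derivative smooth_f smooth_on_subset[OF \<eta>] subset_UNIV)+
  \<comment> \<open>\<open>N0\<close> collects the times and points at which the varied map stays in
    the chart, and \<open>N\<close> those where in addition \<open>W\<close> stays positive, so that
    \<open>?L\<close> is smooth. Compactness of the cube then gives one time interval for all its
    points.\<close>
  define N0 where "N0 = ?S \<inter> F -` Y"
  have N0: "open N0" unfolding N0_def
    by (rule continuous_open_preimage[OF smooth_on_continuous[OF sFUV(1)] S open_Y])
  have N0S: "N0 \<subseteq> ?S" by (auto simp: N0_def)
  have sW: "smooth_on ?W N0"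
    by (rule smooth_on_form[OF N0 sFUV[THEN smooth_on_subset, OF N0S]]) (simp add: N0_def)
  define N where "N = N0 \<inter> ?W -` {0<..}"
  have N: "open N" unfolding N_def
    by (rule continuous_open_preimage[OF smooth_on_continuous[OF sW] N0 open_greaterThan])
  have NS: "N \<subseteq> N0" by (auto simp: N_def)
  have sWN: "smooth_on ?W N" by (rule smooth_on_subset[OF sW NS])
  have sFUVN: "smooth_on F N" "smooth_on U N" "smooth_on V N"
    using sFUV NS N0S smooth_on_subset by blast+
  have sL: "smooth_on ?L N"
  proof -
    have "smooth_on (\<lambda>p. rho (F p)) N"
      by (rule smooth_on_compose[OF smooth_on_rho open_Y N sFUVN(1)]) (auto simp: N_def N0_def)
    moreover have c: "smooth_on (\<lambda>p. cdet (U p) (V p)) N"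
      by (rule smooth_on_bilinear[OF bounded_bilinear_cdet N sFUVN(2,3)])
    then have "smooth_on (\<lambda>p. (cmod (cdet (U p) (V p)))\<^sup>2) N"
      unfolding cmod_power2 by (intro smooth_on_add smooth_on_power smooth_on_Re smooth_on_Im N)
    ultimately show ?thesis
      by (intro smooth_on_add smooth_on_divide smooth_on_mult sWN N) (auto simp: N_def)
  qed
  have "(0, x) \<in> N" if "x \<in> \<Omega>" for x
    using f_in_Y[OF that] symplectic[OF that] that by (simp add: N_def N0_def F_def U_def V_def)
  then have sub: "{0} \<times> ?Q \<subseteq> N" using Q by blast
  have "compact ({0::real} \<times> ?Q)" by (intro compact_Times compact_cube) auto
  from compact_subset_open_imp_ball_epsilon_subset[OF this N sub]
  obtain d where d: "d > 0" "(\<Union>p\<in>{0::real} \<times> ?Q. ball p d) \<subseteq> N" .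
  define \<tau> where "\<tau> = d / 2"
  have \<tau>: "\<tau> > 0" "\<tau> < d" using d by (auto simp: \<tau>_def)
  have inN: "(t, x) \<in> N" if "t \<in> {-\<tau>..\<tau>}" "x \<in> ?Q" for t x
  proof -
    have "(t, x) \<in> ball (0, x) d" using that \<tau> by (auto simp: dist_Pair_Pair dist_real_def)
    then show ?thesis using d(2) that by blast
  qed
  let ?L' = "\<lambda>p. frechet_derivative ?L (at p) (1, 0)"
  have dL: "((\<lambda>t. ?L (t, x)) has_field_derivative ?L' (t, x)) (at t within A)" if "(t, x) \<in> N" for t x A
  proof -
    have d1: "(?L has_derivative frechet_derivative ?L (at (t, x))) (at (t, x))"
      by (rule smooth_on_has_derivative[OF sL that])
    have "((\<lambda>t. (t, x)) has_derivative (\<lambda>k. (k, 0))) (at t within A)"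
      by (auto intro!: derivative_eq_intros)
    from has_derivative_compose[OF this d1]
    have d2: "((\<lambda>t. ?L (t, x)) has_derivative (\<lambda>k. frechet_derivative ?L (at (t, x)) (k, 0))) (at t within A)" .
    have "frechet_derivative ?L (at (t, x)) (k, 0) = ?L' (t, x) * k" for k
      using linear.scaleR[OF bounded_linear.linear[OF has_derivative_bounded_linear[OF d1]], of k "(1, 0)"] by simp
    then show ?thesis unfolding has_field_derivative_def by (intro has_derivative_eq_rhs[OF d2] ext)
  qed
  have cont: "continuous_on N ?L" "continuous_on N ?L'"
    by (rule smooth_on_continuous[OF sL], rule smooth_on_continuous[OF smooth_on_derivative[OF sL]])
  have "((\<lambda>t. integral (cbox (y - s *\<^sub>R One) (y + s *\<^sub>R One)) (\<lambda>x. ?L (t, x))) has_field_derivative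
      integral (cbox (y - s *\<^sub>R One) (y + s *\<^sub>R One)) (\<lambda>x. ?L' (0, x))) (at 0 within {-\<tau>..\<tau>})"
  proof (rule leibniz_rule_field_derivative)
    fix t :: real and x :: "real^2" assume tx: "t \<in> {-\<tau>..\<tau>}" "x \<in> cbox (y - s *\<^sub>R One) (y + s *\<^sub>R One)"
    show "((\<lambda>t. ?L (t, x)) has_field_derivative ?L' (t, x)) (at t within {-\<tau>..\<tau>})"
      using tx by (intro dL inN) (auto simp: cube_def)
  next
    fix t :: real assume t: "t \<in> {-\<tau>..\<tau>}"
    show "(\<lambda>x. ?L (t, x)) integrable_on cbox (y - s *\<^sub>R One) (y + s *\<^sub>R One)"
      by (intro integrable_continuous continuous_on_compose2[OF cont(1)] continuous_intros)
        (use inN[OF t] in \<open>auto simp: cube_def\<close>)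
  next
    show "continuous_on ({-\<tau>..\<tau>} \<times> cbox (y - s *\<^sub>R One) (y + s *\<^sub>R One)) (\<lambda>(t, x). ?L' (t, x))"
      unfolding split_beta prod.collapse
      by (rule continuous_on_subset[OF cont(2)]) (use inN in \<open>auto simp: cube_def\<close>)
  qed (use \<tau> in auto)
  moreover have at0: "at (0::real) within {-\<tau>..\<tau>} = at 0" using \<tau> by (intro at_within_interior) auto
  ultimately have 1: "((\<lambda>t. integral ?Q (\<lambda>x. ?L (t, x))) has_field_derivative integral ?Q (\<lambda>x. ?L' (0, x))) (at 0)"
    by (simp add: cube_def)
  have "((\<lambda>t. integral ?Q (\<lambda>x. ?L (t, x))) has_field_derivative 0) (at 0)"
  proof (rule has_field_derivative_transform_within_open[OF critical[OF s Q \<eta> \<eta>0, where e=e], of "{-\<tau><..<\<tau>}"])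
    fix t assume t: "t \<in> {-\<tau><..<\<tau>}"
    show "integral ?Q (\<lambda>x. lagrangian (\<omega> (f x + (t * \<eta> x) *\<^sub>R e))
          (dir_deriv e1 (\<lambda>x. f x + (t * \<eta> x) *\<^sub>R e) x) (dir_deriv e2 (\<lambda>x. f x + (t * \<eta> x) *\<^sub>R e) x)) = integral ?Q (\<lambda>x. ?L (t, x))"
    proof (rule integral_cong)
      fix x assume x: "x \<in> ?Q"
      then have *: "x \<in> \<Omega>" "(t, x) \<in> N" using Q inN t by auto
      show "lagrangian (\<omega> (f x + (t * \<eta> x) *\<^sub>R e))
          (dir_deriv e1 (\<lambda>x. f x + (t * \<eta> x) *\<^sub>R e) x) (dir_deriv e2 (\<lambda>x. f x + (t * \<eta> x) *\<^sub>R e) x) = ?L (t, x)"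
        unfolding dir_deriv_variation[OF smooth_f \<eta> *(1)]
        using lagrangian_eq[of "F (t, x)" "U (t, x)" "V (t, x)"] *(2) by (simp add: N_def N0_def F_def U_def V_def)
    qed
  qed (use \<tau> in auto)
  then have "integral ?Q (\<lambda>x. ?L' (0, x)) = 0" using DERIV_unique[OF 1] by simp
  moreover have "integral ?Q (\<lambda>x. ?L' (0, x)) = integral ?Q ?V"
  proof (rule integral_cong)
    fix x assume x: "x \<in> ?Q"
    have "(0, x) \<in> N" using inN[of 0 x] x \<tau> by simp
    moreover have "((\<lambda>t. ?L (t, x)) has_real_derivative ?V x) (at 0)"
      unfolding F_def U_def V_def fst_conv snd_conv by (rule lagrangian_derivative) (use x Q in blast)
    ultimately show "?L' (0, x) = ?V x" using DERIV_unique[OF dL] by blast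
  qed
  ultimately show ?thesis by simp
qed

end

section \<open>The pointwise Euler--Lagrange equation and the Cauchy--Riemann inequality\<close>

context critical_map
begin

lemma smooth_f12: "smooth_on f1 \<Omega>" "smooth_on f2 \<Omega>"
  by (rule smooth_on_derivative[OF smooth_f])+

lemma smooth_W: "smooth_on W \<Omega>"
  by (rule smooth_on_form[OF open_\<Omega> smooth_f smooth_f12 f_in_Y])

lemma smooth_on_cdet: "smooth_on u \<Omega> \<Longrightarrow> smooth_on v \<Omega> \<Longrightarrow> smooth_on (\<lambda>x. cdet (u x) (v x)) \<Omega>"
  by (rule smooth_on_bilinear[OF bounded_bilinear_cdet open_\<Omega>])

lemma smooth_rho_f: "smooth_on (\<lambda>x. rho (f x)) \<Omega>"
  by (rule smooth_on_compose[OF smooth_on_rho open_Y open_\<Omega> smooth_f f_in_Y])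

lemma W_nonzero: "x \<in> \<Omega> \<Longrightarrow> W x \<noteq> 0"
  using symplectic by force

lemma smooth_\<mu>: "smooth_on \<mu> \<Omega>"
  using W_nonzero by (intro smooth_on_divide smooth_on_power smooth_rho_f smooth_W open_\<Omega>) auto

lemma smooth_Dom: "smooth_on (Dom e) \<Omega>"
proof -
  have "smooth_on (\<lambda>x. \<Sum>b\<in>Basis. \<Sum>b'\<in>Basis. (f1 x \<bullet> b) * (f2 x \<bullet> b') * dir_deriv e (\<lambda>y. \<omega> y b b') (f x)) \<Omega>"
    by (intro smooth_on_sum smooth_on_mult smooth_on_inner smooth_on_const smooth_f12 open_\<Omega>
        smooth_on_compose[OF smooth_on_derivative[OF smooth] open_Y open_\<Omega> smooth_f f_in_Y])
  moreover have "Dom e x = (\<Sum>b\<in>Basis. \<Sum>b'\<in>Basis. (f1 x \<bullet> b) * (f2 x \<bullet> b') * dir_deriv e (\<lambda>y. \<omega> y b b') (f x))" if "x \<in> \<Omega>" for x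
  proof -
    have eq: "frechet_derivative (\<lambda>y. \<omega> y (f1 x) (f2 x)) (at (f x)) = frechet_derivative (\<lambda>y. \<Sum>b\<in>Basis. \<Sum>b'\<in>Basis. (f1 x \<bullet> b) * (f2 x \<bullet> b') * \<omega> y b b') (at (f x))"
      by (rule frechet_derivative_cong[OF open_Y expansion f_in_Y[OF that]])
    have d: "((\<lambda>y. \<Sum>b\<in>Basis. \<Sum>b'\<in>Basis. (f1 x \<bullet> b) * (f2 x \<bullet> b') * \<omega> y b b') has_derivative
      (\<lambda>w. \<Sum>b\<in>Basis. \<Sum>b'\<in>Basis. (f1 x \<bullet> b) * (f2 x \<bullet> b') * dir_deriv w (\<lambda>y. \<omega> y b b') (f x))) (at (f x))"
      by (intro has_derivative_sum has_derivative_mult_right smooth_on_has_derivative[OF smooth f_in_Y[OF that]])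
    show ?thesis unfolding eq frechet_derivative_at[OF d, symmetric] by (rule refl)
  qed
  ultimately show ?thesis by (subst smooth_on_cong[OF open_\<Omega>]) auto
qed

lemma mixed: "x \<in> \<Omega> \<Longrightarrow> dir_deriv e2 f1 x = dir_deriv e1 f2 x"
  using mixed_derivatives_commute[OF smooth_f open_\<Omega>, of x e1 e2] by simp

text \<open>Closedness of the form makes \<open>W\<close> a null Lagrangian: its Euler--Lagrange
  equation holds for every map, which is the pointwise form of the invariance of symplectic
  area.\<close>

lemma Dom_divergence:
  assumes x: "x \<in> \<Omega>"
  shows "Dom e x = dir_deriv e1 (\<lambda>x. \<omega> (f x) e (f2 x)) x + dir_deriv e2 (\<lambda>x. \<omega> (f x) (f1 x) e) x"
proof -
  interpret hermitian_form "\<omega> (f x)" by (rule hermitian[OF f_in_Y[OF x]])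
  note d = smooth_on_has_derivative[OF smooth_f x] smooth_on_has_derivative[OF smooth_f12(1) x] smooth_on_has_derivative[OF smooth_f12(2) x]
  have z: "\<omega> (f x) 0 u = 0" "\<omega> (f x) u 0 = 0" for u
    using bilinear_lzero[OF bilin] bilinear_rzero[OF bilin] by auto
  have 1: "dir_deriv e1 (\<lambda>x. \<omega> (f x) e (f2 x)) x = dir_deriv (f1 x) (\<lambda>y. \<omega> y e (f2 x)) (f x) + \<omega> (f x) e (dir_deriv e1 f2 x)"
    using fun_cong[OF frechet_derivative_at[OF form_has_derivative[OF d(1) has_derivative_const d(3) f_in_Y[OF x]], symmetric], of e e1]
    by (simp add: z)
  have 2: "dir_deriv e2 (\<lambda>x. \<omega> (f x) (f1 x) e) x = dir_deriv (f2 x) (\<lambda>y. \<omega> y (f1 x) e) (f x) + \<omega> (f x) (dir_deriv e2 f1 x) e"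
    using fun_cong[OF frechet_derivative_at[OF form_has_derivative[OF d(1) d(2) has_derivative_const f_in_Y[OF x]], symmetric], of e e2]
    by (simp add: z)
  have neg: "dir_deriv w (\<lambda>y. \<omega> y u v) (f x) = - dir_deriv w (\<lambda>y. \<omega> y v u) (f x)" for u v w
  proof -
    have eq: "frechet_derivative (\<lambda>y. \<omega> y u v) (at (f x)) = frechet_derivative (\<lambda>y. - \<omega> y v u) (at (f x))"
      by (rule frechet_derivative_cong[OF open_Y hermitian_form.swap[OF hermitian] f_in_Y[OF x]])
    have d: "((\<lambda>y. - \<omega> y v u) has_derivative (\<lambda>w. - dir_deriv w (\<lambda>y. \<omega> y v u) (f x))) (at (f x))"
      by (intro has_derivative_minus smooth_on_has_derivative[OF smooth f_in_Y[OF x]])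
    show ?thesis unfolding eq frechet_derivative_at[OF d, symmetric] by (rule refl)
  qed
  show ?thesis
    using closed[OF f_in_Y[OF x], of "f1 x" "f2 x" e] neg[of e "f2 x" "f1 x"] neg[of "f1 x" e "f2 x"]
      swap[of e "dir_deriv e1 f2 x"] mixed[OF x]
    unfolding 1 2 by simp
qed

lemma dir_deriv_real_mult:
  fixes p q :: "real^2 \<Rightarrow> real"
  assumes "smooth_on p \<Omega>" "smooth_on q \<Omega>" "x \<in> \<Omega>"
  shows "dir_deriv v (\<lambda>x. p x * q x) x = p x * dir_deriv v q x + dir_deriv v p x * q x"
  using fun_cong[OF frechet_derivative_at[OF has_derivative_mult[OF smooth_on_has_derivative[OF assms(1,3)]
    smooth_on_has_derivative[OF assms(2,3)]], symmetric], of v] by simp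

lemma dir_deriv_Re_mult3:
  assumes "smooth_on k \<Omega>" "smooth_on w \<Omega>" "smooth_on d \<Omega>" "x \<in> \<Omega>"
  shows "dir_deriv v (\<lambda>x. k x * Re (w x * d x)) x =
    dir_deriv v k x * Re (w x * d x) + k x * Re (dir_deriv v w x * d x) + k x * Re (w x * dir_deriv v d x)"
proof -
  have "((\<lambda>x. k x * Re (w x * d x)) has_derivative (\<lambda>v. k x * Re (w x * frechet_derivative d (at x) v + frechet_derivative w (at x) v * d x)
      + frechet_derivative k (at x) v * Re (w x * d x))) (at x)"
    by (intro has_derivative_mult has_derivative_Re smooth_on_has_derivative[OF _ assms(4)] assms(1-3))
  from fun_cong[OF frechet_derivative_at[OF this, symmetric], of v] show ?thesis by (simp add: algebra_simps)
qed

text \<open>The part of the equation coming from \<open>W\<close> drops out by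
  \<open>Dom_divergence\<close>. Terms with |w|^2, its derivatives, or a derivative of
  \<open>k\<close> keep a factor \<open>w\<close>; divided by \<open>k\<close> they are collected in
  \<open>G\<close>. Derivatives of \<open>w\<close> do occur in \<open>G\<close>, but multiplied by
  the remaining \<open>w\<close>, so continuity of \<open>G\<close> is enough for a bound on compact
  sets.\<close>

lemma euler_lagrange_weak_form:
  obtains G where "continuous_on \<Omega> G"
    and "\<And>x. x \<in> \<Omega> \<Longrightarrow> Re (dir_deriv e1 (\<lambda>x. cnj (\<delta> x)) x * cdet e (f2 x) + dir_deriv e2 (\<lambda>x. cnj (\<delta> x)) x * cdet (f1 x) e)
      = Re (cnj (\<delta> x) * G x)"
proof -
  define w where "w = (\<lambda>x. cnj (\<delta> x))"
  define d1 where "d1 = (\<lambda>x. cdet e (f2 x))"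
  define d2 where "d2 = (\<lambda>x. cdet (f1 x) e)"
  define k where "k = (\<lambda>x. 2 * rho (f x) / W x)"
  define o1 where "o1 = (\<lambda>x. \<omega> (f x) e (f2 x))"
  define o2 where "o2 = (\<lambda>x. \<omega> (f x) (f1 x) e)"
  define S0 where "S0 = (\<lambda>x. dir_deriv e rho (f x) / W x - \<mu> x * Dom e x)"
  define S1 where "S1 = (\<lambda>x. \<mu> x * o1 x)"
  define S2 where "S2 = (\<lambda>x. \<mu> x * o2 x)"
  define N where "N = (\<lambda>x. (cmod (\<delta> x))\<^sup>2)"
  have w: "smooth_on w \<Omega>" unfolding w_def by (intro smooth_on_cnj smooth_on_cdet smooth_f12 open_\<Omega>)
  have d1: "smooth_on d1 \<Omega>" and d2: "smooth_on d2 \<Omega>"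
    unfolding d1_def d2_def by (intro smooth_on_cdet smooth_f12 smooth_on_const)+
  have k: "smooth_on k \<Omega>" unfolding k_def
    by (intro smooth_on_divide smooth_on_mult smooth_on_const smooth_rho_f smooth_W W_nonzero open_\<Omega>)
  have o1: "smooth_on o1 \<Omega>" and o2: "smooth_on o2 \<Omega>" unfolding o1_def o2_def
    by (intro smooth_on_form open_\<Omega> smooth_f smooth_f12 smooth_on_const f_in_Y; assumption)+
  have S0: "smooth_on S0 \<Omega>" unfolding S0_def
    by (intro smooth_on_diff smooth_on_divide smooth_on_mult smooth_W W_nonzero smooth_\<mu> smooth_Dom open_\<Omega>
       smooth_on_compose[OF smooth_on_derivative[OF smooth_on_rho] open_Y open_\<Omega> smooth_f f_in_Y])
  have S1: "smooth_on S1 \<Omega>" and S2: "smooth_on S2 \<Omega>"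
    unfolding S1_def S2_def by (intro smooth_on_mult smooth_\<mu> o1 o2 open_\<Omega>)+
  have N: "smooth_on N \<Omega>"
    unfolding N_def cmod_power2 by (intro smooth_on_add smooth_on_power smooth_on_Re smooth_on_Im smooth_on_cdet smooth_f12 open_\<Omega>)
  let ?R1 = "\<lambda>x. k x * Re (w x * d1 x)" and ?R2 = "\<lambda>x. k x * Re (w x * d2 x)"
  have R: "smooth_on ?R1 \<Omega>" "smooth_on ?R2 \<Omega>" by (intro smooth_on_mult smooth_on_Re k w d1 d2 open_\<Omega>)+
  let ?P0 = "\<lambda>x. Dom e x + N x * S0 x" and ?P1 = "\<lambda>x. o1 x + (?R1 x - N x * S1 x)" and ?P2 = "\<lambda>x. o2 x + (?R2 x - N x * S2 x)"
  have eq: "?P0 x = dir_deriv e1 ?P1 x + dir_deriv e2 ?P2 x" if "x \<in> \<Omega>" for x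
  proof (rule fundamental_lemma[OF open_\<Omega> _ _ _ _ that])
    show "smooth_on ?P0 \<Omega>" "smooth_on ?P1 \<Omega>" "smooth_on ?P2 \<Omega>"
      by (intro smooth_on_add smooth_on_diff smooth_on_mult smooth_Dom N S0 S1 S2 R o1 o2 open_\<Omega>)+
    fix y :: "real^2" and s :: real and \<eta> :: "real^2 \<Rightarrow> real"
    assume s: "s > 0" "cube y s \<subseteq> \<Omega>" "smooth_on \<eta> UNIV" and \<eta>0: "\<And>x. x \<notin> cube y s \<Longrightarrow> \<eta> x = 0"
    show "integral (cube y s) (\<lambda>x. \<eta> x * ?P0 x + dir_deriv e1 \<eta> x * ?P1 x + dir_deriv e2 \<eta> x * ?P2 x) = 0"
      unfolding w_def d1_def d2_def k_def o1_def o2_def S0_def S1_def S2_def N_def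
      by (rule first_variation[OF s \<eta>0])
  qed
  define G where "G = (\<lambda>x. (cnj (w x) * of_real (S0 x) - (of_real (dir_deriv e1 k x) * d1 x + of_real (dir_deriv e2 k x) * d2 x)
      + 2 * cnj (dir_deriv e1 w x) * of_real (S1 x) + 2 * cnj (dir_deriv e2 w x) * of_real (S2 x)
      + cnj (w x) * of_real (dir_deriv e1 S1 x + dir_deriv e2 S2 x)) / of_real (k x))"
  show ?thesis
  proof (rule that[of G])
    have "k x \<noteq> 0" if "x \<in> \<Omega>" for x using W_nonzero[OF that] rho_pos[OF f_in_Y[OF that]] by (simp add: k_def)
    then show "continuous_on \<Omega> G" unfolding G_def
      by (intro continuous_intros smooth_on_continuous w k d1 d2 S0 S1 S2 smooth_on_derivative) auto
    fix x assume x: "x \<in> \<Omega>"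
    have k0: "k x > 0" using symplectic[OF x] rho_pos[OF f_in_Y[OF x]] by (simp add: k_def)
    have dP: "dir_deriv v (\<lambda>x. p x + (k x * Re (w x * d x) - N x * S x)) x =
      dir_deriv v p x + (dir_deriv v k x * Re (w x * d x) + k x * Re (dir_deriv v w x * d x) + k x * Re (w x * dir_deriv v d x))
      - (N x * dir_deriv v S x + dir_deriv v N x * S x)"
      if "smooth_on p \<Omega>" "smooth_on d \<Omega>" "smooth_on S \<Omega>" for v p d S
    proof -
      have "smooth_on (\<lambda>x. k x * Re (w x * d x)) \<Omega>" "smooth_on (\<lambda>x. N x * S x) \<Omega>"
        by (intro smooth_on_mult smooth_on_Re k w that N open_\<Omega>)+
      note h = this[THEN smooth_on_has_derivative[OF _ x]]
      have "((\<lambda>x. p x + (k x * Re (w x * d x) - N x * S x)) has_derivative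
        (\<lambda>v. dir_deriv v p x + (dir_deriv v (\<lambda>x. k x * Re (w x * d x)) x - dir_deriv v (\<lambda>x. N x * S x) x))) (at x)"
        by (intro has_derivative_add has_derivative_diff smooth_on_has_derivative[OF that(1) x] h)
      from fun_cong[OF frechet_derivative_at[OF this, symmetric], of v] show ?thesis
        unfolding dir_deriv_Re_mult3[OF k w that(2) x] dir_deriv_real_mult[OF N that(3) x] by simp
    qed
    have dN: "dir_deriv v N x = 2 * Re (w x * cnj (dir_deriv v w x))" for v
    proof -
      have D: "((\<lambda>x. (Re (w x))\<^sup>2 + (Im (w x))\<^sup>2) has_derivative (\<lambda>v. 2 * Re (w x) * Re (frechet_derivative w (at x) v) + 2 * Im (w x) * Im (frechet_derivative w (at x) v))) (at x)"
        using smooth_on_has_derivative[OF w x] by (auto intro!: derivative_eq_intros)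
      have N_eq: "N = (\<lambda>x. (Re (w x))\<^sup>2 + (Im (w x))\<^sup>2)" by (auto simp: N_def w_def cmod_power2)
      show ?thesis unfolding N_eq frechet_derivative_at[OF D, symmetric] by simp
    qed
    \<comment> \<open>The second derivatives of \<open>f\<close> not contained in the derivatives of
      \<open>w\<close>: both are the mixed derivative, placed in opposite slots of
      \<open>cdet\<close>.\<close>
    have cancel: "dir_deriv e1 d1 x + dir_deriv e2 d2 x = 0"
    proof -
      have "(d1 has_derivative (\<lambda>v. cdet e (frechet_derivative f2 (at x) v))) (at x)" unfolding d1_def
        by (rule bounded_linear.has_derivative[OF bounded_linear_cdet(1) smooth_on_has_derivative[OF smooth_f12(2) x]])
      from fun_cong[OF frechet_derivative_at[OF this, symmetric], of e1]
      have 1: "dir_deriv e1 d1 x = cdet e (dir_deriv e1 f2 x)" .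
      have "(d2 has_derivative (\<lambda>v. cdet (frechet_derivative f1 (at x) v) e)) (at x)" unfolding d2_def
        by (rule bounded_linear.has_derivative[OF bounded_linear_cdet(2) smooth_on_has_derivative[OF smooth_f12(1) x]])
      from fun_cong[OF frechet_derivative_at[OF this, symmetric], of e2]
      have 2: "dir_deriv e2 d2 x = cdet (dir_deriv e2 f1 x) e" .
      show ?thesis unfolding 1 2 mixed[OF x] cdet_swap[of e] by simp
    qed
    have "N x = Re (w x * cnj (w x))" unfolding N_def w_def cmod_power2 by (simp add: power2_eq_square)
    moreover have "Re (w x * dir_deriv e1 d1 x) + Re (w x * dir_deriv e2 d2 x) = 0"
      using cancel by (simp only: plus_complex.sel(1)[symmetric] distrib_left[symmetric]) simp
    moreover have "dir_deriv e1 o1 x + dir_deriv e2 o2 x = Dom e x"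
      using Dom_divergence[OF x, of e] by (simp add: o1_def o2_def)
    \<comment> \<open>The rearrangement as an identity of real numbers: \<open>D\<close> cancels
      against \<open>p1 + p2\<close>, and \<open>k * c\<close> against
      \<open>k * c2\<close>.\<close>
    moreover have alg: "k * (b + b2) = n * s0 - k1 * a - k2 * a2 + n * (s1' + s2') + 2 * m1 * s1 + 2 * m2 * s2"
      if "D + n * s0 = (p1 + (k1 * a + k * b + k * c) - (n * s1' + 2 * m1 * s1)) + (p2 + (k2 * a2 + k * b2 + k * c2) - (n * s2' + 2 * m2 * s2))"
        "c + c2 = 0" "p1 + p2 = D" for D n s0 p1 p2 k1 k2 k a a2 b b2 c c2 s1 s2 s1' s2' m1 m2 :: real
    proof -
      have "k * c + k * c2 = 0" using that(2) by (simp add: distrib_left[symmetric])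
      then show ?thesis using that(1,3) by (simp add: algebra_simps)
    qed
    ultimately have "k x * (Re (dir_deriv e1 w x * d1 x) + Re (dir_deriv e2 w x * d2 x)) =
       Re (w x * cnj (w x)) * S0 x - dir_deriv e1 k x * Re (w x * d1 x) - dir_deriv e2 k x * Re (w x * d2 x)
       + Re (w x * cnj (w x)) * (dir_deriv e1 S1 x + dir_deriv e2 S2 x)
       + 2 * Re (w x * cnj (dir_deriv e1 w x)) * S1 x + 2 * Re (w x * cnj (dir_deriv e2 w x)) * S2 x"
      using eq[OF x] unfolding dP[OF o1 d1 S1] dP[OF o2 d2 S2] dN by (intro alg) (simp_all only:)
    also have "\<dots> = Re (w x * (of_real (k x) * G x))"
    proof -
      have kG: "of_real (k x) * G x = cnj (w x) * of_real (S0 x) - (of_real (dir_deriv e1 k x) * d1 x + of_real (dir_deriv e2 k x) * d2 x)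
        + 2 * cnj (dir_deriv e1 w x) * of_real (S1 x) + 2 * cnj (dir_deriv e2 w x) * of_real (S2 x)
        + cnj (w x) * of_real (dir_deriv e1 S1 x + dir_deriv e2 S2 x)"
        using k0 by (simp add: G_def)
      show ?thesis unfolding kG by (simp add: algebra_simps)
    qed
    also have "\<dots> = k x * Re (w x * G x)" by (simp add: algebra_simps)
    finally have "Re (dir_deriv e1 w x * d1 x) + Re (dir_deriv e2 w x * d2 x) = Re (w x * G x)"
      using k0 by simp
    then show "Re (dir_deriv e1 (\<lambda>x. cnj (\<delta> x)) x * cdet e (f2 x) + dir_deriv e2 (\<lambda>x. cnj (\<delta> x)) x * cdet (f1 x) e) = Re (cnj (\<delta> x) * G x)"
      by (simp add: w_def d1_def d2_def)
  qed
qed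


lemma cauchy_riemann_inequality:
  assumes x0: "x0 \<in> \<Omega>"
  obtains V C where "open V" "x0 \<in> V" "V \<subseteq> \<Omega>"
    "\<And>x k. x \<in> V \<Longrightarrow> cmod (f2 x $ k * dir_deriv e1 (\<lambda>x. cnj (\<delta> x)) x - f1 x $ k * dir_deriv e2 (\<lambda>x. cnj (\<delta> x)) x) \<le> C * cmod (cnj (\<delta> x))"
proof -
  let ?w = "\<lambda>x. cnj (\<delta> x)"
  let ?E = "\<lambda>e x. dir_deriv e1 ?w x * cdet e (f2 x) + dir_deriv e2 ?w x * cdet (f1 x) e"
  obtain d where d: "d > 0" "cube x0 d \<subseteq> \<Omega>" using cube_in_open[OF open_\<Omega> x0] .
  have "\<exists>C. \<forall>x\<in>cube x0 d. \<bar>Re (?E e x)\<bar> \<le> C * cmod (?w x)" for e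
  proof -
    obtain G where G: "continuous_on \<Omega> G" "\<And>x. x \<in> \<Omega> \<Longrightarrow> Re (?E e x) = Re (?w x * G x)"
      by (rule euler_lagrange_weak_form[of e]) blast
    have "bounded (G ` cube x0 d)"
      using continuous_on_subset[OF G(1) d(2)] compact_cube by (intro compact_imp_bounded compact_continuous_image)
    then obtain C where C: "\<And>x. x \<in> cube x0 d \<Longrightarrow> cmod (G x) \<le> C" by (auto simp: bounded_iff)
    have "\<bar>Re (?E e x)\<bar> \<le> C * cmod (?w x)" if "x \<in> cube x0 d" for x
    proof -
      have "\<bar>Re (?E e x)\<bar> \<le> cmod (?w x * G x)" using G(2)[of x] that d(2) abs_Re_le_cmod[of "?w x * G x"] by auto
      also have "\<dots> \<le> cmod (?w x) * C" unfolding norm_mult using C[OF that] by (rule mult_left_mono) simp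
      finally show ?thesis by (simp add: mult.commute)
    qed
    then show ?thesis by blast
  qed
  then have "\<forall>e. \<exists>C. \<forall>x\<in>cube x0 d. \<bar>Re (?E e x)\<bar> \<le> C * cmod (?w x)" by (rule allI)
  from choice[OF this] obtain C where "\<forall>e. \<forall>x\<in>cube x0 d. \<bar>Re (?E e x)\<bar> \<le> C e * cmod (?w x)" ..
  then have C: "\<bar>Re (?E e x)\<bar> \<le> C e * cmod (?w x)" if "x \<in> cube x0 d" for e x using that by (elim allE ballE) auto
  let ?T = "\<lambda>k x. f2 x $ k * dir_deriv e1 ?w x - f1 x $ k * dir_deriv e2 ?w x"
  \<comment> \<open>For \<open>z1\<close> and \<open>J z1\<close> the left-hand sides are
    \<open>?T 2\<close> and \<i> times it, so their real parts bound both parts of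
    \<open>?T 2\<close>; \<open>z2\<close> and \<open>J z2\<close> do the same for
    \<open>?T 1\<close>, up to sign.\<close>
  have E: "?E z1 x = ?T 2 x" "?E (J z1) x = \<i> * ?T 2 x" "?E z2 x = - ?T 1 x" "?E (J z2) x = - \<i> * ?T 1 x" for x
    by (simp_all add: cdet_def axis_def algebra_simps)
  let ?C = "\<bar>C z1\<bar> + \<bar>C (J z1)\<bar> + \<bar>C z2\<bar> + \<bar>C (J z2)\<bar>"
  show ?thesis
  proof (rule that[of "ball x0 d" ?C])
    show "ball x0 d \<subseteq> \<Omega>" using d ball_subset_cube by blast
    fix x and k :: 2 assume "x \<in> ball x0 d"
    then have x: "x \<in> cube x0 d" using ball_subset_cube by blast
    have "cmod (?T k x) \<le> \<bar>Re (?T k x)\<bar> + \<bar>Im (?T k x)\<bar>" by (rule cmod_le)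
    also have "\<dots> \<le> ?C * cmod (?w x)"
    proof (cases "k = 1")
      case True
      have "\<bar>Re (?T 1 x)\<bar> + \<bar>Im (?T 1 x)\<bar> \<le> C z2 * cmod (?w x) + C (J z2) * cmod (?w x)"
        using C[OF x, of z2] C[OF x, of "J z2"] unfolding E by (simp del: complex_mod_cnj)
      also have "\<dots> = (C z2 + C (J z2)) * cmod (?w x)" by (simp add: distrib_right)
      also have "\<dots> \<le> ?C * cmod (?w x)" by (intro mult_right_mono) auto
      finally show ?thesis using True by simp
    next
      case False
      then have k: "k = 2" using exhaust_2[of k] by auto
      have "\<bar>Re (?T 2 x)\<bar> + \<bar>Im (?T 2 x)\<bar> \<le> C z1 * cmod (?w x) + C (J z1) * cmod (?w x)"
        using C[OF x, of z1] C[OF x, of "J z1"] unfolding E by (simp del: complex_mod_cnj)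
      also have "\<dots> = (C z1 + C (J z1)) * cmod (?w x)" by (simp add: distrib_right)
      also have "\<dots> \<le> ?C * cmod (?w x)" by (intro mult_right_mono) auto
      finally show ?thesis using k by simp
    qed
    finally show "cmod (?T k x) \<le> ?C * cmod (?w x)" .
  qed (use d in auto)
qed

theorem complex_points_isolated_or_open:
  assumes x0: "x0 \<in> \<Omega>"
  shows "(\<forall>\<^sub>F x in nhds x0. \<delta> x = 0) \<or> (\<forall>\<^sub>F x in at x0. \<delta> x \<noteq> 0)"
proof (cases "\<delta> x0 = 0")
  case False
  have "(\<delta> \<longlongrightarrow> \<delta> x0) (nhds x0)" by (rule smooth_on_tendsto[OF smooth_on_cdet[OF smooth_f12] open_\<Omega> x0])
  then have "\<forall>\<^sub>F x in nhds x0. \<delta> x \<noteq> 0" using False by (rule tendsto_imp_eventually_ne)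
  then show ?thesis by (simp add: eventually_nhds_conv_at)
next
  case True
  interpret hermitian_form "\<omega> (f x0)" by (rule hermitian[OF f_in_Y[OF x0]])
  obtain k where k: "Im (f2 x0 $ k * cnj (f1 x0 $ k)) \<noteq> 0"
    using transversal_component[OF W_nonzero[OF x0] True] by blast
  obtain V C where V: "open V" "x0 \<in> V" "V \<subseteq> \<Omega>"
    and C: "\<And>x k. x \<in> V \<Longrightarrow> cmod (f2 x $ k * dir_deriv e1 (\<lambda>x. cnj (\<delta> x)) x - f1 x $ k * dir_deriv e2 (\<lambda>x. cnj (\<delta> x)) x) \<le> C * cmod (cnj (\<delta> x))"
    by (rule cauchy_riemann_inequality[OF x0]) blast
  have sz: "smooth_on (\<lambda>x. f x $ k) V"
    by (intro smooth_on_vec_nth smooth_on_subset[OF smooth_f V(3)] V)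
  have sw: "smooth_on (\<lambda>x. cnj (\<delta> x)) V"
    by (rule smooth_on_subset[OF smooth_on_cnj[OF open_\<Omega> smooth_on_cdet[OF smooth_f12]] V(3)])
  have dz: "dir_deriv v (\<lambda>x. f x $ k) x = dir_deriv v f x $ k" if "x \<in> V" for v x
  proof -
    have "((\<lambda>x. f x $ k) has_derivative (\<lambda>v. dir_deriv v f x $ k)) (at x)"
      using that V(3) by (intro bounded_linear.has_derivative[OF bounded_linear_vec_nth] smooth_on_has_derivative[OF smooth_f]) blast
    from fun_cong[OF frechet_derivative_at[OF this, symmetric]] show ?thesis by simp
  qed
  have "(\<forall>\<^sub>F x in nhds x0. cnj (\<delta> x) = 0) \<or> (\<forall>\<^sub>F x in at x0. cnj (\<delta> x) \<noteq> 0)"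
    by (rule zeros_isolated_or_locally_zero[OF V(1,2) sw sz, of C]) (use k C in \<open>simp_all add: dz V\<close>)
  then show ?thesis by simp
qed

end

section \<open>Charts\<close>

abbreviation chart_inv :: "('a, 'e) chart \<Rightarrow> 'e \<Rightarrow> 'a" where
  "chart_inv a \<equiv> inv_into (fst a) (snd a)"

lemma chart_facts:
  assumes "is_chart a"
  shows chart_inj: "inj_on (snd a) (fst a)"
    and chart_continuous: "continuous_on (fst a) (snd a)"
    and chart_inv_continuous: "continuous_on (snd a ` fst a) (chart_inv a)"
    and open_chart: "open (fst a)" "open (snd a ` fst a)"
proof -
  obtain \<psi> where \<psi>: "homeomorphism (fst a) (snd a ` fst a) (snd a) \<psi>"
    using assms by (auto simp: is_chart_def)
  show inj: "inj_on (snd a) (fst a)" using \<psi> by (metis homeomorphism_def inj_on_inverseI)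
  show "continuous_on (fst a) (snd a)" using \<psi> by (simp add: homeomorphism_def)
  have "chart_inv a x = \<psi> x" if x: "x \<in> snd a ` fst a" for x
  proof -
    from x obtain p where p: "p \<in> fst a" "x = snd a p" by blast
    then show ?thesis using \<psi> inj by (simp add: homeomorphism_def)
  qed
  moreover have "continuous_on (snd a ` fst a) \<psi>" using \<psi> by (simp add: homeomorphism_def)
  ultimately show "continuous_on (snd a ` fst a) (chart_inv a)" by (simp cong: continuous_on_cong)
  show "open (fst a)" "open (snd a ` fst a)" using assms by (auto simp: is_chart_def)
qed

lemma chart_inv_chart: "is_chart a \<Longrightarrow> p \<in> fst a \<Longrightarrow> chart_inv a (snd a p) = p"
  by (rule inv_into_f_f[OF chart_inj])

lemma chart_chart_inv: "x \<in> snd a ` fst a \<Longrightarrow> snd a (chart_inv a x) = x"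
  by (rule f_inv_into_f)

lemma chart_inv_in: "x \<in> snd a ` fst a \<Longrightarrow> chart_inv a x \<in> fst a"
  by (rule inv_into_into)

text \<open>Writing an image under a chart as a preimage under its inverse gives openness, and later
  Borel measurability, of such images.\<close>

lemma chart_image_eq:
  assumes "is_chart a" "V \<subseteq> fst a"
  shows "snd a ` V = snd a ` fst a \<inter> chart_inv a -` V"
proof
  show "snd a ` V \<subseteq> snd a ` fst a \<inter> chart_inv a -` V"
    using assms(2) by (auto simp: chart_inv_chart[OF assms(1)] subset_iff)
  show "snd a ` fst a \<inter> chart_inv a -` V \<subseteq> snd a ` V"
  proof
    fix x assume "x \<in> snd a ` fst a \<inter> chart_inv a -` V"
    then have "x = snd a (chart_inv a x)" "chart_inv a x \<in> V" by (simp_all add: chart_chart_inv)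
    then show "x \<in> snd a ` V" by (rule image_eqI)
  qed
qed

lemma open_chart_image:
  assumes "is_chart a" "V \<subseteq> fst a" "open V"
  shows "open (snd a ` V)"
  unfolding chart_image_eq[OF assms(1,2)]
  by (rule continuous_open_preimage[OF chart_inv_continuous[OF assms(1)] open_chart(2)[OF assms(1)] assms(3)])

lemma mem_local_dom:
  assumes "is_chart a"
  shows "x \<in> local_dom a c F \<longleftrightarrow> x \<in> snd a ` fst a \<and> F (chart_inv a x) \<in> fst c"
  unfolding local_dom_def by (subst chart_image_eq[OF assms]) (auto simp: chart_inv_in)

lemma chart_in_local_dom: "p \<in> fst a \<Longrightarrow> F p \<in> fst c \<Longrightarrow> snd a p \<in> local_dom a c F"
  by (auto simp: local_dom_def)

lemma open_local_dom:
  assumes "is_chart a" "is_chart c" "continuous_on UNIV F"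
  shows "open (local_dom a c F)"
  unfolding local_dom_def
  by (intro open_chart_image assms open_Int open_chart open_vimage) auto

lemma local_rep_apply: "local_rep a c F x = snd c (F (chart_inv a x))"
  by (simp add: local_rep_def)

lemma local_rep_chart: "is_chart a \<Longrightarrow> p \<in> fst a \<Longrightarrow> local_rep a c F (snd a p) = snd c (F p)"
  by (simp add: local_rep_apply chart_inv_chart)

lemma local_rep_cong:
  assumes "is_chart a" "open V" "p \<in> fst a" "p \<in> V" "\<And>q. q \<in> V \<Longrightarrow> G q = F q"
  shows "local_rep a c G (snd a p) = local_rep a c F (snd a p)" "local_deriv a c G (snd a p) = local_deriv a c F (snd a p)"
proof -
  let ?U = "snd a ` (fst a \<inter> V)"
  have U: "open ?U" using assms by (intro open_chart_image open_Int open_chart) auto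
  have r: "local_rep a c G x = local_rep a c F x" if x: "x \<in> ?U" for x
  proof -
    obtain q where "x = snd a q" "q \<in> fst a" "q \<in> V" using x by blast
    then show ?thesis using assms by (simp add: local_rep_chart)
  qed
  have pU: "snd a p \<in> ?U" using assms by blast
  show "local_rep a c G (snd a p) = local_rep a c F (snd a p)" by (rule r[OF pU])
  show "local_deriv a c G (snd a p) = local_deriv a c F (snd a p)" by (rule frechet_derivative_cong[OF U r pU])
qed

lemma det_matrix_2:
  fixes L :: "real^2 \<Rightarrow> real^2"
  shows "det (matrix L) = L e1 $ 1 * L e2 $ 2 - L e2 $ 1 * L e1 $ 2"
  by (simp add: det_2 matrix_def)

lemma alternating_pullback:
  fixes h :: "real^2 \<Rightarrow> real^2 \<Rightarrow> real"
  assumes "bilinear h" "\<And>u. h u u = 0" "bounded_linear L"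
  shows "h (L e1) (L e2) = det (matrix L) * h e1 e2"
proof -
  note s = bilinear_ladd[OF assms(1)] bilinear_radd[OF assms(1)] bilinear_lmul[OF assms(1)] bilinear_rmul[OF assms(1)]
  have "h (e1 + e2) (e1 + e2) = 0" by (rule assms)
  then have sw: "h e2 e1 = - h e1 e2" unfolding s unfolding assms(2) by simp
  have ex: "v = v $ 1 *\<^sub>R e1 + v $ 2 *\<^sub>R e2" for v :: "real^2"
    by (simp add: vec_eq_iff forall_2 axis_def)
  have "h (L e1) (L e2) = h (L e1 $ 1 *\<^sub>R e1 + L e1 $ 2 *\<^sub>R e2) (L e2 $ 1 *\<^sub>R e1 + L e2 $ 2 *\<^sub>R e2)"
    using ex[of "L e1"] ex[of "L e2"] by simp
  then show ?thesis unfolding s assms(2) sw det_matrix_2 by (simp add: algebra_simps)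
qed

lemma gram_pullback:
  fixes g :: "real^2 \<Rightarrow> real^2 \<Rightarrow> real"
  assumes "bilinear g" "bounded_linear L"
  shows "g (L e1) (L e1) * g (L e2) (L e2) - g (L e1) (L e2) * g (L e2) (L e1)
    = (det (matrix L))\<^sup>2 * (g e1 e1 * g e2 e2 - g e1 e2 * g e2 e1)"
proof -
  note s = bilinear_ladd[OF assms(1)] bilinear_radd[OF assms(1)] bilinear_lmul[OF assms(1)] bilinear_rmul[OF assms(1)]
  have ex: "v = v $ 1 *\<^sub>R e1 + v $ 2 *\<^sub>R e2" for v :: "real^2"
    by (simp add: vec_eq_iff forall_2 axis_def)
  have *: "g (L u) (L v) = g (L u $ 1 *\<^sub>R e1 + L u $ 2 *\<^sub>R e2) (L v $ 1 *\<^sub>R e1 + L v $ 2 *\<^sub>R e2)" for u v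
    using ex[of "L u"] ex[of "L v"] by simp
  show ?thesis
    unfolding * s det_matrix_2 by (simp add: power2_eq_square algebra_simps)
qed

section \<open>Chart independence of the induced metric and of the Kaehler angle\<close>

lemma kaehler_chartI:
  assumes "kaehler_surface B \<omega>" "c \<in> B"
  shows "kaehler_chart (snd c ` fst c) (\<omega> c)"
proof -
  have "is_chart c" using assms by (auto simp: kaehler_surface_def complex_surface_def smooth_atlas_def)
  then have "open (snd c ` fst c)" by (rule open_chart)
  then show ?thesis
    using assms unfolding kaehler_surface_def differential_form2_def closed_form2_def
    by unfold_locales auto
qed

text \<open>Only smoothness of \<open>F\<close> is assumed, because for the members of a variation
  it is a conclusion that they are immersed and symplectic.\<close>

locale surface_map =
  fixes A :: "('s::{t2_space,second_countable_topology}, real^2) chart set"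
    and B :: "('m::{t2_space,second_countable_topology}, complex^2) chart set"
    and \<omega> :: "'m form2" and F :: "'s \<Rightarrow> 'm"
  assumes kaehler: "kaehler_surface B \<omega>" and surface: "closed_oriented_surface A" and smooth_F: "smooth_map A B F"
begin

lemma chart_A: "a \<in> A \<Longrightarrow> is_chart a" and chart_B: "c \<in> B \<Longrightarrow> is_chart c"
  using surface kaehler by (auto simp: closed_oriented_surface_def kaehler_surface_def complex_surface_def smooth_atlas_def)

lemma ex_chart_A: "\<exists>a\<in>A. p \<in> fst a" and ex_chart_B: "\<exists>c\<in>B. q \<in> fst c"
proof -
  have "\<Union>(fst ` A) = UNIV" "\<Union>(fst ` B) = UNIV"
    using surface kaehler by (auto simp: closed_oriented_surface_def kaehler_surface_def complex_surface_def smooth_atlas_def)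
  then show "\<exists>a\<in>A. p \<in> fst a" "\<exists>c\<in>B. q \<in> fst c" by auto
qed

lemma continuous_F: "continuous_on UNIV F"
  using smooth_F by (simp add: smooth_map_def)

lemma open_dom: "a \<in> A \<Longrightarrow> c \<in> B \<Longrightarrow> open (local_dom a c F)"
  by (intro open_local_dom chart_A chart_B continuous_F)

lemma smooth_rep: "a \<in> A \<Longrightarrow> c \<in> B \<Longrightarrow> smooth_on (local_rep a c F) (local_dom a c F)"
  using smooth_F by (simp add: smooth_map_def)

lemma rep_in: "a \<in> A \<Longrightarrow> x \<in> local_dom a c F \<Longrightarrow> local_rep a c F x \<in> snd c ` fst c"
  by (simp add: mem_local_dom chart_A local_rep_apply)

lemma transition_A:
  assumes "a \<in> A" "a' \<in> A"
  shows "smooth_on (local_rep a a' id) (local_dom a a' id)" "open (local_dom a a' id)"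
    "x \<in> local_dom a a' id \<Longrightarrow> det (matrix (local_deriv a a' id x)) > 0"
  using surface assms open_local_dom[OF chart_A chart_A] by (auto simp: closed_oriented_surface_def smooth_atlas_def)

lemma transition_B:
  assumes "c \<in> B" "c' \<in> B"
  shows "smooth_on (local_rep c c' id) (local_dom c c' id)" "open (local_dom c c' id)"
    "x \<in> local_dom c c' id \<Longrightarrow> local_deriv c c' id x (J v) = J (local_deriv c c' id x v)"
    "x \<in> local_dom c c' id \<Longrightarrow> \<omega> c' (local_rep c c' id x) (local_deriv c c' id x u) (local_deriv c c' id x v) = \<omega> c x u v"
  using kaehler assms open_local_dom[OF chart_B chart_B]
  by (auto simp: kaehler_surface_def complex_surface_def smooth_atlas_def differential_form2_def)

lemma hermitian_at: "a \<in> A \<Longrightarrow> c \<in> B \<Longrightarrow> x \<in> local_dom a c F \<Longrightarrow> hermitian_form (\<omega> c (local_rep a c F x))"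
  using kaehler_chart.hermitian[OF kaehler_chartI[OF kaehler]] rep_in by blast

lemma linear_deriv: "a \<in> A \<Longrightarrow> c \<in> B \<Longrightarrow> x \<in> local_dom a c F \<Longrightarrow> bounded_linear (local_deriv a c F x)"
  using has_derivative_bounded_linear[OF smooth_on_has_derivative[OF smooth_rep]] .

lemma
  assumes a: "a \<in> A" "a' \<in> A" and c: "c \<in> B" "c' \<in> B" and p: "p \<in> fst a" "p \<in> fst a'" "F p \<in> fst c" "F p \<in> fst c'"
  shows pullback_transform: "pullback_form \<omega> a c F (snd a p) u v =
      pullback_form \<omega> a' c' F (snd a' p) (local_deriv a a' id (snd a p) u) (local_deriv a a' id (snd a p) v)"
    and metric_transform: "induced_metric \<omega> a c F (snd a p) u v =
      induced_metric \<omega> a' c' F (snd a' p) (local_deriv a a' id (snd a p) u) (local_deriv a a' id (snd a p) v)"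
proof -
  let ?\<tau> = "local_rep a a' id" and ?\<sigma> = "local_rep c' c id"
  let ?f = "local_rep a c F" and ?f' = "local_rep a' c' F"
  let ?x = "snd a p"
  \<comment> \<open>The coordinates of the points covered by all four charts; there
    \<open>?f\<close> is the composition of \<open>?\<tau>\<close>, \<open>?f'\<close> and
    \<open>?\<sigma>\<close>.\<close>
  define U where "U = snd a ` (fst a \<inter> fst a' \<inter> F -` fst c \<inter> F -` fst c')"
  have U: "open U" unfolding U_def
    by (intro open_chart_image chart_A a open_Int open_chart open_vimage chart_B c continuous_F) auto
  have xU: "?x \<in> U" using p by (auto simp: U_def)
  have \<tau>x: "?\<tau> ?x = snd a' p" using p by (simp add: local_rep_chart chart_A a)
  have f'x: "?f' (snd a' p) = snd c' (F p)" using p by (simp add: local_rep_chart chart_A a)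
  have fx: "?f ?x = snd c (F p)" using p by (simp add: local_rep_chart chart_A a)
  have \<sigma>x: "?\<sigma> (snd c' (F p)) = snd c (F p)" using p by (simp add: local_rep_chart chart_B c)
  have dom: "?x \<in> local_dom a a' id" "snd a' p \<in> local_dom a' c' F" "snd c' (F p) \<in> local_dom c' c id"
    using p by (auto intro!: chart_in_local_dom)
  have d\<tau>: "(?\<tau> has_derivative local_deriv a a' id ?x) (at ?x)"
    by (rule smooth_on_has_derivative[OF transition_A(1)[OF a] dom(1)])
  have df': "(?f' has_derivative local_deriv a' c' F (snd a' p)) (at (?\<tau> ?x))"
    unfolding \<tau>x by (rule smooth_on_has_derivative[OF smooth_rep[OF a(2) c(2)] dom(2)])
  have d\<sigma>: "(?\<sigma> has_derivative local_deriv c' c id (snd c' (F p))) (at (?f' (?\<tau> ?x)))"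
    unfolding \<tau>x f'x by (rule smooth_on_has_derivative[OF transition_B(1)[OF c(2,1)] dom(3)])
  have 1: "((\<lambda>x. ?\<sigma> (?f' (?\<tau> x))) has_derivative
      (\<lambda>v. local_deriv c' c id (snd c' (F p)) (local_deriv a' c' F (snd a' p) (local_deriv a a' id ?x v)))) (at ?x)"
    using has_derivative_compose[OF has_derivative_compose[OF d\<tau> df'] d\<sigma>] .
  have "(?f has_derivative
      (\<lambda>v. local_deriv c' c id (snd c' (F p)) (local_deriv a' c' F (snd a' p) (local_deriv a a' id ?x v)))) (at ?x)"
  proof (rule has_derivative_transform_within_open[OF 1 U xU])
    fix y assume "y \<in> U"
    then obtain q where q: "y = snd a q" "q \<in> fst a" "q \<in> fst a'" "F q \<in> fst c" "F q \<in> fst c'" by (auto simp: U_def)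
    then show "?\<sigma> (?f' (?\<tau> y)) = ?f y" by (simp add: local_rep_chart chart_A chart_B a c)
  qed
  from frechet_derivative_at[OF this, symmetric]
  have D: "local_deriv a c F ?x v = local_deriv c' c id (snd c' (F p)) (local_deriv a' c' F (snd a' p) (local_deriv a a' id ?x v))" for v
    by simp
  show "pullback_form \<omega> a c F ?x u v = pullback_form \<omega> a' c' F (snd a' p) (local_deriv a a' id ?x u) (local_deriv a a' id ?x v)"
    unfolding pullback_form_def D fx f'x using transition_B(4)[OF c(2,1) dom(3)] \<sigma>x by simp
  show "induced_metric \<omega> a c F ?x u v = induced_metric \<omega> a' c' F (snd a' p) (local_deriv a a' id ?x u) (local_deriv a a' id ?x v)"
    unfolding induced_metric_def D fx f'x transition_B(3)[OF c(2,1) dom(3), symmetric]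
    using transition_B(4)[OF c(2,1) dom(3)] \<sigma>x by simp
qed

abbreviation W where "W a c x \<equiv> pullback_form \<omega> a c F x e1 e2"
abbreviation D where "D a c x \<equiv> area_density \<omega> a c F x"

lemma bilinear_pullback:
  assumes "a \<in> A" "c \<in> B" "x \<in> local_dom a c F"
  shows "bilinear (pullback_form \<omega> a c F x)" "bilinear (induced_metric \<omega> a c F x)" "pullback_form \<omega> a c F x u u = 0"
proof -
  interpret hermitian_form "\<omega> c (local_rep a c F x)" by (rule hermitian_at[OF assms])
  interpret L: linear "local_deriv a c F x" using linear_deriv[OF assms] by (rule bounded_linear.linear)
  show "bilinear (pullback_form \<omega> a c F x)" "bilinear (induced_metric \<omega> a c F x)"
    unfolding bilinear_def linear_iff pullback_form_def induced_metric_def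
    by (simp_all add: L.add L.scale h_simps J_add J_scaleR)
  show "pullback_form \<omega> a c F x u u = 0" by (simp add: pullback_form_def alt)
qed

lemma D_square_gram:
  assumes "a \<in> A" "c \<in> B" "x \<in> local_dom a c F"
  defines "u \<equiv> local_deriv a c F x e1" and "v \<equiv> local_deriv a c F x e2" and "h \<equiv> \<omega> c (local_rep a c F x)"
  shows "(D a c x)\<^sup>2 = h u (J u) * h v (J v) - h u (J v) * h v (J u)"
    and "(D a c x)\<^sup>2 = (W a c x)\<^sup>2 + hermitian_form.gram h * (cmod (cdet u v))\<^sup>2"
    and "D a c x \<ge> 0" "\<bar>W a c x\<bar> \<le> D a c x"
proof -
  interpret hermitian_form h unfolding h_def by (rule hermitian_at[OF assms(1-3)])
  have W: "W a c x = h u v" by (simp add: pullback_form_def u_def v_def h_def)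
  have D: "D a c x = sqrt (h u (J u) * h v (J v) - h u (J v) * h v (J u))"
    by (simp add: area_density_def induced_metric_def u_def v_def h_def Let_def)
  have nn: "(h u v)\<^sup>2 + gram * (cmod (cdet u v))\<^sup>2 \<ge> 0" using gram_pos by (intro add_nonneg_nonneg mult_nonneg_nonneg) auto
  show 1: "(D a c x)\<^sup>2 = h u (J u) * h v (J v) - h u (J v) * h v (J u)"
    unfolding D gram_identity using nn by simp
  show 2: "(D a c x)\<^sup>2 = (W a c x)\<^sup>2 + gram * (cmod (cdet u v))\<^sup>2"
    unfolding 1 gram_identity W ..
  show 3: "D a c x \<ge> 0" unfolding D gram_identity using nn by simp
  have "(W a c x)\<^sup>2 \<le> (D a c x)\<^sup>2" unfolding 2 using gram_pos by simp
  then show "\<bar>W a c x\<bar> \<le> D a c x" using 3 abs_le_square_iff[of "W a c x" "D a c x"] by simp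
qed

lemma
  assumes a: "a \<in> A" "a' \<in> A" and c: "c \<in> B" "c' \<in> B" and p: "p \<in> fst a" "p \<in> fst a'" "F p \<in> fst c" "F p \<in> fst c'"
  shows W_transform: "W a c (snd a p) = det (matrix (local_deriv a a' id (snd a p))) * W a' c' (snd a' p)"
    and D_transform: "D a c (snd a p) = det (matrix (local_deriv a a' id (snd a p))) * D a' c' (snd a' p)"
proof -
  let ?L = "local_deriv a a' id (snd a p)"
  have dom: "snd a p \<in> local_dom a a' id" "snd a' p \<in> local_dom a' c' F"
    using p by (auto intro!: chart_in_local_dom)
  have L: "bounded_linear ?L"
    by (rule has_derivative_bounded_linear[OF smooth_on_has_derivative[OF transition_A(1)[OF a] dom(1)]])
  note b = bilinear_pullback[OF a(2) c(2) dom(2)]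
  show "W a c (snd a p) = det (matrix ?L) * W a' c' (snd a' p)"
    unfolding pullback_transform[OF a c p] by (rule alternating_pullback[OF b(1,3) L])
  \<comment> \<open>Orientation enters here: \<open>sqrt\<close> yields the absolute value of the
    determinant, while \<open>W\<close> scales with the determinant itself, so positivity makes
    \<open>W / D\<close> independent of the chart.\<close>
  have "det (matrix ?L) > 0" by (rule transition_A(3)[OF a dom(1)])
  then show "D a c (snd a p) = det (matrix ?L) * D a' c' (snd a' p)"
    unfolding area_density_def Let_def metric_transform[OF a c p] gram_pullback[OF b(2) L] real_sqrt_mult by simp
qed

lemma kaehler_angle_eq:
  assumes a: "a \<in> A" and c: "c \<in> B" and p: "p \<in> fst a" "F p \<in> fst c" and D: "D a c (snd a p) > 0"
  shows "kaehler_angle A B \<omega> F p = arccos (W a c (snd a p) / D a c (snd a p))"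
proof -
  let ?r = "W a c (snd a p) / D a c (snd a p)"
  have x: "snd a p \<in> local_dom a c F" using p by (rule chart_in_local_dom)
  have r: "-1 \<le> ?r" "?r \<le> 1"
    using D_square_gram(4)[OF a c x] D by (auto simp: le_divide_eq divide_le_eq)
  have eq: "pullback_form \<omega> a' c' F (snd a' p) e1 e2 = ?r * D a' c' (snd a' p)"
    if "a' \<in> A" "c' \<in> B" "p \<in> fst a'" "F p \<in> fst c'" for a' c'
    using W_transform[OF that(1) a that(2) c that(3) p(1) that(4) p(2)]
      D_transform[OF that(1) a that(2) c that(3) p(1) that(4) p(2)] D by simp
  show ?thesis unfolding kaehler_angle_def
  proof (rule the_equality)
    show "0 \<le> arccos ?r \<and> arccos ?r \<le> pi \<and> (\<forall>a\<in>A. \<forall>c\<in>B. p \<in> fst a \<longrightarrow> F p \<in> fst c \<longrightarrow>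
        pullback_form \<omega> a c F (snd a p) e1 e2 = cos (arccos ?r) * area_density \<omega> a c F (snd a p))"
      using arccos[OF r] eq by simp
  next
    fix \<alpha> assume \<alpha>: "0 \<le> \<alpha> \<and> \<alpha> \<le> pi \<and> (\<forall>a\<in>A. \<forall>c\<in>B. p \<in> fst a \<longrightarrow> F p \<in> fst c \<longrightarrow>
        pullback_form \<omega> a c F (snd a p) e1 e2 = cos \<alpha> * area_density \<omega> a c F (snd a p))"
    then have "W a c (snd a p) = cos \<alpha> * D a c (snd a p)" using a c p by blast
    then have "?r = cos \<alpha>" using D by simp
    then show "\<alpha> = arccos ?r" using \<alpha> by (simp add: arccos_cos)
  qed
qed

lemma cos_kaehler_angle:
  assumes "a \<in> A" "c \<in> B" "p \<in> fst a" "F p \<in> fst c" "D a c (snd a p) > 0"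
  shows "cos (kaehler_angle A B \<omega> F p) = W a c (snd a p) / D a c (snd a p)"
  using kaehler_angle_eq[OF assms] D_square_gram(4)[OF assms(1,2) chart_in_local_dom[where F=F, OF assms(3,4)]] assms(5)
  by (auto simp: cos_arccos le_divide_eq divide_le_eq)

lemma D_pos_of_inj:
  assumes a: "a \<in> A" and c: "c \<in> B" and x: "x \<in> local_dom a c F" and inj: "inj (local_deriv a c F x)"
  shows "D a c x > 0"
proof (rule ccontr)
  assume "\<not> D a c x > 0"
  then have D0: "D a c x = 0" using D_square_gram(3)[OF a c x] by simp
  let ?L = "local_deriv a c F x" and ?h = "\<omega> c (local_rep a c F x)"
  let ?u = "?L e1" and ?v = "?L e2"
  interpret hermitian_form ?h by (rule hermitian_at[OF a c x])
  interpret L: linear ?L using linear_deriv[OF a c x] by (rule bounded_linear.linear)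
  have sym: "?h v (J u) = ?h u (J v)" for u v using swap[of v "J u"] J_left[of u v] by simp
  have z: "?h ?u (J ?u) * ?h ?v (J ?v) - ?h ?u (J ?v) * ?h ?u (J ?v) = 0"
    using D_square_gram(1)[OF a c x] D0 sym[of ?v ?u] by simp
  \<comment> \<open>Its image is |u|^2 times the part of \<open>?v\<close> orthogonal to
    \<open>?u\<close>, and has squared length |u|^2 times the Gram determinant, hence 0.\<close>
  let ?w = "?h ?u (J ?u) *\<^sub>R e2 + (- ?h ?u (J ?v)) *\<^sub>R e1"
  have Lw: "?L ?w = ?h ?u (J ?u) *\<^sub>R ?v + (- ?h ?u (J ?v)) *\<^sub>R ?u" by (simp only: L.add L.scale)
  have "?h (?L ?w) (J (?L ?w)) = ?h ?u (J ?u) * (?h ?u (J ?u) * ?h ?v (J ?v) - ?h ?u (J ?v) * ?h ?u (J ?v))"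
    unfolding Lw J_add J_scaleR h_simps sym[of ?v ?u] by (simp add: algebra_simps)
  then have "?h (?L ?w) (J (?L ?w)) = 0" using z by simp
  then have "?L ?w = 0" using pos[of "?L ?w"] by (metis less_irrefl)
  then have w0: "?w = 0" using inj L.zero by (metis injD)
  have "?w $ 2 = ?h ?u (J ?u)" by (simp add: axis_def)
  then have "?h ?u (J ?u) = 0" unfolding w0 by simp
  then have "?u = 0" using pos[of ?u] by (metis less_irrefl)
  then have "e1 = 0" using inj L.zero by (metis injD)
  then show False by (simp add: axis_eq_0_iff)
qed

text \<open>The sign of \<open>W\<close> is the same in all charts by orientation, and
  \<open>W \<noteq> 0\<close> forces the differential to be injective. One chart per point therefore
  suffices, also for the immersion property.\<close>

lemma symplectic_surfaceI:
  assumes "\<And>p. \<exists>a\<in>A. \<exists>c\<in>B. p \<in> fst a \<and> F p \<in> fst c \<and> W a c (snd a p) > 0"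
  shows "symplectic_surface A B \<omega> F"
proof -
  have W: "W a c (snd a p) > 0" if ac: "a \<in> A" "c \<in> B" "p \<in> fst a" "F p \<in> fst c" for a c p
  proof -
    obtain a' c' where a': "a' \<in> A" "c' \<in> B" "p \<in> fst a'" "F p \<in> fst c'" "W a' c' (snd a' p) > 0" using assms by blast
    have "det (matrix (local_deriv a a' id (snd a p))) > 0"
      using transition_A(3)[OF ac(1) a'(1)] ac a' by (simp add: chart_in_local_dom)
    then show ?thesis
      using W_transform[OF ac(1) a'(1) ac(2) a'(2) ac(3) a'(3) ac(4) a'(4)] a'(5) by simp
  qed
  have "inj (local_deriv a c F x)" if ac: "a \<in> A" "c \<in> B" and x: "x \<in> local_dom a c F" for a c x
  proof -
    let ?L = "local_deriv a c F x" and ?h = "\<omega> c (local_rep a c F x)"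
    interpret hermitian_form ?h by (rule hermitian_at[OF ac x])
    interpret L: linear ?L using linear_deriv[OF ac x] by (rule bounded_linear.linear)
    obtain p where p: "x = snd a p" "p \<in> fst a" "F p \<in> fst c" using x by (auto simp: local_dom_def)
    have h: "?h (?L e1) (?L e2) > 0" using W[OF ac p(2,3)] p(1) by (simp add: pullback_form_def)
    have "v = 0" if "?L v = 0" for v
    proof -
      have ex: "v = v $ 1 *\<^sub>R e1 + v $ 2 *\<^sub>R e2" by (simp add: vec_eq_iff forall_2 axis_def)
      have Lv: "v $ 1 *\<^sub>R ?L e1 + v $ 2 *\<^sub>R ?L e2 = 0"
        using that arg_cong[OF ex, of ?L] by (simp only: L.add L.scale)
      have "?h (v $ 1 *\<^sub>R ?L e1 + v $ 2 *\<^sub>R ?L e2) (?L e2) = v $ 1 * ?h (?L e1) (?L e2)"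
        "?h (?L e1) (v $ 1 *\<^sub>R ?L e1 + v $ 2 *\<^sub>R ?L e2) = v $ 2 * ?h (?L e1) (?L e2)"
        by (simp_all add: h_simps alt)
      then have "v $ 1 * ?h (?L e1) (?L e2) = 0" "v $ 2 * ?h (?L e1) (?L e2) = 0"
        unfolding Lv using bilinear_lzero[OF bilin] bilinear_rzero[OF bilin] by auto
      then show "v = 0" using h by (simp add: vec_eq_iff forall_2)
    qed
    then show ?thesis using L.linear_axioms by (simp add: linear_injective_0)
  qed
  then have "immersion A B F" using smooth_F by (simp add: immersion_def)
  moreover have "cos (kaehler_angle A B \<omega> F p) > 0" for p
  proof -
    obtain a c where ac: "a \<in> A" "c \<in> B" "p \<in> fst a" "F p \<in> fst c" using ex_chart_A ex_chart_B by blast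
    have "D a c (snd a p) > 0" using W[OF ac] D_square_gram(4)[OF ac(1,2) chart_in_local_dom[where F=F, OF ac(3,4)]] by simp
    then show ?thesis using cos_kaehler_angle[OF ac] W[OF ac] by simp
  qed
  ultimately show ?thesis by (simp add: symplectic_surface_def)
qed

end

locale symplectic_map = surface_map +
  assumes symplectic: "symplectic_surface A B \<omega> F"
begin

lemma
  assumes "a \<in> A" "c \<in> B" "x \<in> local_dom a c F"
  shows D_pos: "D a c x > 0" and W_pos: "W a c x > 0"
proof -
  obtain p where p: "x = snd a p" "p \<in> fst a" "F p \<in> fst c" using assms by (auto simp: local_dom_def)
  have "inj (local_deriv a c F x)"
    using symplectic assms by (simp add: symplectic_surface_def immersion_def)
  then show D: "D a c x > 0" by (rule D_pos_of_inj[OF assms])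
  have "cos (kaehler_angle A B \<omega> F p) > 0" using symplectic by (simp add: symplectic_surface_def)
  then show "W a c x > 0"
    using cos_kaehler_angle[OF assms(1,2) p(2,3)] D p(1) by (simp add: zero_less_divide_iff)
qed

lemma kaehler_angle_eq_0_iff:
  assumes "a \<in> A" "c \<in> B" "p \<in> fst a" "F p \<in> fst c"
  shows "kaehler_angle A B \<omega> F p = 0 \<longleftrightarrow> cdet (local_deriv a c F (snd a p) e1) (local_deriv a c F (snd a p) e2) = 0"
proof -
  let ?x = "snd a p"
  have x: "?x \<in> local_dom a c F" using assms(3,4) by (rule chart_in_local_dom)
  note pos = D_pos[OF assms(1,2) x] W_pos[OF assms(1,2) x]
  have le: "W a c ?x \<le> D a c ?x" using D_square_gram(4)[OF assms(1,2) x] by simp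
  have "W a c ?x / D a c ?x \<le> 1" "-1 \<le> W a c ?x / D a c ?x" using pos le by (auto simp: le_divide_eq)
  then have "arccos (W a c ?x / D a c ?x) = 0 \<longleftrightarrow> W a c ?x / D a c ?x = 1"
    using cos_arccos[of "W a c ?x / D a c ?x"] by (metis cos_zero arccos_1)
  then have "kaehler_angle A B \<omega> F p = 0 \<longleftrightarrow> W a c ?x / D a c ?x = 1"
    unfolding kaehler_angle_eq[OF assms pos(1)] .
  also have "\<dots> \<longleftrightarrow> (W a c ?x)\<^sup>2 = (D a c ?x)\<^sup>2" using pos by auto
  also have "\<dots> \<longleftrightarrow> cdet (local_deriv a c F ?x e1) (local_deriv a c F ?x e2) = 0"
    unfolding D_square_gram(2)[OF assms(1,2) x] using hermitian_form.gram_pos[OF hermitian_at[OF assms(1,2) x]] by simp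
  finally show ?thesis .
qed

end

section \<open>The area measure\<close>

lemma absolutely_integrable_iff_nn_integral:
  fixes q :: "'a::euclidean_space \<Rightarrow> real"
  assumes nn: "\<And>x. x \<in> T \<Longrightarrow> 0 \<le> q x" and m: "(\<lambda>x. q x * indicator T x) \<in> borel_measurable borel"
  shows "(q absolutely_integrable_on T \<and> integral T q = b) \<longleftrightarrow> ((\<integral>\<^sup>+x\<in>T. ennreal (q x) \<partial>lborel) = ennreal b \<and> 0 \<le> b)"
proof -
  have "(q absolutely_integrable_on T \<and> integral T q = b) \<longleftrightarrow> (q has_integral b) T"
    using absolutely_integrable_on_iff_nonneg[of T q] nn by (metis has_integral_integral has_integral_integrable integral_unique)
  also have "\<dots> \<longleftrightarrow> ((\<lambda>x. q x * indicator T x) has_integral b) UNIV"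
  proof -
    have "(\<lambda>x. q x * indicator T x) = (\<lambda>x. if x \<in> T then q x else 0)" by auto
    then show ?thesis by (simp only: has_integral_restrict_UNIV)
  qed
  also have "\<dots> \<longleftrightarrow> (integral\<^sup>N lebesgue (\<lambda>x. ennreal (q x * indicator T x)) = ennreal b \<and> 0 \<le> b)"
    using m nn by (subst has_integral_iff_nn_integral_lebesgue) (auto simp: indicator_def intro: measurable_completion)
  also have "integral\<^sup>N lebesgue (\<lambda>x. ennreal (q x * indicator T x)) = (\<integral>\<^sup>+x\<in>T. ennreal (q x) \<partial>lborel)"
    unfolding nn_integral_completion by (rule nn_integral_cong) (auto simp: indicator_def)
  finally show ?thesis .
qed

text \<open>The underlying theorem is about absolutely integrable functions with values in
  \<open>real^1\<close>. It shows that each finite value is taken by both integrals or by neither,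
  and the infinite value follows.\<close>

lemma nn_integral_change_of_variables:
  fixes g :: "real^2 \<Rightarrow> real^2" and q :: "real^2 \<Rightarrow> real"
  assumes S: "S \<in> sets borel" and g: "\<And>x. x \<in> S \<Longrightarrow> (g has_derivative g' x) (at x)" and inj: "inj_on g S"
    and nn: "\<And>x. x \<in> S \<Longrightarrow> 0 \<le> q (g x)"
    and m1: "(\<lambda>x. q x * indicator (g ` S) x) \<in> borel_measurable borel"
    and m2: "(\<lambda>x. \<bar>det (matrix (g' x))\<bar> * q (g x) * indicator S x) \<in> borel_measurable borel"
  shows "(\<integral>\<^sup>+x\<in>S. ennreal (\<bar>det (matrix (g' x))\<bar> * q (g x)) \<partial>lborel) = (\<integral>\<^sup>+x\<in>g ` S. ennreal (q x) \<partial>lborel)"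
    (is "?I1 = ?I2")
proof -
  let ?v = "\<lambda>x. vec (q x) :: real^1" and ?p = "\<lambda>x. \<bar>det (matrix (g' x))\<bar> * q (g x)"
  have eq: "(\<lambda>x. \<bar>det (matrix (g' x))\<bar> *\<^sub>R ?v (g x)) = (\<lambda>x. vec (?p x) :: real^1)"
    by (auto simp: vec_eq_iff)
  have abs: "(\<lambda>x. vec (r x) :: real^1) absolutely_integrable_on T \<longleftrightarrow> r absolutely_integrable_on T" for T and r :: "real^2 \<Rightarrow> real"
    by (subst absolutely_integrable_on_1_iff) simp
  have int: "(integral T (\<lambda>x. vec (r x) :: real^1) = vec b) \<longleftrightarrow> integral T r = b"
    if "r absolutely_integrable_on T" for b T and r :: "real^2 \<Rightarrow> real"
    using integral_component_eq_cart[OF set_lebesgue_integral_eq_integral(1)[OF that[folded abs]], of 1] by (auto simp: vec_eq_iff)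
  have S': "S \<in> sets lebesgue" using S by simp
  have gw: "(g has_derivative g' x) (at x within S)" if "x \<in> S" for x
    using g[OF that] by (rule has_derivative_at_withinI)
  have "(?p absolutely_integrable_on S \<and> integral S ?p = b) \<longleftrightarrow> (q absolutely_integrable_on (g ` S) \<and> integral (g ` S) q = b)" for b
    using has_absolute_integral_change_of_variables[OF S' gw inj, of ?v "vec b"]
      int[where r="?p" and T=S and b=b] int[where r=q and T="g ` S" and b=b]
    unfolding eq abs by blast
  then have iff: "(?I1 = ennreal b \<and> 0 \<le> b) \<longleftrightarrow> (?I2 = ennreal b \<and> 0 \<le> b)" for b
    using absolutely_integrable_iff_nn_integral[of S ?p b] absolutely_integrable_iff_nn_integral[of "g ` S" q b] nn m1 m2 by auto
  show ?thesis
  proof (cases ?I1)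
    case (real b)
    then show ?thesis using iff[of b] by simp
  next
    case top
    show ?thesis
    proof (cases ?I2)
      case (real b)
      then show ?thesis using iff[of b] top by simp
    qed (use top in simp)
  qed
qed

section \<open>Gluing coordinate area measures\<close>

context surface_map
begin

definition dom where "dom a c = fst a \<inter> F -` fst c"

text \<open>The area measure of one coordinate patch, pushed forward to the surface. The default
  \<open>undefined\<close> only makes the map total: the density is 0 where it is used.\<close>

definition N where
  "N a c = distr (density lborel (\<lambda>x. indicator (local_dom a c F) x * ennreal (D a c x))) borel
    (\<lambda>x. if x \<in> local_dom a c F then chart_inv a x else undefined)"

lemma open_dom': "a \<in> A \<Longrightarrow> c \<in> B \<Longrightarrow> open (dom a c)"
  unfolding dom_def by (intro open_Int open_chart chart_A chart_B open_vimage continuous_F)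

lemma vimage_local_dom: "a \<in> A \<Longrightarrow> X \<subseteq> dom a c \<Longrightarrow> snd a ` X = local_dom a c F \<inter> chart_inv a -` X"
  by (subst chart_image_eq) (auto simp: chart_A dom_def mem_local_dom)

lemma chart_inv_measurable:
  assumes "a \<in> A" "c \<in> B"
  shows "(\<lambda>x. if x \<in> local_dom a c F then chart_inv a x else undefined) \<in> borel_measurable borel"
proof (rule borel_measurableI)
  fix V :: "'s set" assume V: "open V"
  let ?f = "\<lambda>x. if x \<in> local_dom a c F then chart_inv a x else undefined"
  have "continuous_on (local_dom a c F) (chart_inv a)"
    by (rule continuous_on_subset[OF chart_inv_continuous[OF chart_A[OF assms(1)]]]) (auto simp: mem_local_dom chart_A assms)
  then have "open (local_dom a c F \<inter> chart_inv a -` V)"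
    using open_dom[OF assms] V by (rule continuous_open_preimage)
  moreover have "?f -` V \<inter> space borel = (local_dom a c F \<inter> chart_inv a -` V) \<union> (if undefined \<in> V then - local_dom a c F else {})"
    by (auto split: if_splits)
  ultimately show "?f -` V \<inter> space borel \<in> sets borel" using open_dom[OF assms] by auto
qed

lemma borel_chart_image:
  assumes "a \<in> A" "c \<in> B" "X \<in> sets borel" "X \<subseteq> dom a c"
  shows "snd a ` X \<in> sets borel"
proof -
  let ?f = "\<lambda>x. if x \<in> local_dom a c F then chart_inv a x else undefined"
  have "snd a ` X = local_dom a c F \<inter> (?f -` X \<inter> space borel)"
    unfolding vimage_local_dom[OF assms(1,4)] by auto
  also have "\<dots> \<in> sets borel"
    using open_dom[OF assms(1,2)] measurable_sets[OF chart_inv_measurable[OF assms(1,2)] assms(3)] by auto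
  finally show ?thesis .
qed

lemma smooth_metric:
  assumes "a \<in> A" "c \<in> B"
  shows "smooth_on (\<lambda>x. induced_metric \<omega> a c F x u v) (local_dom a c F)"
    and "smooth_on (\<lambda>x. pullback_form \<omega> a c F x u v) (local_dom a c F)"
proof -
  interpret kaehler_chart "snd c ` fst c" "\<omega> c" by (rule kaehler_chartI[OF kaehler assms(2)])
  note s = smooth_rep[OF assms] open_dom[OF assms]
  show "smooth_on (\<lambda>x. induced_metric \<omega> a c F x u v) (local_dom a c F)"
    unfolding induced_metric_def
    by (rule smooth_on_form[OF s(2,1) smooth_on_derivative[OF s(1)] smooth_on_compose_linear[OF s(2) bounded_linear_J smooth_on_derivative[OF s(1)]] rep_in[OF assms(1)]])
  show "smooth_on (\<lambda>x. pullback_form \<omega> a c F x u v) (local_dom a c F)"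
    unfolding pullback_form_def
    by (rule smooth_on_form[OF s(2,1) smooth_on_derivative[OF s(1)] smooth_on_derivative[OF s(1)] rep_in[OF assms(1)]])
qed

lemma continuous_D: "a \<in> A \<Longrightarrow> c \<in> B \<Longrightarrow> continuous_on (local_dom a c F) (D a c)"
  unfolding area_density_def[abs_def] Let_def
  by (intro continuous_intros smooth_on_continuous[OF smooth_metric(1)])

lemma D_measurable:
  assumes "a \<in> A" "c \<in> B" "S \<in> sets borel" "S \<subseteq> local_dom a c F"
  shows "(\<lambda>x. D a c x * indicator S x) \<in> borel_measurable borel"
  using borel_measurable_continuous_on_indicator[OF assms(3) continuous_on_subset[OF continuous_D[OF assms(1,2)] assms(4)]]
  by (simp add: mult.commute)

lemma density_measurable:
  assumes "a \<in> A" "c \<in> B"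
  shows "(\<lambda>x. indicator (local_dom a c F) x * ennreal (D a c x)) \<in> borel_measurable lborel"
proof -
  have "(\<lambda>x. ennreal (D a c x * indicator (local_dom a c F) x)) \<in> borel_measurable lborel"
    using D_measurable[OF assms, of "local_dom a c F"] open_dom[OF assms] by simp
  also have "(\<lambda>x. ennreal (D a c x * indicator (local_dom a c F) x)) = (\<lambda>x. indicator (local_dom a c F) x * ennreal (D a c x))"
    by (auto simp: indicator_def)
  finally show ?thesis .
qed

lemma emeasure_N:
  assumes "a \<in> A" "c \<in> B" "X \<in> sets borel" "X \<subseteq> dom a c"
  shows "emeasure (N a c) X = (\<integral>\<^sup>+x\<in>snd a ` X. ennreal (D a c x) \<partial>lborel)"
proof -
  let ?f = "\<lambda>x. if x \<in> local_dom a c F then chart_inv a x else undefined"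
  have X': "?f -` X \<in> sets borel"
    using measurable_sets[OF chart_inv_measurable[OF assms(1,2)] assms(3)] by simp
  have "emeasure (N a c) X = emeasure (density lborel (\<lambda>x. indicator (local_dom a c F) x * ennreal (D a c x))) (?f -` X)"
    unfolding N_def using assms chart_inv_measurable[OF assms(1,2)] by (subst emeasure_distr) auto
  also have "\<dots> = (\<integral>\<^sup>+x. indicator (local_dom a c F) x * ennreal (D a c x) * indicator (?f -` X) x \<partial>lborel)"
    using X' density_measurable[OF assms(1,2)] by (subst emeasure_density) auto
  also have "\<dots> = (\<integral>\<^sup>+x\<in>snd a ` X. ennreal (D a c x) \<partial>lborel)"
    unfolding vimage_local_dom[OF assms(1,4)] by (rule nn_integral_cong) (auto simp: indicator_def)
  finally show ?thesis .
qed

text \<open>The Jacobian from the change of variables is the factor by which \<open>D\<close>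
  transforms.\<close>

lemma N_consistent:
  assumes a: "a \<in> A" "a' \<in> A" and c: "c \<in> B" "c' \<in> B" and X: "X \<in> sets borel" "X \<subseteq> dom a c" "X \<subseteq> dom a' c'"
  shows "emeasure (N a c) X = emeasure (N a' c') X"
proof -
  let ?S = "snd a ` X" and ?g = "local_rep a a' id"
  have S: "?S \<in> sets borel" by (rule borel_chart_image[OF a(1) c(1) X(1,2)])
  have gp: "?g (snd a p) = snd a' p" if "p \<in> X" for p
    using that X by (subst local_rep_chart) (auto simp: dom_def chart_A a)
  then have gS: "?g ` ?S = snd a' ` X" by (auto simp: image_image)
  have S': "?g ` ?S \<in> sets borel" unfolding gS by (rule borel_chart_image[OF a(2) c(2) X(1,3)])
  have Sdom: "?S \<subseteq> local_dom a a' id" "?S \<subseteq> local_dom a c F" "?g ` ?S \<subseteq> local_dom a' c' F"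
    unfolding gS using X by (auto simp: dom_def intro!: chart_in_local_dom)
  have inj: "inj_on ?g ?S"
  proof (rule inj_onI)
    fix x y assume "x \<in> ?S" "y \<in> ?S" "?g x = ?g y"
    then obtain p q where "p \<in> X" "q \<in> X" "x = snd a p" "y = snd a q" "snd a' p = snd a' q" by (auto simp: gp)
    then show "x = y" using chart_inj[OF chart_A[OF a(2)]] X(3) by (auto simp: dom_def inj_on_def subset_iff)
  qed
  have Deq: "D a c x = \<bar>det (matrix (local_deriv a a' id x))\<bar> * D a' c' (?g x)" if x: "x \<in> ?S" for x
  proof -
    obtain p where p: "p \<in> X" "x = snd a p" using x by blast
    have "det (matrix (local_deriv a a' id x)) > 0" using transition_A(3)[OF a] x Sdom(1) by blast
    then show ?thesis
      using D_transform[OF a c, of p] p X gp[OF p(1)] by (auto simp: dom_def)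
  qed
  have "emeasure (N a c) X = (\<integral>\<^sup>+x\<in>?S. ennreal (D a c x) \<partial>lborel)" by (rule emeasure_N[OF a(1) c(1) X(1,2)])
  also have "\<dots> = (\<integral>\<^sup>+x\<in>?S. ennreal (\<bar>det (matrix (local_deriv a a' id x))\<bar> * D a' c' (?g x)) \<partial>lborel)"
    by (rule nn_integral_cong) (simp add: Deq indicator_def)
  also have "\<dots> = (\<integral>\<^sup>+x\<in>?g ` ?S. ennreal (D a' c' x) \<partial>lborel)"
  proof (rule nn_integral_change_of_variables[OF S _ inj])
    fix x assume x: "x \<in> ?S"
    then show "(?g has_derivative local_deriv a a' id x) (at x)"
      using Sdom(1) by (intro smooth_on_has_derivative[OF transition_A(1)[OF a]]) blast
    show "0 \<le> D a' c' (?g x)" using D_square_gram(3)[OF a(2) c(2)] Sdom(3) x by blast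
  next
    show "(\<lambda>x. D a' c' x * indicator (?g ` ?S) x) \<in> borel_measurable borel"
      by (rule D_measurable[OF a(2) c(2) S' Sdom(3)])
    have "(\<lambda>x. D a c x * indicator ?S x) = (\<lambda>x. \<bar>det (matrix (local_deriv a a' id x))\<bar> * D a' c' (?g x) * indicator ?S x)"
    proof
      fix x show "D a c x * indicator ?S x = \<bar>det (matrix (local_deriv a a' id x))\<bar> * D a' c' (?g x) * indicator ?S x"
        unfolding indicator_def by (simp add: Deq)
    qed
    then show "(\<lambda>x. \<bar>det (matrix (local_deriv a a' id x))\<bar> * D a' c' (?g x) * indicator ?S x) \<in> borel_measurable borel"
      using D_measurable[OF a(1) c(1) S Sdom(2)] by (simp only:)
  qed
  also have "\<dots> = emeasure (N a' c') X" unfolding gS by (rule emeasure_N[OF a(2) c(2) X(1,3), symmetric])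
  finally show ?thesis .
qed

lemma sets_N [simp]: "sets (N a c) = sets borel"
  by (simp add: N_def)

lemma finite_chart_cover:
  obtains cs :: "(('s, real^2) chart \<times> ('m, complex^2) chart) list" where
    "set cs \<subseteq> A \<times> B" "(\<Union>(a, c)\<in>set cs. dom a c) = UNIV"
proof -
  have "compact (UNIV :: 's set)" using surface by (simp add: closed_oriented_surface_def)
  moreover have "open (case i of (a, c) \<Rightarrow> dom a c)" if "i \<in> A \<times> B" for i using that open_dom' by auto
  moreover have "UNIV \<subseteq> (\<Union>i\<in>A \<times> B. case i of (a, c) \<Rightarrow> dom a c)"
  proof
    fix p
    show "p \<in> (\<Union>i\<in>A \<times> B. case i of (a, c) \<Rightarrow> dom a c)"
      using ex_chart_A[of p] ex_chart_B[of "F p"] by (auto simp: dom_def)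
  qed
  ultimately obtain C where C: "C \<subseteq> A \<times> B" "finite C" "UNIV \<subseteq> (\<Union>i\<in>C. case i of (a, c) \<Rightarrow> dom a c)"
    by (rule compactE_image)
  obtain cs where "set cs = C" using finite_list[OF C(2)] by blast
  then show ?thesis using C(1,3) by (intro that[of cs]) blast+
qed

definition is_area_measure where
  "is_area_measure \<mu> \<longleftrightarrow> sets \<mu> = sets borel \<and>
     (\<forall>a\<in>A. \<forall>c\<in>B. \<forall>X\<in>sets borel. X \<subseteq> fst a \<inter> F -` fst c \<longrightarrow>
        emeasure \<mu> X = (\<integral>\<^sup>+ x \<in> snd a ` X. ennreal (area_density \<omega> a c F x) \<partial>lborel))"

text \<open>A finite subcover made disjoint, so that a Borel measure can be assembled from, and is
  determined by, its values inside single charts. Pieces with index beyond the list are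
  empty.\<close>

lemma chart_partition:
  obtains n a c and U :: "nat \<Rightarrow> 's set" where "\<And>i. i < n \<Longrightarrow> a i \<in> A" "\<And>i. i < n \<Longrightarrow> c i \<in> B"
    "\<And>i. U i \<in> sets borel" "\<And>i. U i \<subseteq> dom (a i) (c i)"
    "\<And>M X. sets M = sets borel \<Longrightarrow> X \<in> sets borel \<Longrightarrow> (\<Sum>i<(n::nat). emeasure M (X \<inter> U i)) = emeasure M X"
proof -
  obtain cs where cs: "set cs \<subseteq> A \<times> B" "(\<Union>(a, c)\<in>set cs. dom a c) = UNIV" by (rule finite_chart_cover)
  let ?n = "length cs"
  define a where "a i = fst (cs ! i)" for i
  define c where "c i = snd (cs ! i)" for i
  have AB: "a i \<in> A" "c i \<in> B" if "i < ?n" for i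
  proof -
    have "cs ! i \<in> A \<times> B" using cs(1) nth_mem[OF that] by blast
    then show "a i \<in> A" "c i \<in> B" by (auto simp: a_def c_def mem_Times_iff)
  qed
  define V where "V i = (if i < ?n then dom (a i) (c i) else {})" for i
  define U where "U = disjointed V"
  have Vb: "V i \<in> sets borel" for i using open_dom' AB by (auto simp: V_def)
  have Ub: "U i \<in> sets borel" for i unfolding U_def disjointed_def using Vb by (intro sets.Diff sets.finite_UN) auto
  have Udom: "U i \<subseteq> dom (a i) (c i)" for i using disjointed_subset[of V i] by (auto simp: U_def V_def split: if_splits)
  have "(\<Union>i. V i) = UNIV"
  proof (rule UNIV_eq_I[symmetric])
    fix p
    have "p \<in> (\<Union>x\<in>set cs. dom (fst x) (snd x))" using cs(2) unfolding case_prod_beta by blast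
    then obtain x where x: "x \<in> set cs" "p \<in> dom (fst x) (snd x)" by blast
    then obtain i where "i < ?n" "cs ! i = x" by (auto simp: in_set_conv_nth)
    then show "p \<in> (\<Union>i. V i)" using x(2) by (auto simp: V_def a_def c_def)
  qed
  then have UN: "(\<Union>i. U i) = UNIV" by (simp add: U_def UN_disjointed_eq)
  have Uemp: "U i = {}" if "i \<ge> ?n" for i using disjointed_subset[of V i] that by (auto simp: U_def V_def)
  have cover: "(\<Union>i<?n. X \<inter> U i) = X" for X
  proof -
    have "i < ?n" if "x \<in> U i" for x i using Uemp[of i] that by (cases "i < ?n") auto
    then have "(\<Union>i<?n. U i) = (\<Union>i. U i)" by blast
    then have "X \<inter> (\<Union>i<?n. U i) = X" using UN by simp
    then show ?thesis by simp
  qed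
  have disj: "disjoint_family_on (\<lambda>i. X \<inter> U i) {..<?n}" for X
    using disjoint_family_disjointed[of V] by (auto simp: U_def disjoint_family_on_def)
  have split: "(\<Sum>i<?n. emeasure M (X \<inter> U i)) = emeasure M X" if "sets M = sets borel" "X \<in> sets borel" for M X
    using sum_emeasure[OF _ disj, of X M] that Ub cover by (auto simp: image_subset_iff)
  show ?thesis
    by (rule that[of ?n a c U]) (use AB Ub Udom split in auto)
qed

text \<open>Gives meaning to the definite description \<open>area_measure\<close>. The patch
  measures are added up over a partition; since they agree on overlaps, the sum has the prescribed
  values in every chart.\<close>

lemma area_measure_exists_unique: "\<exists>!\<mu>. is_area_measure \<mu>"
proof -
  obtain n a c and U :: "nat \<Rightarrow> 's set" where AB: "\<And>i. i < n \<Longrightarrow> a i \<in> A" "\<And>i. i < n \<Longrightarrow> c i \<in> B"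
    and Ub: "\<And>i. U i \<in> sets borel" and Udom: "\<And>i. U i \<subseteq> dom (a i) (c i)"
    and split: "\<And>M X. sets M = sets borel \<Longrightarrow> X \<in> sets borel \<Longrightarrow> (\<Sum>i<(n::nat). emeasure M (X \<inter> U i)) = emeasure M X"
    by (rule chart_partition) blast
  define m where "m X = (\<Sum>i<n. emeasure (N (a i) (c i)) (X \<inter> U i))" for X
  define \<mu> where "\<mu> = measure_of UNIV (sets borel) m"
  have sig: "sigma_algebra (UNIV :: 's set) (sets borel)"
    using sets.sigma_algebra_axioms[of borel] by simp
  have m: "emeasure \<mu> X = m X" if "X \<in> sets borel" for X
    unfolding \<mu>_def
  proof (rule emeasure_measure_of_sigma[OF sig _ _ that])
    show "positive (sets borel) m" by (simp add: positive_def m_def)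
    show "countably_additive (sets borel) m"
    proof (rule countably_additiveI)
      fix Y :: "nat \<Rightarrow> 's set" assume Y: "range Y \<subseteq> sets borel" "disjoint_family Y"
      have "(\<Sum>k. m (Y k)) = (\<Sum>i<n. \<Sum>k. emeasure (N (a i) (c i)) (Y k \<inter> U i))"
        unfolding m_def by (rule suminf_sum) simp
      also have "\<dots> = m (\<Union>k. Y k)"
        unfolding m_def
      proof (rule sum.cong[OF refl])
        fix i
        have "disjoint_family (\<lambda>k. Y k \<inter> U i)" using Y(2) by (auto simp: disjoint_family_on_def)
        then have "(\<Sum>k. emeasure (N (a i) (c i)) (Y k \<inter> U i)) = emeasure (N (a i) (c i)) (\<Union>k. Y k \<inter> U i)"
          using Y(1) Ub by (intro suminf_emeasure) auto
        also have "(\<Union>k. Y k \<inter> U i) = (\<Union>k. Y k) \<inter> U i" by blast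
        finally show "(\<Sum>k. emeasure (N (a i) (c i)) (Y k \<inter> U i)) = emeasure (N (a i) (c i)) ((\<Union>k. Y k) \<inter> U i)" .
      qed
      finally show "(\<Sum>k. m (Y k)) = m (\<Union>k. Y k)" .
    qed
  qed
  have sets: "sets \<mu> = sets borel"
    unfolding \<mu>_def using sigma_algebra.sets_measure_of_eq[OF sig] by simp
  have \<mu>: "is_area_measure \<mu>"
    unfolding is_area_measure_def
  proof (intro conjI ballI impI sets)
    fix a' c' X assume a': "a' \<in> A" "c' \<in> B" "X \<in> sets borel" and "X \<subseteq> fst a' \<inter> F -` fst c'"
    then have X: "X \<subseteq> dom a' c'" by (simp add: dom_def)
    have "emeasure \<mu> X = (\<Sum>i<n. emeasure (N a' c') (X \<inter> U i))"
      unfolding m[OF a'(3)] m_def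
      using a' X Ub Udom AB by (intro sum.cong refl N_consistent) auto
    also have "\<dots> = emeasure (N a' c') X" by (rule split) (simp_all add: a')
    also have "\<dots> = (\<integral>\<^sup>+ x \<in> snd a' ` X. ennreal (D a' c' x) \<partial>lborel)" by (rule emeasure_N[OF a' X])
    finally show "emeasure \<mu> X = (\<integral>\<^sup>+ x \<in> snd a' ` X. ennreal (D a' c' x) \<partial>lborel)" .
  qed
  moreover have "\<nu> = \<mu>" if \<nu>: "is_area_measure \<nu>" for \<nu>
  proof (rule measure_eqI)
    show s: "sets \<nu> = sets \<mu>" using \<nu> sets by (simp add: is_area_measure_def)
    fix X assume "X \<in> sets \<nu>"
    then have X: "X \<in> sets borel" using s sets by simp
    have "emeasure \<nu> (X \<inter> U i) = emeasure \<mu> (X \<inter> U i)" if "i < n" for i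
    proof -
      have "X \<inter> U i \<in> sets borel" "X \<inter> U i \<subseteq> fst (a i) \<inter> F -` fst (c i)" using X Ub Udom[of i] by (auto simp: dom_def)
      then show ?thesis using \<nu> \<mu> AB[OF that] by (simp add: is_area_measure_def)
    qed
    then have "(\<Sum>i<n. emeasure \<nu> (X \<inter> U i)) = (\<Sum>i<n. emeasure \<mu> (X \<inter> U i))" by simp
    then show "emeasure \<nu> X = emeasure \<mu> X" using split[of \<nu> X] split[of \<mu> X] X sets s by simp
  qed
  ultimately show ?thesis by blast
qed

abbreviation "\<mu> \<equiv> area_measure A B \<omega> F"

lemma is_area_measure_\<mu>: "is_area_measure \<mu>"
  unfolding area_measure_def using theI'[OF area_measure_exists_unique] unfolding is_area_measure_def .

lemma sets_\<mu>: "sets \<mu> = sets borel"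
  using is_area_measure_\<mu> by (simp add: is_area_measure_def)

lemma emeasure_\<mu>: "a \<in> A \<Longrightarrow> c \<in> B \<Longrightarrow> X \<in> sets borel \<Longrightarrow> X \<subseteq> dom a c \<Longrightarrow> emeasure \<mu> X = emeasure (N a c) X"
  using is_area_measure_\<mu> emeasure_N by (simp add: is_area_measure_def dom_def)

end

section \<open>Integration in one chart and finiteness of the area\<close>

context surface_map
begin

lemma compact_chart_inv:
  assumes "a \<in> A" "c \<in> B" "compact Q" "Q \<subseteq> local_dom a c F"
  shows "compact (chart_inv a ` Q)" "chart_inv a ` Q \<subseteq> dom a c" "chart_inv a ` Q \<in> sets borel"
    "x \<in> local_dom a c F \<Longrightarrow> chart_inv a x \<in> chart_inv a ` Q \<longleftrightarrow> x \<in> Q"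
proof -
  have Q: "Q \<subseteq> snd a ` fst a" using assms(4) by (auto simp: mem_local_dom chart_A assms(1))
  show c: "compact (chart_inv a ` Q)"
    by (rule compact_continuous_image[OF continuous_on_subset[OF chart_inv_continuous[OF chart_A[OF assms(1)]] Q] assms(3)])
  show "chart_inv a ` Q \<subseteq> dom a c"
    using assms(4) by (auto simp: dom_def mem_local_dom chart_A assms(1) chart_inv_in subset_iff)
  show "chart_inv a ` Q \<in> sets borel" using compact_imp_closed[OF c] by simp
  show "chart_inv a x \<in> chart_inv a ` Q \<longleftrightarrow> x \<in> Q" if "x \<in> local_dom a c F"
  proof
    assume "chart_inv a x \<in> chart_inv a ` Q"
    then obtain y where y: "y \<in> Q" "chart_inv a x = chart_inv a y" by blast
    have "x = snd a (chart_inv a x)" using that by (simp add: mem_local_dom chart_A assms(1) chart_chart_inv)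
    also have "\<dots> = y" unfolding y(2) using y(1) Q by (intro chart_chart_inv) blast
    finally show "x \<in> Q" using y(1) by simp
  qed simp
qed

lemma nn_integral_chart:
  fixes h :: "'s \<Rightarrow> ennreal"
  assumes a: "a \<in> A" and c: "c \<in> B" and Q: "compact Q" "Q \<subseteq> local_dom a c F" and h: "h \<in> borel_measurable borel"
  shows "(\<integral>\<^sup>+p\<in>chart_inv a ` Q. h p \<partial>\<mu>) = (\<integral>\<^sup>+x\<in>Q. ennreal (D a c x) * h (chart_inv a x) \<partial>lborel)"
proof -
  let ?K = "chart_inv a ` Q"
  let ?f = "\<lambda>x. if x \<in> local_dom a c F then chart_inv a x else undefined"
  note K = compact_chart_inv[OF a c Q]
  have sp: "space \<mu> = UNIV" "space (N a c) = UNIV" using sets_eq_imp_space_eq[OF sets_\<mu>] by (simp_all add: N_def)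
  \<comment> \<open>On subsets of the chart domain \<mu> and \<open>N a c\<close> agree, so
    integrals over \<open>?K\<close> may be computed with either of them.\<close>
  have res: "restrict_space \<mu> ?K = restrict_space (N a c) ?K"
  proof (rule measure_eqI)
    show "sets (restrict_space \<mu> ?K) = sets (restrict_space (N a c) ?K)"
      by (rule sets_restrict_space_cong) (simp add: sets_\<mu>)
    fix X assume "X \<in> sets (restrict_space \<mu> ?K)"
    then have X: "X \<in> sets borel" "X \<subseteq> ?K"
      using K(3) by (auto simp: sets_restrict_space sets_\<mu>)
    then show "emeasure (restrict_space \<mu> ?K) X = emeasure (restrict_space (N a c) ?K) X"
      using K(2,3) by (simp add: emeasure_restrict_space sp sets_\<mu> emeasure_\<mu>[OF a c])
  qed
  have "(\<integral>\<^sup>+p\<in>?K. h p \<partial>\<mu>) = nn_integral (restrict_space \<mu> ?K) h"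
    using K(3) by (subst nn_integral_restrict_space) (simp_all add: sets_\<mu> sp)
  also have "\<dots> = (\<integral>\<^sup>+p\<in>?K. h p \<partial>N a c)"
    unfolding res using K(3) by (subst nn_integral_restrict_space) (simp_all add: sp)
  also have "\<dots> = (\<integral>\<^sup>+x. h (?f x) * indicator ?K (?f x) \<partial>density lborel (\<lambda>x. indicator (local_dom a c F) x * ennreal (D a c x)))"
    unfolding N_def using chart_inv_measurable[OF a c] h K(3)
    by (subst nn_integral_distr) auto
  also have "\<dots> = (\<integral>\<^sup>+x. (indicator (local_dom a c F) x * ennreal (D a c x)) * (h (?f x) * indicator ?K (?f x)) \<partial>lborel)"
  proof (rule nn_integral_density[OF density_measurable[OF a c]])
    have f: "?f \<in> measurable lborel borel" using chart_inv_measurable[OF a c] by simp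
    show "(\<lambda>x. h (?f x) * indicator ?K (?f x)) \<in> borel_measurable lborel"
      by (rule measurable_compose[OF f]) (use h K(3) in simp)
  qed
  also have "\<dots> = (\<integral>\<^sup>+x\<in>Q. ennreal (D a c x) * h (chart_inv a x) \<partial>lborel)"
  proof (rule nn_integral_cong)
    fix x
    show "(indicator (local_dom a c F) x * ennreal (D a c x)) * (h (?f x) * indicator ?K (?f x)) =
      ennreal (D a c x) * h (chart_inv a x) * indicator Q x"
      using K(4)[of x] Q(2) by (auto simp: indicator_def mult.assoc)
  qed
  finally show ?thesis .
qed

lemma emeasure_compact_finite:
  assumes a: "a \<in> A" and c: "c \<in> B" and Q: "compact Q" "Q \<subseteq> local_dom a c F"
  shows "emeasure \<mu> (chart_inv a ` Q) < \<infinity>"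
proof -
  have "bounded (D a c ` Q)"
    using continuous_on_subset[OF continuous_D[OF a c] Q(2)] Q(1) by (intro compact_imp_bounded compact_continuous_image)
  then obtain M where M: "\<And>x. x \<in> Q \<Longrightarrow> D a c x \<le> M" by (auto simp: bounded_iff) (meson abs_le_D1)
  have "emeasure \<mu> (chart_inv a ` Q) = (\<integral>\<^sup>+p\<in>chart_inv a ` Q. 1 \<partial>\<mu>)"
    using compact_chart_inv(3)[OF a c Q] by (simp add: sets_\<mu>)
  also have "\<dots> = (\<integral>\<^sup>+x\<in>Q. ennreal (D a c x) * 1 \<partial>lborel)" by (rule nn_integral_chart[OF a c Q]) simp
  also have "\<dots> \<le> (\<integral>\<^sup>+x. ennreal M * indicator Q x \<partial>lborel)"
    using M by (intro nn_integral_mono) (auto simp: indicator_def intro: ennreal_leI)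
  also have "\<dots> = ennreal M * emeasure lborel Q"
    using borel_closed[OF compact_imp_closed[OF Q(1)]] by (intro nn_integral_cmult_indicator) simp
  also have "\<dots> < \<infinity>" using emeasure_compact_finite[OF Q(1)] by (simp add: ennreal_mult_less_top)
  finally show ?thesis .
qed

lemma ex_compact_neighbourhood:
  shows "\<exists>a c Q V. a \<in> A \<and> c \<in> B \<and> compact Q \<and> Q \<subseteq> local_dom a c F \<and> open V \<and> p \<in> V \<and> V \<subseteq> chart_inv a ` Q"
proof -
  obtain a c where ac: "a \<in> A" "c \<in> B" "p \<in> fst a" "F p \<in> fst c" using ex_chart_A ex_chart_B by blast
  have "snd a p \<in> local_dom a c F" using ac(3,4) by (rule chart_in_local_dom)
  then obtain r where r: "r > 0" "cube (snd a p) r \<subseteq> local_dom a c F" using cube_in_open[OF open_dom[OF ac(1,2)]] by blast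
  let ?V = "fst a \<inter> snd a -` ball (snd a p) r"
  have 1: "open ?V" by (rule continuous_open_preimage[OF chart_continuous open_chart(1)]) (simp_all add: chart_A ac)
  have 2: "?V \<subseteq> chart_inv a ` cube (snd a p) r"
  proof
    fix q assume q: "q \<in> ?V"
    then have "snd a q \<in> cube (snd a p) r" "q = chart_inv a (snd a q)"
      using ball_subset_cube[of "snd a p" r] by (auto simp: chart_inv_chart chart_A ac)
    then show "q \<in> chart_inv a ` cube (snd a p) r" by blast
  qed
  have 3: "p \<in> ?V" using ac r by simp
  show ?thesis
    by (intro exI[of _ a] exI[of _ c] exI[of _ "cube (snd a p) r"] exI[of _ ?V] conjI ac(1,2) r(2) compact_cube 1 2 3)
qed

lemma compact_surface: "compact (UNIV :: 's set)"
  using surface by (simp add: closed_oriented_surface_def)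

text \<open>Makes the integral of the bounded function \<open>cos_inv\<close> finite, so that
  \<open>L\<close> can be split into a sum of real numbers.\<close>

lemma finite_\<mu>: "emeasure \<mu> UNIV < \<infinity>"
proof -
  have "\<exists>V K. open V \<and> p \<in> V \<and> V \<subseteq> K \<and> K \<in> sets borel \<and> emeasure \<mu> K < \<infinity>" for p
  proof -
    obtain a c Q V where Q: "a \<in> A" "c \<in> B" "compact Q" "Q \<subseteq> local_dom a c F" and V: "open V" "p \<in> V" "V \<subseteq> chart_inv a ` Q"
      using ex_compact_neighbourhood[of p] by (elim exE conjE)
    show ?thesis
      by (intro exI[of _ V] exI[of _ "chart_inv a ` Q"] conjI V compact_chart_inv(3)[OF Q] emeasure_compact_finite[OF Q])
  qed
  then obtain V K where VK: "\<And>p. open (V p)" "\<And>p. p \<in> V p" "\<And>p. V p \<subseteq> K p" "\<And>p. K p \<in> sets borel" "\<And>p. emeasure \<mu> (K p) < \<infinity>"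
    by metis
  obtain C where C: "finite C" "UNIV \<subseteq> (\<Union>p\<in>C. V p)"
    by (rule compactE_image[OF compact_surface, of UNIV V]) (use VK(1,2) in auto)
  then have "UNIV = (\<Union>p\<in>C. K p)" using VK(3) by blast
  then have "emeasure \<mu> UNIV \<le> (\<Sum>p\<in>C. emeasure \<mu> (K p))"
    using emeasure_subadditive_finite[OF C(1), of K \<mu>] VK(4) by (simp add: sets_\<mu> image_subset_iff)
  also have "\<dots> < \<infinity>" using VK(5) C(1) by (simp add: sum_Pinfty less_top[symmetric])
  finally show ?thesis .
qed

end

section \<open>The functional seen from one chart\<close>

context symplectic_map
begin

definition cos_inv where "cos_inv p = 1 / cos (kaehler_angle A B \<omega> F p)"

lemma cos_inv_eq:
  assumes "a \<in> A" "c \<in> B" "p \<in> fst a" "F p \<in> fst c"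
  shows "cos_inv p = D a c (snd a p) / W a c (snd a p)"
  unfolding cos_inv_def
  by (subst cos_kaehler_angle[OF assms D_pos[OF assms(1,2) chart_in_local_dom[where F=F, OF assms(3,4)]]]) simp

lemma cos_inv_pos: "cos_inv p > 0"
  using symplectic by (simp add: cos_inv_def symplectic_surface_def)

lemma continuous_cos_inv: "continuous_on UNIV cos_inv"
proof -
  have "continuous_on (dom a c) cos_inv" if ac: "a \<in> A" "c \<in> B" for a c
  proof -
    have W0: "W a c x \<noteq> 0" if "x \<in> local_dom a c F" for x using W_pos[OF ac that] by simp
    have "continuous_on (local_dom a c F) (\<lambda>x. D a c x / W a c x)"
      by (intro continuous_intros continuous_D smooth_on_continuous[OF smooth_metric(2)] ac ballI W0)
    then have "continuous_on (dom a c) (\<lambda>p. D a c (snd a p) / W a c (snd a p))"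
      by (rule continuous_on_compose2[OF _ continuous_on_subset[OF chart_continuous[OF chart_A[OF ac(1)]]]])
        (auto simp: dom_def local_dom_def)
    then show ?thesis by (subst continuous_on_cong[OF refl cos_inv_eq[OF ac]]) (auto simp: dom_def)
  qed
  then have "continuous_on (\<Union>i\<in>A \<times> B. dom (fst i) (snd i)) cos_inv"
    by (intro continuous_on_open_UN) (auto intro: open_dom')
  moreover have "(\<Union>i\<in>A \<times> B. dom (fst i) (snd i)) = UNIV"
  proof (rule UNIV_eq_I[symmetric])
    fix p
    obtain a c where "a \<in> A" "c \<in> B" "p \<in> fst a" "F p \<in> fst c" using ex_chart_A ex_chart_B by blast
    then show "p \<in> (\<Union>i\<in>A \<times> B. dom (fst i) (snd i))" by (intro UN_I[of "(a, c)"]) (auto simp: dom_def)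
  qed
  ultimately show ?thesis by simp
qed

lemma measurable_cos_inv: "cos_inv \<in> borel_measurable borel"
  by (rule borel_measurable_continuous_onI[OF continuous_cos_inv])

lemma nn_integral_cos_inv_finite: "(\<integral>\<^sup>+p. ennreal (cos_inv p) \<partial>\<mu>) < \<infinity>"
proof -
  have "bounded (range cos_inv)" using continuous_cos_inv compact_surface by (intro compact_imp_bounded compact_continuous_image)
  then obtain M where M: "\<And>p. cos_inv p \<le> M" by (auto simp: bounded_iff) (meson abs_le_D1)
  have "(\<integral>\<^sup>+p. ennreal (cos_inv p) \<partial>\<mu>) \<le> (\<integral>\<^sup>+p. ennreal M \<partial>\<mu>)"
    using M by (intro nn_integral_mono ennreal_leI)
  also have "\<dots> = ennreal M * emeasure \<mu> UNIV"
    using sets_eq_imp_space_eq[OF sets_\<mu>] by simp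
  also have "\<dots> < \<infinity>" using finite_\<mu> by (simp add: ennreal_mult_less_top)
  finally show ?thesis .
qed

text \<open>Separates the part of \<open>L\<close> inside a coordinate cube, which is the integral
  of \<open>lagrangian\<close>, from the rest. A variation supported in the cube changes the former
  only.\<close>

lemma L_functional_split:
  assumes a: "a \<in> A" and c: "c \<in> B" and Q: "cube y s \<subseteq> local_dom a c F"
  shows "L_functional A B \<omega> F = enn2real (\<integral>\<^sup>+p\<in>- chart_inv a ` cube y s. ennreal (cos_inv p) \<partial>\<mu>) +
    integral (cube y s) (\<lambda>x. lagrangian (\<omega> c (local_rep a c F x)) (local_deriv a c F x e1) (local_deriv a c F x e2))"
proof -
  let ?Q = "cube y s" and ?L = "\<lambda>x. lagrangian (\<omega> c (local_rep a c F x)) (local_deriv a c F x e1) (local_deriv a c F x e2)"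
  let ?K = "chart_inv a ` ?Q"
  note K = compact_chart_inv[OF a c compact_cube Q]
  have hm: "(\<lambda>p. ennreal (cos_inv p)) \<in> borel_measurable borel" using measurable_cos_inv by simp
  then have hm\<mu>: "(\<lambda>p. ennreal (cos_inv p)) \<in> borel_measurable \<mu>"
    by (subst measurable_cong_sets[OF sets_\<mu> refl])
  have Lx: "?L x = D a c x * cos_inv (chart_inv a x)" "?L x \<ge> 0" "?L x = (D a c x)\<^sup>2 / W a c x" if x: "x \<in> local_dom a c F" for x
  proof -
    have x': "chart_inv a x \<in> fst a" "F (chart_inv a x) \<in> fst c" "snd a (chart_inv a x) = x"
      using x by (simp_all add: mem_local_dom chart_A a chart_inv_in chart_chart_inv)
    show *: "?L x = (D a c x)\<^sup>2 / W a c x"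
      unfolding lagrangian_def D_square_gram(1)[OF a c x] pullback_form_def ..
    show "?L x = D a c x * cos_inv (chart_inv a x)"
      unfolding * cos_inv_eq[OF a c x'(1,2)] x'(3) by (simp add: power2_eq_square)
    show "?L x \<ge> 0" unfolding * using W_pos[OF a c x] by simp
  qed
  have "continuous_on ?Q (\<lambda>x. (D a c x)\<^sup>2 / W a c x)"
    using W_pos[OF a c] Q
    by (intro continuous_intros continuous_on_subset[OF continuous_D[OF a c] Q]
        continuous_on_subset[OF smooth_on_continuous[OF smooth_metric(2)[OF a c]] Q]) force
  then have "continuous_on ?Q ?L" using Lx(3) Q by (subst continuous_on_cong[OF refl Lx(3)]) auto
  then have "?L integrable_on ?Q" unfolding cube_def by (rule integrable_continuous)
  then have "(\<integral>\<^sup>+x\<in>?Q. ennreal (?L x) \<partial>lborel) = ennreal (integral ?Q ?L)"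
    using Lx(2) Q by (intro nn_integral_has_integral_lebesgue' integrable_integral) auto
  moreover have "(\<integral>\<^sup>+p\<in>?K. ennreal (cos_inv p) \<partial>\<mu>) = (\<integral>\<^sup>+x\<in>?Q. ennreal (?L x) \<partial>lborel)"
    unfolding nn_integral_chart[OF a c compact_cube Q hm]
  proof (rule nn_integral_cong)
    fix x
    show "ennreal (D a c x) * ennreal (cos_inv (chart_inv a x)) * indicator ?Q x = ennreal (?L x) * indicator ?Q x"
    proof (cases "x \<in> ?Q")
      case True
      then have "x \<in> local_dom a c F" using Q by blast
      from Lx(1)[OF this] D_square_gram(3)[OF a c this] cos_inv_pos[of "chart_inv a x"] show ?thesis
        by (simp add: ennreal_mult less_imp_le)
    qed simp
  qed
  ultimately have IK: "(\<integral>\<^sup>+p\<in>?K. ennreal (cos_inv p) \<partial>\<mu>) = ennreal (integral ?Q ?L)" by simp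
  have nn: "integral ?Q ?L \<ge> 0" using Lx(2) Q \<open>?L integrable_on ?Q\<close> by (intro integral_nonneg) auto
  have "(\<integral>\<^sup>+p. ennreal (cos_inv p) \<partial>\<mu>) = (\<integral>\<^sup>+p. ennreal (cos_inv p) * indicator (- ?K) p + ennreal (cos_inv p) * indicator ?K p \<partial>\<mu>)"
    by (rule nn_integral_cong) (auto simp: indicator_def)
  also have "\<dots> = (\<integral>\<^sup>+p\<in>-?K. ennreal (cos_inv p) \<partial>\<mu>) + (\<integral>\<^sup>+p\<in>?K. ennreal (cos_inv p) \<partial>\<mu>)"
    using hm\<mu> K(3) sets_\<mu> by (intro nn_integral_add borel_measurable_times_ennreal borel_measurable_indicator) (auto simp: Compl_in_sets_lebesgue)
  finally have sum: "(\<integral>\<^sup>+p. ennreal (cos_inv p) \<partial>\<mu>) = (\<integral>\<^sup>+p\<in>-?K. ennreal (cos_inv p) \<partial>\<mu>) + ennreal (integral ?Q ?L)"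
    unfolding IK .
  \<comment> \<open>Finiteness is what makes \<open>enn2real\<close> additive here.\<close>
  then have fin: "(\<integral>\<^sup>+p\<in>-?K. ennreal (cos_inv p) \<partial>\<mu>) < \<infinity>" using nn_integral_cos_inv_finite by auto
  have "L_functional A B \<omega> F = integral\<^sup>L \<mu> cos_inv" by (simp add: L_functional_def cos_inv_def[abs_def])
  also have "\<dots> = enn2real (\<integral>\<^sup>+p. ennreal (cos_inv p) \<partial>\<mu>)"
  proof (rule integral_eq_nn_integral)
    show "cos_inv \<in> borel_measurable \<mu>" using measurable_cos_inv by (subst measurable_cong_sets[OF sets_\<mu> refl])
  qed (auto intro: less_imp_le[OF cos_inv_pos])
  also have "\<dots> = enn2real (\<integral>\<^sup>+p\<in>-?K. ennreal (cos_inv p) \<partial>\<mu>) + integral ?Q ?L"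
    unfolding sum using fin nn by (subst enn2real_plus) auto
  finally show ?thesis .
qed

end

text \<open>As \<open>- K\<close> is open, \<open>F\<close> and \<open>G\<close> have the same
  derivatives there, hence the same area densities and Kaehler angles. The measures are compared
  piece by piece on a chart partition.\<close>

lemma complement_integral_eq:
  assumes F: "symplectic_map A B \<omega> F" and G: "symplectic_map A B \<omega> G" and K: "closed K" and eq: "\<And>p. p \<notin> K \<Longrightarrow> G p = F p"
  shows "(\<integral>\<^sup>+p\<in>- K. ennreal (symplectic_map.cos_inv A B \<omega> G p) \<partial>area_measure A B \<omega> G) =
    (\<integral>\<^sup>+p\<in>- K. ennreal (symplectic_map.cos_inv A B \<omega> F p) \<partial>area_measure A B \<omega> F)"
proof -
  interpret F: symplectic_map A B \<omega> F by (rule F)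
  interpret G: symplectic_map A B \<omega> G by (rule G)
  have rep: "local_rep a c G (snd a p) = local_rep a c F (snd a p)" "local_deriv a c G (snd a p) = local_deriv a c F (snd a p)"
    if "a \<in> A" "p \<in> fst a" "p \<notin> K" for a p and c :: "('b, complex^2) chart"
    by (rule local_rep_cong[OF F.chart_A[OF that(1)] open_Compl[OF K] that(2)]; use that(3) eq in simp)+
  have DW: "G.D a c (snd a p) = F.D a c (snd a p)" "G.W a c (snd a p) = F.W a c (snd a p)"
    if "a \<in> A" "p \<in> fst a" "p \<notin> K" for a c p
    unfolding area_density_def induced_metric_def pullback_form_def rep[OF that] by (rule refl)+
  have h: "G.cos_inv p = F.cos_inv p" if p: "p \<notin> K" for p
  proof -
    obtain a c where ac: "a \<in> A" "c \<in> B" "p \<in> fst a" "F p \<in> fst c" using F.ex_chart_A F.ex_chart_B by blast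
    then have "G p \<in> fst c" using eq[OF p] by simp
    then show ?thesis using F.cos_inv_eq[OF ac] G.cos_inv_eq[OF ac(1-3)] DW[OF ac(1,3) p] by simp
  qed
  have Kb: "- K \<in> sets borel" using K by auto
  have sp: "space F.\<mu> = UNIV" "space G.\<mu> = UNIV"
    using sets_eq_imp_space_eq[OF F.sets_\<mu>] sets_eq_imp_space_eq[OF G.sets_\<mu>] by simp_all
  have em: "emeasure G.\<mu> X = emeasure F.\<mu> X" if X: "X \<in> sets borel" "X \<subseteq> - K" for X
  proof -
    obtain n a c and U :: "nat \<Rightarrow> 'a set" where AB: "\<And>i. i < n \<Longrightarrow> a i \<in> A" "\<And>i. i < n \<Longrightarrow> c i \<in> B"
      and Ub: "\<And>i. U i \<in> sets borel" and Udom: "\<And>i. U i \<subseteq> F.dom (a i) (c i)"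
      and split: "\<And>M X. sets M = sets borel \<Longrightarrow> X \<in> sets borel \<Longrightarrow> (\<Sum>i<(n::nat). emeasure M (X \<inter> U i)) = emeasure M X"
      by (rule F.chart_partition) blast
    have "emeasure G.\<mu> (X \<inter> U i) = emeasure F.\<mu> (X \<inter> U i)" if i: "i < n" for i
    proof -
      have b: "X \<inter> U i \<in> sets borel" using X Ub by auto
      have dF: "X \<inter> U i \<subseteq> F.dom (a i) (c i)" using Udom[of i] by blast
      then have dG: "X \<inter> U i \<subseteq> G.dom (a i) (c i)" using X eq by (fastforce simp: F.dom_def G.dom_def)
      have "emeasure G.\<mu> (X \<inter> U i) = (\<integral>\<^sup>+ x \<in> snd (a i) ` (X \<inter> U i). ennreal (G.D (a i) (c i) x) \<partial>lborel)"
        using G.emeasure_\<mu>[OF AB[OF i] b dG] G.emeasure_N[OF AB[OF i] b dG] by simp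
      also have "\<dots> = (\<integral>\<^sup>+ x \<in> snd (a i) ` (X \<inter> U i). ennreal (F.D (a i) (c i) x) \<partial>lborel)"
      proof (rule nn_integral_cong)
        fix x
        show "ennreal (G.D (a i) (c i) x) * indicator (snd (a i) ` (X \<inter> U i)) x = ennreal (F.D (a i) (c i) x) * indicator (snd (a i) ` (X \<inter> U i)) x"
        proof (cases "x \<in> snd (a i) ` (X \<inter> U i)")
          case True
          then obtain q where q: "x = snd (a i) q" "q \<in> X" "q \<in> U i" by blast
          then have "q \<in> fst (a i)" "q \<notin> K" using X Udom[of i] by (auto simp: F.dom_def)
          from DW(1)[OF AB(1)[OF i] this] q(1) show ?thesis by simp
        qed simp
      qed
      also have "\<dots> = emeasure F.\<mu> (X \<inter> U i)"
        using F.emeasure_\<mu>[OF AB[OF i] b dF] F.emeasure_N[OF AB[OF i] b dF] by simp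
      finally show ?thesis .
    qed
    then show ?thesis using split[OF G.sets_\<mu> X(1)] split[OF F.sets_\<mu> X(1)] by simp
  qed
  have res: "restrict_space G.\<mu> (- K) = restrict_space F.\<mu> (- K)"
  proof (rule measure_eqI)
    show "sets (restrict_space G.\<mu> (- K)) = sets (restrict_space F.\<mu> (- K))"
      by (rule sets_restrict_space_cong) (simp add: F.sets_\<mu> G.sets_\<mu>)
    fix X assume "X \<in> sets (restrict_space G.\<mu> (- K))"
    then have X: "X \<in> sets borel" "X \<subseteq> - K" using Kb by (auto simp: sets_restrict_space G.sets_\<mu>)
    then show "emeasure (restrict_space G.\<mu> (- K)) X = emeasure (restrict_space F.\<mu> (- K)) X"
      using Kb by (simp add: emeasure_restrict_space sp F.sets_\<mu> G.sets_\<mu> em)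
  qed
  have "(\<integral>\<^sup>+p\<in>- K. ennreal (G.cos_inv p) \<partial>G.\<mu>) = (\<integral>\<^sup>+p\<in>- K. ennreal (F.cos_inv p) \<partial>G.\<mu>)"
    by (rule nn_integral_cong) (auto simp: indicator_def h)
  also have "\<dots> = nn_integral (restrict_space G.\<mu> (- K)) (\<lambda>p. ennreal (F.cos_inv p))"
    using Kb by (subst nn_integral_restrict_space) (simp_all add: G.sets_\<mu> sp)
  also have "\<dots> = (\<integral>\<^sup>+p\<in>- K. ennreal (F.cos_inv p) \<partial>F.\<mu>)"
    unfolding res using Kb by (subst nn_integral_restrict_space) (simp_all add: F.sets_\<mu> sp)
  finally show ?thesis .
qed

section \<open>Variations supported in a chart\<close>

text \<open>Both conditions are open and hold at \<open>t = 0\<close>; compactness of the cube makes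
  the time bound uniform. Outside the cube nothing moves.\<close>

lemma (in symplectic_map) small_variation:
  assumes a: "a \<in> A" and c: "c \<in> B" and Q: "cube y s \<subseteq> local_dom a c F"
    and \<eta>: "smooth_on \<eta> UNIV" and \<eta>0: "\<And>x. x \<notin> cube y s \<Longrightarrow> \<eta> x = 0"
  defines "f \<equiv> local_rep a c F"
  obtains \<epsilon> where "\<epsilon> > 0"
    "\<And>t x. \<bar>t\<bar> < \<epsilon> \<Longrightarrow> x \<in> local_dom a c F \<Longrightarrow> f x + (t * \<eta> x) *\<^sub>R e \<in> snd c ` fst c"
    "\<And>t x. \<bar>t\<bar> < \<epsilon> \<Longrightarrow> x \<in> local_dom a c F \<Longrightarrow> \<omega> c (f x + (t * \<eta> x) *\<^sub>R e)
      (dir_deriv e1 (\<lambda>x. f x + (t * \<eta> x) *\<^sub>R e) x) (dir_deriv e2 (\<lambda>x. f x + (t * \<eta> x) *\<^sub>R e) x) > 0"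
proof -
  let ?\<Omega> = "local_dom a c F" and ?Q = "cube y s" and ?Y = "snd c ` fst c"
  interpret C: kaehler_chart ?Y "\<omega> c" by (rule kaehler_chartI[OF kaehler c])
  have f: "smooth_on f ?\<Omega>" unfolding f_def by (rule smooth_rep[OF a c])
  have \<Omega>: "open ?\<Omega>" by (rule open_dom[OF a c])
  have fY: "f x \<in> ?Y" if "x \<in> ?\<Omega>" for x unfolding f_def by (rule rep_in[OF a that])
  have fW: "\<omega> c (f x) (dir_deriv e1 f x) (dir_deriv e2 f x) > 0" if "x \<in> ?\<Omega>" for x
    using W_pos[OF a c that] by (simp add: pullback_form_def f_def)
  let ?F = "\<lambda>p. f (snd p) + (fst p * \<eta> (snd p)) *\<^sub>R e"
  let ?U = "\<lambda>v p. dir_deriv v f (snd p) + (fst p * dir_deriv v \<eta> (snd p)) *\<^sub>R e"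
  let ?S = "UNIV \<times> ?\<Omega> :: (real \<times> (real^2)) set"
  have S: "open ?S" using \<Omega> by (simp add: open_Times)
  have comp: "smooth_on (\<lambda>p. g (snd p)) ?S" if "smooth_on g ?\<Omega>" for g :: "real^2 \<Rightarrow> 'c::euclidean_space"
    by (rule smooth_on_compose[OF that \<Omega> S smooth_on_snd[OF S smooth_on_id]]) auto
  have sF: "smooth_on ?F ?S" and sU: "smooth_on (?U v) ?S" for v
    by (intro smooth_on_add smooth_on_scaleR smooth_on_mult smooth_on_fst smooth_on_id smooth_on_const S comp
        smooth_on_derivative f smooth_on_subset[OF \<eta>] subset_UNIV)+
  define N0 where "N0 = ?S \<inter> ?F -` ?Y"
  have N0: "open N0" unfolding N0_def
    by (rule continuous_open_preimage[OF smooth_on_continuous[OF sF] S C.open_Y])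
  have N0S: "N0 \<subseteq> ?S" by (auto simp: N0_def)
  let ?W = "\<lambda>p. \<omega> c (?F p) (?U e1 p) (?U e2 p)"
  have sW: "smooth_on ?W N0"
    by (rule C.smooth_on_form[OF N0 smooth_on_subset[OF sF N0S] smooth_on_subset[OF sU N0S] smooth_on_subset[OF sU N0S]])
      (simp add: N0_def)
  define N where "N = N0 \<inter> ?W -` {0<..}"
  have N: "open N" unfolding N_def
    by (rule continuous_open_preimage[OF smooth_on_continuous[OF sW] N0 open_greaterThan])
  have "(0, x) \<in> N" if "x \<in> ?\<Omega>" for x
    using fY[OF that] fW[OF that] that by (simp add: N_def N0_def)
  then have sub: "{0} \<times> ?Q \<subseteq> N" using Q by blast
  have "compact ({0::real} \<times> ?Q)" by (intro compact_Times compact_cube) auto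
  from compact_subset_open_imp_ball_epsilon_subset[OF this N sub]
  obtain \<epsilon> where \<epsilon>: "\<epsilon> > 0" "(\<Union>p\<in>{0::real} \<times> ?Q. ball p \<epsilon>) \<subseteq> N" .
  have inN: "(t, x) \<in> N" if "\<bar>t\<bar> < \<epsilon>" "x \<in> ?Q" for t x
  proof -
    have "(t, x) \<in> ball (0, x) \<epsilon>" using that by (auto simp: dist_Pair_Pair dist_real_def)
    then show ?thesis using \<epsilon>(2) that(2) by blast
  qed
  show ?thesis
  proof (rule that[OF \<epsilon>(1)])
    fix t x assume t: "\<bar>t\<bar> < \<epsilon>" and x: "x \<in> ?\<Omega>"
    show "f x + (t * \<eta> x) *\<^sub>R e \<in> ?Y"
    proof (cases "x \<in> ?Q")
      case True
      then show ?thesis using inN[OF t True] by (simp add: N_def N0_def)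
    qed (simp add: \<eta>0 fY[OF x])
    show "\<omega> c (f x + (t * \<eta> x) *\<^sub>R e) (dir_deriv e1 (\<lambda>x. f x + (t * \<eta> x) *\<^sub>R e) x) (dir_deriv e2 (\<lambda>x. f x + (t * \<eta> x) *\<^sub>R e) x) > 0"
    proof (cases "x \<in> ?Q")
      case True
      then show ?thesis using inN[OF t True] by (simp add: N_def N0_def dir_deriv_variation[OF f \<eta> x])
    next
      case False
      \<comment> \<open>The complement of the cube is open, so the derivative of \<eta> vanishes
        there together with \<eta>.\<close>
      have "frechet_derivative \<eta> (at x) = frechet_derivative (\<lambda>x. 0) (at x)"
        by (rule frechet_derivative_cong[of "- ?Q"]) (use False \<eta>0 closed_cube in auto)
      then show ?thesis using fW[OF x] by (simp add: dir_deriv_variation[OF f \<eta> x] \<eta>0[OF False])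
    qed
  qed
qed

locale variation = symplectic_map A B \<omega> F
  for A :: "('s::{t2_space,second_countable_topology}, real^2) chart set"
    and B :: "('m::{t2_space,second_countable_topology}, complex^2) chart set"
    and \<omega> :: "'m form2" and F :: "'s \<Rightarrow> 'm" +
  fixes a c and y :: "real^2" and s :: real and \<eta> :: "real^2 \<Rightarrow> real" and e :: "complex^2" and \<epsilon> :: real
  assumes a: "a \<in> A" and c: "c \<in> B" and Q: "cube y s \<subseteq> local_dom a c F"
    and \<eta>: "smooth_on \<eta> UNIV" and \<eta>0: "x \<notin> cube y s \<Longrightarrow> \<eta> x = 0" and \<epsilon>: "\<epsilon> > 0"
    and in_chart: "\<bar>t\<bar> < \<epsilon> \<Longrightarrow> x \<in> local_dom a c F \<Longrightarrow> local_rep a c F x + (t * \<eta> x) *\<^sub>R e \<in> snd c ` fst c"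
    and pos: "\<bar>t\<bar> < \<epsilon> \<Longrightarrow> x \<in> local_dom a c F \<Longrightarrow> \<omega> c (local_rep a c F x + (t * \<eta> x) *\<^sub>R e)
      (dir_deriv e1 (\<lambda>x. local_rep a c F x + (t * \<eta> x) *\<^sub>R e) x) (dir_deriv e2 (\<lambda>x. local_rep a c F x + (t * \<eta> x) *\<^sub>R e) x) > 0"
begin

abbreviation "\<Omega> \<equiv> local_dom a c F"
abbreviation "K \<equiv> chart_inv a ` cube y s"
abbreviation "f \<equiv> local_rep a c F"
abbreviation "ft t x \<equiv> f x + (t * \<eta> x) *\<^sub>R e"

text \<open>The coordinate variation carried to the whole surface. On the part of the chart domain
  outside \<open>K\<close> the two formulas agree because \<eta> is 0 there, so the first is valid
  on the open set \<open>dom a c\<close> and the second on the open set \<open>- K\<close>, and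
  these cover the surface.\<close>

definition G where "G t p = (if p \<in> K then chart_inv c (ft t (snd a p)) else F p)"

lemmas K = compact_chart_inv[OF a c compact_cube Q]

lemma closed_K: "closed K"
  by (rule compact_imp_closed[OF K(1)])

lemma G_off: "p \<notin> K \<Longrightarrow> G t p = F p"
  by (simp add: G_def)

lemma G_dom: "p \<in> dom a c \<Longrightarrow> G t p = chart_inv c (ft t (snd a p))"
proof -
  assume p: "p \<in> dom a c"
  show ?thesis
  proof (cases "p \<in> K")
    case False
    have "snd a p \<in> \<Omega>" using p by (simp add: dom_def chart_in_local_dom)
    then have "snd a p \<notin> cube y s"
      using K(4)[of "snd a p"] False p by (simp add: dom_def chart_inv_chart chart_A a)
    then show ?thesis using p False by (simp add: G_def \<eta>0 local_rep_chart chart_A chart_B a c dom_def chart_inv_chart)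
  qed (simp add: G_def)
qed

lemma G_0: "G 0 = F"
proof
  fix p show "G 0 p = F p"
  proof (cases "p \<in> dom a c")
    case True
    then show ?thesis unfolding G_dom[OF True] by (simp add: local_rep_chart chart_A chart_B a c dom_def chart_inv_chart)
  next
    case False
    then show ?thesis using K(2) by (intro G_off) blast
  qed
qed

lemma smooth_f: "smooth_on f \<Omega>" and open_\<Omega>: "open \<Omega>"
  by (rule smooth_rep[OF a c], rule open_dom[OF a c])

text \<open>Off \<open>K\<close> the family is locally the constant family \<open>F\<close>. At a
  point of \<open>K\<close> it is the coordinate formula, conjugated by the transition maps from
  \<open>a'\<close> to \<open>a\<close> and from \<open>c\<close> to \<open>c'\<close>. Smoothness
  is joint in time and space.\<close>

lemma local_smooth:
  assumes t: "\<bar>t\<bar> < \<epsilon>" and a': "a' \<in> A" and c': "c' \<in> B" and x: "x \<in> local_dom a' c' (G t)"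
  shows "\<exists>U g. open U \<and> (t, x) \<in> U \<and> smooth_on g U \<and> (\<forall>q\<in>U. local_rep a' c' (G (fst q)) (snd q) = g q)"
proof -
  define p where "p = chart_inv a' x"
  have x': "x \<in> snd a' ` fst a'" and Gp: "G t p \<in> fst c'" using x by (simp_all add: mem_local_dom chart_A a' p_def)
  then have p: "p \<in> fst a'" "snd a' p = x" by (simp_all add: p_def chart_inv_in chart_chart_inv)
  show ?thesis
  proof (cases "p \<in> K")
    case False
    let ?V = "snd a' ` (fst a' \<inter> - K \<inter> F -` fst c')"
    have V: "open ?V"
      using closed_K by (intro open_chart_image chart_A a' open_Int open_chart open_vimage chart_B c' continuous_F) auto
    have sub: "?V \<subseteq> local_dom a' c' F" by (auto simp: local_dom_def)
    have U: "open (UNIV \<times> ?V :: (real \<times> (real^2)) set)" using V by (simp add: open_Times)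
    have "smooth_on (\<lambda>q. local_rep a' c' F (snd q)) (UNIV \<times> ?V :: (real \<times> (real^2)) set)"
      by (rule smooth_on_compose[OF smooth_rep[OF a' c'] open_dom[OF a' c'] U smooth_on_snd[OF U smooth_on_id]]) (use sub in auto)
    moreover have "(t, x) \<in> UNIV \<times> ?V" using p Gp False by (auto simp: G_off)
    moreover have "local_rep a' c' (G (fst q)) (snd q) = local_rep a' c' F (snd q)" if "q \<in> UNIV \<times> ?V" for q
      using that by (auto simp: local_rep_chart chart_A a' G_off)
    ultimately show ?thesis using U by blast
  next
    case True
    then have pd: "p \<in> dom a c" using K(2) by blast
    let ?\<tau> = "local_rep a' a id" and ?V = "snd a' ` (fst a' \<inter> dom a c)"
    have V: "open ?V" by (intro open_chart_image chart_A a' open_Int open_chart open_dom' a c) auto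
    let ?S = "UNIV \<times> ?V :: (real \<times> (real^2)) set"
    have S: "open ?S" using V by (simp add: open_Times)
    have \<tau>: "smooth_on (\<lambda>q. ?\<tau> (snd q)) ?S"
      by (rule smooth_on_compose[OF transition_A(1)[OF a' a] transition_A(2)[OF a' a] S smooth_on_snd[OF S smooth_on_id]])
        (auto simp: dom_def intro!: chart_in_local_dom)
    have \<tau>p: "?\<tau> (snd a' q) = snd a q" if "q \<in> fst a'" for q
      using that by (simp add: local_rep_chart chart_A a')
    have \<tau>\<Omega>: "?\<tau> (snd q) \<in> \<Omega>" if "q \<in> ?S" for q
      using that by (auto simp: \<tau>p dom_def intro!: chart_in_local_dom)
    let ?\<Phi> = "\<lambda>q. ft (fst q) (?\<tau> (snd q))"
    have \<Phi>: "smooth_on ?\<Phi> ?S"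
      by (intro smooth_on_add smooth_on_scaleR smooth_on_mult smooth_on_fst smooth_on_id smooth_on_const S
          smooth_on_compose[OF smooth_f open_\<Omega> S \<tau>] smooth_on_compose[OF \<eta> open_UNIV S \<tau>] \<tau>\<Omega> UNIV_I)
    let ?U = "?S \<inter> ?\<Phi> -` local_dom c c' id"
    have U: "open ?U"
      by (rule continuous_open_preimage[OF smooth_on_continuous[OF \<Phi>] S transition_B(2)[OF c c']])
    have "smooth_on (\<lambda>q. local_rep c c' id (?\<Phi> q)) ?U"
      by (rule smooth_on_compose[OF transition_B(1,2)[OF c c'] U smooth_on_subset[OF \<Phi>]]) auto
    moreover have "(t, x) \<in> ?U"
    proof -
      have "snd a p \<in> \<Omega>" using pd by (simp add: dom_def chart_in_local_dom)
      then have "ft t (snd a p) \<in> local_dom c c' id"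
        using in_chart[OF t] Gp G_dom[OF pd] by (simp add: mem_local_dom chart_B c)
      then show ?thesis using p pd \<tau>p[OF p(1)] by auto
    qed
    moreover have "local_rep a' c' (G (fst q)) (snd q) = local_rep c c' id (?\<Phi> q)" if q: "q \<in> ?U" for q
    proof -
      obtain r where r: "snd q = snd a' r" "r \<in> fst a'" "r \<in> dom a c" using q by auto
      have "local_rep a' c' (G (fst q)) (snd q) = snd c' (G (fst q) r)"
        unfolding r(1) by (rule local_rep_chart[OF chart_A[OF a'] r(2)])
      also have "\<dots> = local_rep c c' id (ft (fst q) (snd a r))"
        unfolding G_dom[OF r(3)] local_rep_apply[of c c' id] id_apply ..
      finally show ?thesis unfolding r(1) \<tau>p[OF r(2)] .
    qed
    ultimately show ?thesis using U by blast
  qed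
qed

lemma continuous_G: "continuous_on ({-\<epsilon><..<\<epsilon>} \<times> UNIV) (\<lambda>(t, p). G t p)"
proof -
  let ?I = "{-\<epsilon><..<\<epsilon>}"
  have "continuous_on (dom a c) (snd a)"
    by (rule continuous_on_subset[OF chart_continuous[OF chart_A[OF a]]]) (auto simp: dom_def)
  then have sa: "continuous_on (?I \<times> dom a c) (\<lambda>q. snd a (snd q))"
    by (rule continuous_on_compose2[OF _ continuous_on_snd[OF continuous_on_id]]) auto
  have sa\<Omega>: "snd a (snd q) \<in> \<Omega>" if "q \<in> ?I \<times> dom a c" for q
    using that by (auto simp: dom_def intro!: chart_in_local_dom)
  have "continuous_on (?I \<times> dom a c) (\<lambda>q. ft (fst q) (snd a (snd q)))"
    by (intro continuous_intros continuous_on_compose2[OF smooth_on_continuous[OF smooth_f] sa]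
        continuous_on_compose2[OF smooth_on_continuous[OF \<eta>] sa]) (use sa\<Omega> in auto)
  then have "continuous_on (?I \<times> dom a c) (\<lambda>q. chart_inv c (ft (fst q) (snd a (snd q))))"
  proof (rule continuous_on_compose2[OF chart_inv_continuous[OF chart_B[OF c]]])
    show "(\<lambda>q. ft (fst q) (snd a (snd q))) ` (?I \<times> dom a c) \<subseteq> snd c ` fst c"
      using in_chart sa\<Omega> by (auto simp: abs_less_iff)
  qed
  then have 1: "continuous_on (?I \<times> dom a c) (\<lambda>(t, p). G t p)"
    by (rule continuous_on_eq) (auto simp: G_dom)
  have "continuous_on (?I \<times> - K) (\<lambda>q. F (snd q))"
    by (rule continuous_on_compose2[OF continuous_F continuous_on_snd[OF continuous_on_id]]) auto
  then have 2: "continuous_on (?I \<times> - K) (\<lambda>(t, p). G t p)"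
    by (rule continuous_on_eq) (auto simp: G_off)
  have "continuous_on ((?I \<times> dom a c) \<union> (?I \<times> - K)) (\<lambda>(t, p). G t p)"
    using closed_K open_dom'[OF a c] by (intro continuous_on_open_Un open_Times 1 2) auto
  moreover have "(?I \<times> dom a c) \<union> (?I \<times> - K) = ?I \<times> UNIV" using K(2) by blast
  ultimately show ?thesis by simp
qed

lemma smooth_family_G: "smooth_family A B \<epsilon> G"
  unfolding smooth_family_def
proof (intro conjI ballI continuous_G smooth_on_local)
  fix a' c' q assume a': "a' \<in> A" "c' \<in> B" and q: "q \<in> {(t, x). t \<in> {-\<epsilon><..<\<epsilon>} \<and> x \<in> local_dom a' c' (G t)}"
  obtain t x where tx: "q = (t, x)" by fastforce
  have "\<bar>t\<bar> < \<epsilon>" "x \<in> local_dom a' c' (G t)" using q tx by auto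
  from local_smooth[OF this(1) a' this(2)]
  show "\<exists>U g. open U \<and> q \<in> U \<and> smooth_on g U \<and> (\<forall>y\<in>U. (case y of (t, x) \<Rightarrow> local_rep a' c' (G t) x) = g y)"
    unfolding tx case_prod_beta .
qed

lemma smooth_map_G: "\<bar>t\<bar> < \<epsilon> \<Longrightarrow> smooth_map A B (G t)"
  unfolding smooth_map_def
proof (intro conjI ballI smooth_on_local)
  assume t: "\<bar>t\<bar> < \<epsilon>"
  have "continuous_on UNIV (\<lambda>p. (t, p))" by (intro continuous_intros)
  moreover have "range (Pair t) \<subseteq> {-\<epsilon><..<\<epsilon>} \<times> UNIV" using t by auto
  ultimately show "continuous_on UNIV (G t)" using continuous_on_compose2[OF continuous_G] by fastforce
  fix a' c' x assume a': "a' \<in> A" "c' \<in> B" and x: "x \<in> local_dom a' c' (G t)"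
  obtain U g where U: "open U" "(t, x) \<in> U" "smooth_on g U" "\<And>q. q \<in> U \<Longrightarrow> local_rep a' c' (G (fst q)) (snd q) = g q"
    using local_smooth[OF t a' x] by auto
  let ?U = "Pair t -` U"
  have o: "open ?U" by (rule open_vimage[OF U(1)]) (intro continuous_intros)
  moreover have "smooth_on (\<lambda>x. g (t, x)) ?U"
    by (rule smooth_on_compose[OF U(3,1) o smooth_on_Pair[OF o smooth_on_const smooth_on_id]]) auto
  moreover have "local_rep a' c' (G t) z = g (t, z)" if "z \<in> ?U" for z using U(4)[of "(t, z)"] that by simp
  ultimately show "\<exists>U g. open U \<and> x \<in> U \<and> smooth_on g U \<and> (\<forall>y\<in>U. local_rep a' c' (G t) y = g y)"
    using U(2) by (intro exI[of _ ?U] exI[of _ "\<lambda>x. g (t, x)"]) auto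
qed

lemma
  assumes t: "\<bar>t\<bar> < \<epsilon>" and x: "x \<in> \<Omega>"
  shows rep_G: "local_rep a c (G t) x = ft t x" and G_in: "G t (chart_inv a x) \<in> fst c"
    and deriv_G: "local_deriv a c (G t) x = frechet_derivative (ft t) (at x)"
proof -
  have d: "G t (chart_inv a x) = chart_inv c (ft t x)" if "x \<in> \<Omega>" for x
    using that G_dom[of "chart_inv a x" t] by (simp add: dom_def mem_local_dom chart_A a chart_inv_in chart_chart_inv)
  have r: "local_rep a c (G t) x = ft t x" if "x \<in> \<Omega>" for x
    using in_chart[OF t that] by (simp add: local_rep_apply d[OF that] chart_chart_inv)
  show "local_rep a c (G t) x = ft t x" by (rule r[OF x])
  show "G t (chart_inv a x) \<in> fst c" unfolding d[OF x] by (rule chart_inv_in[OF in_chart[OF t x]])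
  show "local_deriv a c (G t) x = frechet_derivative (ft t) (at x)"
    by (rule frechet_derivative_cong[OF open_\<Omega> r x])
qed

lemma symplectic_map_G:
  assumes t: "\<bar>t\<bar> < \<epsilon>"
  shows "symplectic_map A B \<omega> (G t)"
proof -
  interpret G: surface_map A B \<omega> "G t"
    by unfold_locales (rule kaehler, rule surface, rule smooth_map_G[OF t])
  have "symplectic_surface A B \<omega> (G t)"
  proof (rule G.symplectic_surfaceI)
    fix p
    show "\<exists>a\<in>A. \<exists>c\<in>B. p \<in> fst a \<and> G t p \<in> fst c \<and> G.W a c (snd a p) > 0"
    proof (cases "p \<in> dom a c")
      case True
      then have x: "snd a p \<in> \<Omega>" and p: "p \<in> fst a" by (auto simp: dom_def intro!: chart_in_local_dom)
      have "G t p \<in> fst c" using G_in[OF t x] p by (simp add: chart_inv_chart chart_A a)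
      moreover have "G.W a c (snd a p) > 0"
        unfolding pullback_form_def rep_G[OF t x] deriv_G[OF t x] by (rule pos[OF t x])
      ultimately show ?thesis using a c p by blast
    next
      case False
      then have pK: "p \<in> - K" using K(2) by blast
      obtain a' c' where ac: "a' \<in> A" "c' \<in> B" "p \<in> fst a'" "F p \<in> fst c'" using ex_chart_A ex_chart_B by blast
      have "open (- K)" using closed_K by auto
      moreover have "G t q = F q" if "q \<in> - K" for q using that by (simp add: G_off)
      ultimately have r: "local_rep a' c' (G t) (snd a' p) = local_rep a' c' F (snd a' p)"
        "local_deriv a' c' (G t) (snd a' p) = local_deriv a' c' F (snd a' p)"
        using local_rep_cong[OF chart_A[OF ac(1)] _ ac(3) pK] by blast+
      have "G.W a' c' (snd a' p) = W a' c' (snd a' p)"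
        unfolding pullback_form_def r ..
      moreover have "W a' c' (snd a' p) > 0" by (rule W_pos[OF ac(1,2) chart_in_local_dom[where F=F, OF ac(3,4)]])
      moreover have "G t p \<in> fst c'" using ac(4) pK by (simp add: G_off)
      ultimately show ?thesis using ac(1-3) by (intro bexI[of _ a'] bexI[of _ c']) simp_all
    qed
  qed
  then show ?thesis by unfold_locales
qed

text \<open>Off \<open>K\<close> the contribution is the one of \<open>F\<close>, so the first
  summand does not depend on \<open>t\<close>.\<close>

lemma L_functional_G:
  assumes t: "\<bar>t\<bar> < \<epsilon>"
  shows "L_functional A B \<omega> (G t) = enn2real (\<integral>\<^sup>+p\<in>- K. ennreal (cos_inv p) \<partial>\<mu>) +
    integral (cube y s) (\<lambda>x. lagrangian (\<omega> c (ft t x)) (dir_deriv e1 (ft t) x) (dir_deriv e2 (ft t) x))"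
proof -
  interpret G: symplectic_map A B \<omega> "G t" by (rule symplectic_map_G[OF t])
  have Q': "cube y s \<subseteq> local_dom a c (G t)"
    using Q G_in[OF t] by (auto simp: mem_local_dom chart_A a subset_iff)
  have "integral (cube y s) (\<lambda>x. lagrangian (\<omega> c (local_rep a c (G t) x)) (local_deriv a c (G t) x e1) (local_deriv a c (G t) x e2))
    = integral (cube y s) (\<lambda>x. lagrangian (\<omega> c (ft t x)) (dir_deriv e1 (ft t) x) (dir_deriv e2 (ft t) x))"
    using Q by (intro integral_cong) (simp add: rep_G[OF t] deriv_G[OF t] subset_iff)
  moreover have "symplectic_map A B \<omega> F" by unfold_locales
  ultimately show ?thesis
    unfolding G.L_functional_split[OF a c Q']
    using complement_integral_eq[OF _ symplectic_map_G[OF t] closed_K G_off] by simp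
qed

end

text \<open>Feeds the global variations \<open>G\<close> into the definition of criticality and
  subtracts the constant contribution of the complement.\<close>

lemma critical_mapI:
  assumes K: "kaehler_surface B \<omega>" and S: "closed_oriented_surface A" and F: "symplectic_critical_surface A B \<omega> F"
    and a: "a \<in> A" and c: "c \<in> B"
  shows "critical_map (snd c ` fst c) (\<omega> c) (local_dom a c F) (local_rep a c F)"
proof -
  have sF: "symplectic_surface A B \<omega> F" using F by (simp add: symplectic_critical_surface_def)
  interpret symplectic_map A B \<omega> F
    using K S sF by unfold_locales (auto simp: symplectic_surface_def immersion_def)
  interpret C: kaehler_chart "snd c ` fst c" "\<omega> c" by (rule kaehler_chartI[OF K c])
  let ?f = "local_rep a c F"
  show ?thesis
  proof unfold_locales
    show "open (local_dom a c F)" "smooth_on ?f (local_dom a c F)" by (rule open_dom[OF a c], rule smooth_rep[OF a c])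
    show "?f x \<in> snd c ` fst c" if "x \<in> local_dom a c F" for x by (rule rep_in[OF a that])
    show "\<omega> c (?f x) (dir_deriv e1 ?f x) (dir_deriv e2 ?f x) > 0" if "x \<in> local_dom a c F" for x
      using W_pos[OF a c that] by (simp add: pullback_form_def)
    fix y s e and \<eta> :: "real^2 \<Rightarrow> real"
    assume s: "s > 0" and Q: "cube y s \<subseteq> local_dom a c F" and \<eta>: "smooth_on \<eta> UNIV" and \<eta>0: "\<And>x. x \<notin> cube y s \<Longrightarrow> \<eta> x = 0"
    obtain \<epsilon> where \<epsilon>: "\<epsilon> > 0"
      "\<And>t x. \<bar>t\<bar> < \<epsilon> \<Longrightarrow> x \<in> local_dom a c F \<Longrightarrow> ?f x + (t * \<eta> x) *\<^sub>R e \<in> snd c ` fst c"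
      "\<And>t x. \<bar>t\<bar> < \<epsilon> \<Longrightarrow> x \<in> local_dom a c F \<Longrightarrow> \<omega> c (?f x + (t * \<eta> x) *\<^sub>R e)
        (dir_deriv e1 (\<lambda>x. ?f x + (t * \<eta> x) *\<^sub>R e) x) (dir_deriv e2 (\<lambda>x. ?f x + (t * \<eta> x) *\<^sub>R e) x) > 0"
      by (rule small_variation[OF a c Q \<eta> \<eta>0, of e]) (assumption, rule that)
    interpret variation A B \<omega> F a c y s \<eta> e \<epsilon>
      by (unfold_locales; (rule a c Q \<eta> \<eta>0 \<epsilon>; assumption?))
    let ?C = "enn2real (\<integral>\<^sup>+p\<in>- K. ennreal (cos_inv p) \<partial>\<mu>)"
    let ?I = "\<lambda>t. integral (cube y s) (\<lambda>x. lagrangian (\<omega> c (ft t x)) (dir_deriv e1 (ft t) x) (dir_deriv e2 (ft t) x))"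
    have "\<forall>t\<in>{-\<epsilon><..<\<epsilon>}. symplectic_surface A B \<omega> (G t)"
      using symplectic_map.symplectic[OF symplectic_map_G] by (auto simp: abs_less_iff)
    then have "((\<lambda>t. L_functional A B \<omega> (G t)) has_real_derivative 0) (at 0)"
      using F \<epsilon>(1) smooth_family_G G_0 unfolding symplectic_critical_surface_def by blast
    then have "((\<lambda>t. L_functional A B \<omega> (G t) - ?C) has_real_derivative 0 - 0) (at 0)"
      by (intro DERIV_diff DERIV_const)
    then have "((\<lambda>t. L_functional A B \<omega> (G t) - ?C) has_real_derivative 0) (at 0)" by simp
    then show "(?I has_real_derivative 0) (at 0)"
    proof (rule has_field_derivative_transform_within_open[of _ _ _ "{-\<epsilon><..<\<epsilon>}"])
      fix t assume "t \<in> {-\<epsilon><..<\<epsilon>}"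
      then have "\<bar>t\<bar> < \<epsilon>" by auto
      from L_functional_G[OF this] show "L_functional A B \<omega> (G t) - ?C = ?I t" by simp
    qed (use \<epsilon> in auto)
  qed
qed

section \<open>Complex points\<close>

lemma complex_point_dichotomy:
  assumes K: "kaehler_surface B \<omega>" and S: "closed_oriented_surface A" and F: "symplectic_critical_surface A B \<omega> F"
  shows "(\<forall>\<^sub>F q in nhds p. kaehler_angle A B \<omega> F q = 0) \<or> (\<forall>\<^sub>F q in at p. kaehler_angle A B \<omega> F q \<noteq> 0)"
proof -
  have sF: "symplectic_surface A B \<omega> F" using F by (simp add: symplectic_critical_surface_def)
  interpret symplectic_map A B \<omega> F
    using K S sF by unfold_locales (auto simp: symplectic_surface_def immersion_def)
  obtain a c where ac: "a \<in> A" "c \<in> B" "p \<in> fst a" "F p \<in> fst c" using ex_chart_A ex_chart_B by blast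
  interpret C: critical_map "snd c ` fst c" "\<omega> c" "local_dom a c F" "local_rep a c F"
    by (rule critical_mapI[OF K S F ac(1,2)])
  have x: "snd a p \<in> local_dom a c F" using ac(3,4) by (rule chart_in_local_dom)
  have dom: "\<forall>\<^sub>F q in nhds p. q \<in> dom a c"
    using open_dom'[OF ac(1,2)] ac by (intro eventually_nhds_in_open) (auto simp: dom_def)
  have "isCont (snd a) p"
    using chart_continuous[OF chart_A[OF ac(1)]] open_chart(1)[OF chart_A[OF ac(1)]] ac(3) by (simp add: continuous_on_eq_continuous_at)
  then have lim: "filterlim (snd a) (nhds (snd a p)) (nhds p)"
    by (simp add: continuous_at tendsto_at_iff_tendsto_nhds)
  have iff: "kaehler_angle A B \<omega> F q = 0 \<longleftrightarrow> C.\<delta> (snd a q) = 0" if "q \<in> dom a c" for q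
    using that by (intro kaehler_angle_eq_0_iff ac) (auto simp: dom_def)
  from C.complex_points_isolated_or_open[OF x] show ?thesis
  proof
    assume "\<forall>\<^sub>F x in nhds (snd a p). C.\<delta> x = 0"
    then have "\<forall>\<^sub>F q in nhds p. C.\<delta> (snd a q) = 0" by (rule eventually_compose_filterlim[OF _ lim])
    with dom have "\<forall>\<^sub>F q in nhds p. kaehler_angle A B \<omega> F q = 0" by eventually_elim (simp add: iff)
    then show ?thesis ..
  next
    assume "\<forall>\<^sub>F x in at (snd a p). C.\<delta> x \<noteq> 0"
    then have "\<forall>\<^sub>F x in nhds (snd a p). x \<noteq> snd a p \<longrightarrow> C.\<delta> x \<noteq> 0" by (simp add: eventually_at_filter)
    then have "\<forall>\<^sub>F q in nhds p. snd a q \<noteq> snd a p \<longrightarrow> C.\<delta> (snd a q) \<noteq> 0" by (rule eventually_compose_filterlim[OF _ lim])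
    with dom have "\<forall>\<^sub>F q in nhds p. q \<noteq> p \<longrightarrow> kaehler_angle A B \<omega> F q \<noteq> 0"
    proof eventually_elim
      case (elim q)
      have "snd a q \<noteq> snd a p" if "q \<noteq> p"
        using inj_onD[OF chart_inj[OF chart_A[OF ac(1)]], of q p] that elim(1) ac(3) by (auto simp: dom_def)
      then show ?case using elim iff by blast
    qed
    then show ?thesis by (simp add: eventually_at_filter)
  qed
qed

theorem proposition4p1:
  fixes B :: "('m::{t2_space,second_countable_topology}, complex^2) chart set"
    and \<omega> :: "'m form2"
    and A :: "('s::{t2_space,second_countable_topology}, real^2) chart set"
    and F :: "'s \<Rightarrow> 'm"
  assumes "kaehler_surface B \<omega>"
    and "closed_oriented_surface A"
    and "symplectic_critical_surface A B \<omega> F"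
    and "\<not> holomorphic_curve A B \<omega> F"
  shows "finite (complex_points A B \<omega> F)"
proof -
  let ?\<alpha> = "kaehler_angle A B \<omega> F"
  have comp: "compact (UNIV :: 's set)" and conn: "connected (UNIV :: 's set)"
    using assms(2) by (simp_all add: closed_oriented_surface_def)
  note dich = complex_point_dichotomy[OF assms(1-3)]
  \<comment> \<open>The interior of the set of complex points. Its complement is open too: around a
    point that is not interior, the dichotomy leaves no other complex point nearby.\<close>
  define I where "I = {p. \<forall>\<^sub>F q in nhds p. ?\<alpha> q = 0}"
  have "open I"
  proof (subst open_subopen, rule ballI)
    fix p assume "p \<in> I"
    then have "\<forall>\<^sub>F q in nhds p. q \<in> I" by (simp add: I_def eventually_eventually)
    then show "\<exists>T. open T \<and> p \<in> T \<and> T \<subseteq> I" by (auto simp: eventually_nhds)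
  qed
  moreover have "open (- I)"
  proof (subst open_subopen, rule ballI)
    fix p assume p: "p \<in> - I"
    then have "\<forall>\<^sub>F q in at p. ?\<alpha> q \<noteq> 0" using dich[of p] by (simp add: I_def)
    then have "\<forall>\<^sub>F q in nhds p. q \<noteq> p \<longrightarrow> ?\<alpha> q \<noteq> 0" by (simp add: eventually_at_filter)
    then have "\<forall>\<^sub>F q in nhds p. q \<in> - I"
    proof eventually_elim
      case (elim q)
      show ?case using elim p eventually_nhds_x_imp_x[of "\<lambda>q. ?\<alpha> q = 0" q] by (auto simp: I_def)
    qed
    then show "\<exists>T. open T \<and> p \<in> T \<and> T \<subseteq> - I" by (auto simp: eventually_nhds)
  qed
  ultimately have "I = {} \<or> I = UNIV"
    using conn unfolding connected_clopen by (simp add: closed_def)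
  moreover have "I \<noteq> UNIV"
  proof
    assume "I = UNIV"
    then have "?\<alpha> p = 0" for p
      using eventually_nhds_x_imp_x[of "\<lambda>q. ?\<alpha> q = 0" p] by (auto simp: I_def)
    then have "holomorphic_curve A B \<omega> F"
      using assms(3) by (simp add: holomorphic_curve_def symplectic_critical_surface_def symplectic_surface_def)
    then show False using assms(4) by simp
  qed
  ultimately have "I = {}" by simp
  \<comment> \<open>With no interior complex points, the dichotomy isolates every point of the
    surface from the other complex points.\<close>
  then have "\<exists>V. open V \<and> p \<in> V \<and> (\<forall>q\<in>V. q \<noteq> p \<longrightarrow> ?\<alpha> q \<noteq> 0)" for p
    using dich[of p] by (auto simp: I_def eventually_at_filter eventually_nhds)
  then obtain V where V: "\<And>p. open (V p)" "\<And>p. p \<in> V p" "\<And>p q. q \<in> V p \<Longrightarrow> q \<noteq> p \<Longrightarrow> ?\<alpha> q \<noteq> 0"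
    by metis
  \<comment> \<open>Each \<open>V p\<close> contains no complex point except possibly
    \<open>p\<close>, so a finite subcover lists all of them among its centres.\<close>
  obtain C where C: "finite C" "UNIV \<subseteq> (\<Union>p\<in>C. V p)"
    by (rule compactE_image[OF comp, of UNIV V]) (use V(1,2) in auto)
  have "complex_points A B \<omega> F \<subseteq> C"
  proof
    fix q assume "q \<in> complex_points A B \<omega> F"
    then have q: "?\<alpha> q = 0" by (simp add: complex_points_def)
    obtain p where "p \<in> C" "q \<in> V p" using C(2) by blast
    then show "q \<in> C" using V(3)[of q p] q by (cases "q = p") auto
  qed
  then show ?thesis using C(1) finite_subset by blast
qed

end
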